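(* Let $\boldsymbol i\in\mathcal I_n$, $A\in\mathrm{SetPar}_n$ and $1\le a<n$. Then the following hold in $\mathcal Y_{d,n}(q)$ (for all indices for which the expressions are defined): 1. $\Phi_a\overline e(\boldsymbol i,A)=\overline e(\sigma_a(\boldsymbol i,A))\Phi_a$. 2. $\Phi_aX_b=X_b\Phi_a$ if $b\ne a,a+1$. 3. $\Phi_a\Phi_b=\Phi_b\Phi_a$ if $|a-b|>1$. 4. $\Phi_aX_{a+1}\overline e(\boldsymbol i,A)=X_a\Phi_a\overline e(\boldsymbol i,A)$ if ($i_a\ne i_{a+1}$ and $a\sim_Aa+1$) or $a\not\sim_Aa+1$; and $\Phi_aX_{a+1}\overline e(\boldsymbol i,A)=(X_a\Phi_a+qX_{a+1}-X_a)\overline e(\boldsymbol i,A)$ if $i_a=i_{a+1}$, $a\sim_Aa+1$. 5. $X_{a+1}\Phi_a\overline e(\boldsymbol i,A)=\Phi_aX_a\overline e(\boldsymbol i,A)$ if ($i_a\ne i_{a+1}$ and $a\sim_Aa+1$) or $a\not\sim_Aa+1$; and $X_{a+1}\Phi_a\overline e(\boldsymbol i,A)=(\Phi_aX_a+qX_{a+1}-X_a)\overline e(\boldsymbol i,A)$ if $i_a=i_{a+1}$, $a\sim_Aa+1$. 6. $\Phi_a^2\overline e(\boldsymbol i,A)=\begin{cases}\dfrac{(qX_a-X_{a+1})(X_a-qX_{a+1})}{(X_a-X_{a+1})^2}\overline e(\boldsymbol i,A)&\text{if }i_a\ne i_{a+1},\ a\sim_Aa+1,\\(q+1)\Phi_a\overline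 e(\boldsymbol i,A)&\text{if }i_a=i_{a+1},\ a\sim_Aa+1,\\ q\,\overline e(\boldsymbol i,A)&\text{if }a\not\sim_Aa+1.\end{cases}$ 7. (for $a\le n-2$) $\Phi_a\Phi_{a+1}\Phi_a\overline e(\boldsymbol i,A)=\begin{cases}(\Phi_{a+1}\Phi_a\Phi_{a+1}+q\Phi_a-q\Phi_{a+1})\overline e(\boldsymbol i,A)&\text{if }i_a=i_{a+1}=i_{a+2},\ a\sim_Aa+1\sim_Aa+2,\\(\Phi_{a+1}\Phi_a\Phi_{a+1}+Z_a)\overline e(\boldsymbol i,A)&\text{if }i_a=i_{a+2}\ne i_{a+1},\ a\sim_Aa+1\sim_Aa+2,\\ \Phi_{a+1}\Phi_a\Phi_{a+1}\overline e(\boldsymbol i,A)&\text{otherwise,}\end{cases}$ where $Z_a=(1-q)^2\dfrac{(X_aX_{a+2}-X_{a+1}^2)(X_aX_{a+1}-qX_{a+1}X_{a+2})}{(X_a-X_{a+1})^2(X_{a+1}-X_{a+2})^2}$. The same formulas hold with $A\in\mathrm{SetPar}_n$ replaced by $A^{\mathrm{ord}}\in\mathrm{OrdSetPar}_n$ (i.e. with $\overline e(\boldsymbol i,A)$ replaced by $\overline e(\boldsymbol i,A^{\mathrm{ord}})$, the conditions $\sim_A$ referring to the underlying set partition $A$ of $A^{\mathrm{ord}}$).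
   Context: **Yokonuma–Hecke algebra.** $n,d$ are positive integers, $\Bbbk$ is a field with $d$ coprime to $\mathrm{char}\,\Bbbk$ containing a primitive $d$-th root of unity $\xi$, and $q\in\Bbbk^\times$, $q\neq1$. $\mathcal Y_{d,n}(q)$ is the $\Bbbk$-algebra generated by $g_1,\dots,g_{n-1},t_1,\dots,t_n$ with relations $t_a^d=1$; $t_at_b=t_bt_a$; $t_ag_b=g_bt_{\sigma_b(a)}$; $g_a^2=q+(q-1)e_ag_a$; $g_ag_bg_a=g_bg_ag_b$ if $|a-b|=1$; $g_ag_b=g_bg_a$ if $|a-b|>1$, where $\sigma_b=(b,b+1)$ and $e_a=\frac1d\sum_{r=0}^{d-1}t_a^rt_{a+1}^{-r}$. Put $X_1=1$, $X_{a+1}=q^{-1}g_aX_ag_a$; the elements $X_1,\dots,X_n,t_1,\dots,t_n$ commute and each $X_a$ is invertible. **Idempotents.** Let $e=\min\{m\ge1:1+q+\dots+q^{m-1}=0\}$ ($e=0$ if none), $I=\mathbb Z/e\mathbb Z$, $\mathcal I_n=I^n$, $\mathcal J_n=(\mathbb Z/d\mathbb Z)^n$. $\{e(\boldsymbol i)\}_{\boldsymbol i\in\mathcal I_n}$ is the complete family of orthogonal idempotents (some possibly zero) with $e(\boldsymbol i)\mathcal Y_{d,n}(q)=\{x:(X_a-q^{i_a})^Nx=0\text{ for all }a,\ N\gg0\}$, and $\{e(\boldsymbol j)\}_{\boldsymbol j\in\mathcal J_n}$ the complete family of orthogonal idempotents with $e(\boldsymbol j)\mathcal Y_{d,n}(q)=\{x:t_ax=\xi^{j_a}x\text{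 for all }a\}$. All these commute with each other and with the $X_a,t_a$. $\mathrm{SetPar}_n$ is the set of set partitions of $\{1,\dots,n\}$, $a\sim_Ab$ means same block of $A$; $\mathrm{OrdSetPar}_n$ is the set of ordered set partitions $A^{\mathrm{ord}}=(A_1,\dots,A_k)$, with underlying set partition $A=\{A_1,\dots,A_k\}$. $\overline e(A)=\sum e(\boldsymbol j)$ over $\boldsymbol j\in\mathcal J_n$ with ($j_a=j_b\Leftrightarrow a\sim_Ab$). $\overline e(A^{\mathrm{ord}})=\sum e(\boldsymbol j)$ over $\boldsymbol j\in\mathcal J_n$ such that, representing the entries of $\boldsymbol j$ by integers in $\{1,\dots,d\}$, deleting the empty sets from the tuple $(\{a:j_a=1\},\dots,\{a:j_a=d\})$ gives $A^{\mathrm{ord}}$. $\overline e(\boldsymbol i,A)=e(\boldsymbol i)\overline e(A)$, $\overline e(\boldsymbol i,A^{\mathrm{ord}})=e(\boldsymbol i)\overline e(A^{\mathrm{ord}})$. $\mathfrak S_n$ acts on $\mathcal I_n$ by place permutation ($\sigma_a$ swaps $i_a,i_{a+1}$), on (ordered) set partitions by permuting $\{1,\dots,n\}$, and on pairs diagonally. **Intertwiners.** If $i_a\ne i_{a+1}$ then $1-X_aX_{a+1}^{-1}$ (equivalently $X_a-X_{a+1}$) is invertible on $e(\boldsymbol i)\mathcal Y_{d,n}(q)$, and fractions are understood via this inverse. For $1\le a<n$, $$\Phi_a=g_a+(1-q)\sum_{\substack{\boldsymbol i\in\mathcal I_n,\,A\in\mathrm{SetPar}_n\\ i_a\ne i_{a+1},\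 a\sim_Aa+1}}(1-X_aX_{a+1}^{-1})^{-1}\overline e(\boldsymbol i,A)+\sum_{\substack{\boldsymbol i\in\mathcal I_n,\,A\in\mathrm{SetPar}_n\\ i_a=i_{a+1},\ a\sim_Aa+1}}\overline e(\boldsymbol i,A).$$ *)

theory Defs
  imports
    "HOL-Algebra.QuotRing"
    "HOL-Algebra.Free_Abelian_Groups"
    "HOL-Library.Poly_Mapping"
    "HOL-Library.Disjoint_Sets"
    "HOL-Combinatorics.Transposition"
begin

section \<open>Free associative algebras\<close>

text \<open>
  Words form a monoid under concatenation, written additively because the convolution
  product on \<^typ>\<open>'a \<Rightarrow>\<^sub>0 'b\<close> is stated for the class \<^class>\<open>monoid_add\<close>.
  Thus \<^typ>\<open>'g list \<Rightarrow>\<^sub>0 'k\<close> is the free associative unital algebra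
  on the elements of \<^typ>\<open>'g\<close>.
\<close>

instantiation list :: (type) monoid_add
begin

definition zero_list :: "'a list" where "zero_list = []"

definition plus_list :: "'a list \<Rightarrow> 'a list \<Rightarrow> 'a list" where "plus_list xs ys = xs @ ys"

instance
  by standard (simp_all add: zero_list_def plus_list_def)

end

definition free_algebra :: "'g set \<Rightarrow> ('g list \<Rightarrow>\<^sub>0 'k::field) ring" where
  "free_algebra S =
     \<lparr>carrier = {p. \<forall>w \<in> Poly_Mapping.keys p. set w \<subseteq> S},
      monoid.mult = (*), one = 1, ring.zero = 0, add = (+)\<rparr>"

definition var :: "'g \<Rightarrow> ('g list \<Rightarrow>\<^sub>0 'k::field)" where
  "var x = Poly_Mapping.single [x] 1"

definition const :: "'k \<Rightarrow> ('g list \<Rightarrow>\<^sub>0 'k::field)" where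
  "const c = Poly_Mapping.single [] c"


section \<open>Idempotents and fractions\<close>

text \<open>
  Sum of a family with finite support over a possibly infinite index set.
\<close>

definition gfinsum :: "('a, 'm) ring_scheme \<Rightarrow> ('s \<Rightarrow> 'a) \<Rightarrow> 's set \<Rightarrow> 'a" where
  "gfinsum R f S = gfinprod (add_monoid R) f S"

definition complete_orthogonal_idempotents ::
    "('a, 'm) ring_scheme \<Rightarrow> 's set \<Rightarrow> ('s \<Rightarrow> 'a) \<Rightarrow> bool" where
  "complete_orthogonal_idempotents R S e \<longleftrightarrow>
     e \<in> S \<rightarrow> carrier R \<and>
     (\<forall>s\<in>S. e s \<otimes>\<^bsub>R\<^esub> e s = e s) \<and>
     (\<forall>s\<in>S. \<forall>s'\<in>S. s \<noteq> s' \<longrightarrow> e s \<otimes>\<^bsub>R\<^esub> e s' = \<zero>\<^bsub>R\<^esub>) \<and>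
     finite {s\<in>S. e s \<noteq> \<zero>\<^bsub>R\<^esub>} \<and>
     gfinsum R e S = \<one>\<^bsub>R\<^esub>"

text \<open>
  If left multiplication by \<open>v\<close> is a bijection of the right ideal \<open>f R\<close>, then
  \<open>inv_on R f v\<close> is the inverse bijection; the product \<open>(u / v) x\<close> for \<open>x \<in> f R\<close> is
  written \<open>u \<otimes> inv_on R f v x\<close>.
\<close>

definition inv_on :: "('a, 'm) ring_scheme \<Rightarrow> 'a \<Rightarrow> 'a \<Rightarrow> 'a \<Rightarrow> 'a" where
  "inv_on R f v = the_inv_into (f <#\<^bsub>R\<^esub> carrier R) (\<lambda>z. v \<otimes>\<^bsub>R\<^esub> z)"


section \<open>Set partitions\<close>

definition SetPar :: "nat \<Rightarrow> nat set set set" where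
  "SetPar n = {A. partition_on {1..n} A}"

definition OrdSetPar :: "nat \<Rightarrow> nat set list set" where
  "OrdSetPar n = {As. distinct As \<and> partition_on {1..n} (set As)}"

definition same_block :: "nat set set \<Rightarrow> nat \<Rightarrow> nat \<Rightarrow> bool" where
  "same_block A a b \<longleftrightarrow> (\<exists>B\<in>A. a \<in> B \<and> b \<in> B)"


section \<open>The Yokonuma--Hecke algebra\<close>

datatype gen = GenG nat | GenT nat

definition primitive_root_of_unity :: "nat \<Rightarrow> 'k::field \<Rightarrow> bool" where
  "primitive_root_of_unity d \<xi> \<longleftrightarrow> \<xi> ^ d = 1 \<and> (\<forall>m. 0 < m \<and> m < d \<longrightarrow> \<xi> ^ m \<noteq> 1)"

definition quantum_char :: "'k::field \<Rightarrow> nat" where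
  "quantum_char q =
     (if \<exists>m\<ge>1. (\<Sum>k<m. q ^ k) = 0 then LEAST m. 1 \<le> m \<and> (\<Sum>k<m. q ^ k) = 0 else 0)"

context
  fixes d n :: nat and q \<xi> :: "'k::field"
begin

definition YH_gens :: "gen set" where
  "YH_gens = GenG ` {1..<n} \<union> GenT ` {1..n}"

text \<open>
  In the free algebra the generators \<open>t\<^sub>a\<close> are not yet invertible, so \<open>t\<^sub>a\<^sub>+\<^sub>1\<^sup>-\<^sup>r\<close> is
  written \<open>t\<^sub>a\<^sub>+\<^sub>1\<^sup>d\<^sup>-\<^sup>r\<close>; the two agree once \<open>t\<^sub>a\<^sub>+\<^sub>1\<^sup>d = 1\<close>.
\<close>

definition YH_relators :: "(gen list \<Rightarrow>\<^sub>0 'k) set" where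
  "YH_relators =
     (let g = (\<lambda>a. var (GenG a)); t = (\<lambda>a. var (GenT a));
          e = (\<lambda>a. const (inverse (of_nat d)) * (\<Sum>r<d. t a ^ r * t (a + 1) ^ (d - r)))
      in {t a ^ d - 1 | a. a \<in> {1..n}}
       \<union> {t a * t b - t b * t a | a b. a \<in> {1..n} \<and> b \<in> {1..n}}
       \<union> {t a * g b - g b * t (Transposition.transpose b (b + 1) a) | a b.
            a \<in> {1..n} \<and> b \<in> {1..<n}}
       \<union> {g a ^ 2 - (const q + const (q - 1) * e a * g a) | a. a \<in> {1..<n}}
       \<union> {g a * g b * g a - g b * g a * g b | a b.
            a \<in> {1..<n} \<and> b \<in> {1..<n} \<and> \<bar>int a - int b\<bar> = 1}
       \<union> {g a * g b - g b * g a | a b.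
            a \<in> {1..<n} \<and> b \<in> {1..<n} \<and> \<bar>int a - int b\<bar> > 1})"

definition YH_ideal :: "(gen list \<Rightarrow>\<^sub>0 'k) set" where
  "YH_ideal = genideal (free_algebra YH_gens) YH_relators"

definition YH :: "(gen list \<Rightarrow>\<^sub>0 'k) set ring" where
  "YH = free_algebra YH_gens Quot YH_ideal"

definition YH_class :: "(gen list \<Rightarrow>\<^sub>0 'k) \<Rightarrow> (gen list \<Rightarrow>\<^sub>0 'k) set" where
  "YH_class p = YH_ideal +>\<^bsub>free_algebra YH_gens\<^esub> p"

definition YH_scalar :: "'k \<Rightarrow> (gen list \<Rightarrow>\<^sub>0 'k) set" where
  "YH_scalar c = YH_class (const c)"

definition YH_g :: "nat \<Rightarrow> (gen list \<Rightarrow>\<^sub>0 'k) set" where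
  "YH_g a = YH_class (var (GenG a))"

definition YH_t :: "nat \<Rightarrow> (gen list \<Rightarrow>\<^sub>0 'k) set" where
  "YH_t a = YH_class (var (GenT a))"

text \<open>Only the values at \<open>1, \<dots>, n\<close> are meaningful.\<close>

fun YH_X :: "nat \<Rightarrow> (gen list \<Rightarrow>\<^sub>0 'k) set" where
  "YH_X 0 = \<one>\<^bsub>YH\<^esub>"
| "YH_X (Suc 0) = \<one>\<^bsub>YH\<^esub>"
| "YH_X (Suc (Suc a)) =
     YH_scalar (inverse q) \<otimes>\<^bsub>YH\<^esub> YH_g (Suc a) \<otimes>\<^bsub>YH\<^esub> YH_X (Suc a) \<otimes>\<^bsub>YH\<^esub> YH_g (Suc a)"

text \<open>
  Residue classes are represented by canonical representatives: \<open>\<int>/e\<int>\<close> by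
  \<open>{0, \<dots>, e - 1}\<close> (by all of \<open>\<int>\<close> if \<open>e = 0\<close>) and \<open>\<int>/d\<int>\<close> by \<open>{1, \<dots>, d}\<close>.
  Hence equality of residue classes is equality of representatives.
\<close>

definition YH_I :: "(nat \<Rightarrow> int) set" where
  "YH_I = {1..n} \<rightarrow>\<^sub>E (if quantum_char q = 0 then UNIV else {0..<int (quantum_char q)})"

definition YH_J :: "(nat \<Rightarrow> nat) set" where
  "YH_J = {1..n} \<rightarrow>\<^sub>E {1..d}"

definition YH_eI :: "(nat \<Rightarrow> int) \<Rightarrow> (gen list \<Rightarrow>\<^sub>0 'k) set" where
  "YH_eI = (THE e. e \<in> YH_I \<rightarrow>\<^sub>E carrier YH \<and>
     complete_orthogonal_idempotents YH YH_I e \<and>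
     (\<forall>i\<in>YH_I. e i <#\<^bsub>YH\<^esub> carrier YH =
        {x \<in> carrier YH. \<forall>a\<in>{1..n}. \<exists>N\<^sub>0::nat. \<forall>N\<ge>N\<^sub>0.
           (YH_X a \<ominus>\<^bsub>YH\<^esub> YH_scalar (q powi i a)) [^]\<^bsub>YH\<^esub> N \<otimes>\<^bsub>YH\<^esub> x = \<zero>\<^bsub>YH\<^esub>}))"

definition YH_eJ :: "(nat \<Rightarrow> nat) \<Rightarrow> (gen list \<Rightarrow>\<^sub>0 'k) set" where
  "YH_eJ = (THE e. e \<in> YH_J \<rightarrow>\<^sub>E carrier YH \<and>
     complete_orthogonal_idempotents YH YH_J e \<and>
     (\<forall>j\<in>YH_J. e j <#\<^bsub>YH\<^esub> carrier YH =
        {x \<in> carrier YH. \<forall>a\<in>{1..n}. YH_t a \<otimes>\<^bsub>YH\<^esub> x = YH_scalar (\<xi> ^ j a) \<otimes>\<^bsub>YH\<^esub> x}))"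

definition YH_ePar :: "nat set set \<Rightarrow> (gen list \<Rightarrow>\<^sub>0 'k) set" where
  "YH_ePar A = finsum YH YH_eJ
     {j \<in> YH_J. \<forall>a\<in>{1..n}. \<forall>b\<in>{1..n}. j a = j b \<longleftrightarrow> same_block A a b}"

definition YH_eOrd :: "nat set list \<Rightarrow> (gen list \<Rightarrow>\<^sub>0 'k) set" where
  "YH_eOrd As = finsum YH YH_eJ
     {j \<in> YH_J. filter (\<lambda>B. B \<noteq> {}) (map (\<lambda>c. {a\<in>{1..n}. j a = c}) [1..<d + 1]) = As}"

definition YH_eIPar :: "(nat \<Rightarrow> int) \<Rightarrow> nat set set \<Rightarrow> (gen list \<Rightarrow>\<^sub>0 'k) set" where
  "YH_eIPar i A = YH_eI i \<otimes>\<^bsub>YH\<^esub> YH_ePar A"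

definition YH_eIOrd :: "(nat \<Rightarrow> int) \<Rightarrow> nat set list \<Rightarrow> (gen list \<Rightarrow>\<^sub>0 'k) set" where
  "YH_eIOrd i As = YH_eI i \<otimes>\<^bsub>YH\<^esub> YH_eOrd As"

definition YH_Phi :: "nat \<Rightarrow> (gen list \<Rightarrow>\<^sub>0 'k) set" where
  "YH_Phi a =
     YH_g a
     \<oplus>\<^bsub>YH\<^esub> YH_scalar (1 - q) \<otimes>\<^bsub>YH\<^esub>
        gfinsum YH
          (\<lambda>(i, A). inv_on YH (YH_eI i)
             (\<one>\<^bsub>YH\<^esub> \<ominus>\<^bsub>YH\<^esub> YH_X a \<otimes>\<^bsub>YH\<^esub> inv\<^bsub>YH\<^esub> YH_X (a + 1)) (YH_eIPar i A))
          {(i, A). i \<in> YH_I \<and> A \<in> SetPar n \<and> i a \<noteq> i (a + 1) \<and> same_block A a (a + 1)}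
     \<oplus>\<^bsub>YH\<^esub> gfinsum YH
          (\<lambda>(i, A). YH_eIPar i A)
          {(i, A). i \<in> YH_I \<and> A \<in> SetPar n \<and> i a = i (a + 1) \<and> same_block A a (a + 1)}"

end

end

theory Submission
  imports Defs
begin

text \<open>
  An element of the algebra is determined by its left multiplication on weight vectors, that is, on
  elements \<open>v\<close> such that, for some labels \<open>i\<close> and \<open>j\<close>, every \<open>X\<^sub>a - q ^ i\<^sub>a\<close> acts nilpotently on
  \<open>v\<close> and every \<open>t\<^sub>a\<close> acts as \<open>\<xi> ^ j\<^sub>a\<close> (\<open>eq_if_eq_on_weights\<close>).  On such a vector the sums in the
  intertwiner \<open>\<Phi>\<^sub>a\<close> collapse: with \<open>b = a + 1\<close>, the vector \<open>\<Phi>\<^sub>a v\<close> is \<open>g\<^sub>a v\<close> if \<open>j\<^sub>a \<noteq> j\<^sub>b\<close>,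
  it is \<open>g\<^sub>a v + v\<close> if \<open>j\<^sub>a = j\<^sub>b\<close> and \<open>i\<^sub>a = i\<^sub>b\<close>, and it is \<open>g\<^sub>a v + c\<^sub>a\<^sub>b v\<close> with
  \<open>c\<^sub>a\<^sub>b = (q - 1) X\<^sub>b / (X\<^sub>a - X\<^sub>b)\<close> otherwise (\<open>\<Phi>_weight\<close>).  Every relation becomes a short
  computation with these three formulas.

  That weight vectors generate the algebra means that the eigenvalues of the \<open>X\<^sub>a\<close> are powers of \<open>q\<close>.
  Put \<open>\<phi> = e\<^sub>a (g\<^sub>a (X\<^sub>a - X\<^sub>b) + (q - 1) X\<^sub>b)\<close>.  Then \<open>X\<^sub>b \<phi> = \<phi> X\<^sub>a\<close> and
  \<open>\<phi>\<^sup>2 = (q X\<^sub>a - X\<^sub>b) (q X\<^sub>b - X\<^sub>a) e\<^sub>a\<close>, so if a product of factors \<open>X\<^sub>a - c\<close> vanishes, then so does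
  the product of the factors \<open>X\<^sub>b - c\<close>, \<open>X\<^sub>b - q c\<close> and \<open>X\<^sub>b - c / q\<close> (\<open>linear_factors_step\<close>).
  The resulting spectral projections lie in the bicommutant of the \<open>X\<^sub>a\<close>, hence commute with each
  other and with all \<open>t\<^sub>a\<close>.  They are the idempotents \<open>e(i)\<close> because such a family is determined by
  the right ideals that it generates (\<open>the_idempotents\<close>); the \<open>e(j)\<close> are obtained in the same way
  from the \<open>t\<^sub>a\<close>.

  From \<open>X\<^sub>b g\<^sub>a = g\<^sub>a X\<^sub>a + (q - 1) e\<^sub>a X\<^sub>b\<close> it follows that \<open>\<Phi>\<^sub>a\<close> exchanges \<open>X\<^sub>a\<close> and \<open>X\<^sub>b\<close>, exactly
  if \<open>i\<^sub>a \<noteq> i\<^sub>b\<close> or \<open>j\<^sub>a \<noteq> j\<^sub>b\<close> and up to a nilpotent error otherwise.  Hence \<open>\<Phi>\<^sub>a\<close> permutes the weights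
  (\<open>weight_\<Phi>\<close>) and the coefficients (\<open>coef_\<Phi>\<close>).  The quadratic relation then rests on
  \<open>c\<^sub>a\<^sub>b + c\<^sub>b\<^sub>a = 1 - q\<close>.  For the braid relation both sides are expanded with all coefficients on the
  right of all generators; the words in the generators agree by the braid relation of the algebra.
  If \<open>j\<^sub>a, j\<^sub>b, j\<^sub>c\<close> are not all equal, where \<open>c = b + 1\<close>, each side contains at most one coefficient,
  and these match.  If they are all equal, the coefficients agree by a partial fraction identity when \<open>i\<^sub>a, i\<^sub>b, i\<^sub>c\<close>
  are distinct.  If \<open>i\<^sub>c\<close> differs from \<open>i\<^sub>a = i\<^sub>b\<close>, or \<open>i\<^sub>a\<close> from \<open>i\<^sub>b = i\<^sub>c\<close>, the role of the missing
  coefficient is played by the commutation of a generator with a fraction.  If \<open>i\<^sub>a = i\<^sub>c \<noteq> i\<^sub>b\<close>, then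
  \<open>c\<^sub>a\<^sub>c\<close> is undefined and the two sides differ by the coefficient \<open>Z\<^sub>a\<close>; if all three agree, every
  intertwiner is a generator plus the identity.

  These computations take place in a type of class \<open>ring\<close>, where equations can be rewritten without
  membership conditions, and are carried over to the quotient ring along a bijection between the type
  and its carrier.  A type cannot depend on \<open>d\<close>, \<open>n\<close> and \<open>q\<close>; it is therefore built from one
  fixed choice of these parameters, chosen such that the relations hold for all parameters if they
  hold for this choice (\<open>critical_parameters\<close>).
\<close>

section \<open>Bicommutants and nilpotent elements\<close>

text \<open>
  Spectral projections of a commuting family, and inverses of differences on its eigenspaces, lie in
  the bicommutant of the family.  This one fact makes them commute with each other and with
  everything that commutes with the family.
\<close>

definition bicommutant :: "'a::semigroup_mult set \<Rightarrow> 'a set" where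
  "bicommutant S = {z. \<forall>y. (\<forall>s\<in>S. s * y = y * s) \<longrightarrow> z * y = y * z}"

lemma bicommutantD: "z \<in> bicommutant S \<Longrightarrow> (\<And>s. s \<in> S \<Longrightarrow> s * y = y * s) \<Longrightarrow> z * y = y * z"
  by (simp add: bicommutant_def)

lemma bicommutant_base: "s \<in> S \<Longrightarrow> s \<in> bicommutant S"
  by (simp add: bicommutant_def)

lemma bicommutant_commute:
  assumes "\<And>s s'. s \<in> S \<Longrightarrow> s' \<in> S \<Longrightarrow> s * s' = s' * s"
    and "x \<in> bicommutant S" and "y \<in> bicommutant S"
  shows "x * y = y * x"
proof (rule bicommutantD[OF assms(2)])
  fix s assume "s \<in> S"
  then show "s * y = y * s"
    using bicommutantD[OF assms(3), of s] assms(1) by simp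
qed

lemma bicommutant_mult:
  fixes x y :: "'a::semigroup_mult"
  assumes "x \<in> bicommutant S" "y \<in> bicommutant S"
  shows "x * y \<in> bicommutant S"
proof -
  have "x * y * z = z * (x * y)" if "\<forall>s\<in>S. s * z = z * s" for z
  proof -
    have "x * y * z = x * z * y"
      using bicommutantD[OF assms(2), of z] that by (simp add: mult.assoc)
    also have "\<dots> = z * x * y"
      using bicommutantD[OF assms(1), of z] that by simp
    finally show ?thesis by (simp add: mult.assoc)
  qed
  then show ?thesis by (simp add: bicommutant_def)
qed

context
  fixes S :: "'a::{ring,monoid_mult} set"
begin

lemma bicommutant_one: "1 \<in> bicommutant S"
  and bicommutant_zero: "0 \<in> bicommutant S"
  and bicommutant_add: "x \<in> bicommutant S \<Longrightarrow> y \<in> bicommutant S \<Longrightarrow> x + y \<in> bicommutant S"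
  and bicommutant_diff: "x \<in> bicommutant S \<Longrightarrow> y \<in> bicommutant S \<Longrightarrow> x - y \<in> bicommutant S"
  and bicommutant_minus: "x \<in> bicommutant S \<Longrightarrow> - x \<in> bicommutant S"
  by (simp_all add: bicommutant_def algebra_simps)

lemma bicommutant_sum: "(\<And>s. s \<in> T \<Longrightarrow> f s \<in> bicommutant S) \<Longrightarrow> sum f T \<in> bicommutant S"
  by (induction T rule: infinite_finite_induct) (auto intro: bicommutant_zero bicommutant_add)

lemma bicommutant_power: "x \<in> bicommutant S \<Longrightarrow> x ^ m \<in> bicommutant S"
  by (induction m) (auto intro: bicommutant_one bicommutant_mult)

end

lemma power_commutes_left:
  fixes x y :: "'a::monoid_mult"
  assumes "x * y = y * x"
  shows "x ^ m * y = y * x ^ m"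
  using power_commuting_commutes[OF assms] by simp

text \<open>
  The geometric series inverts \<open>u - y\<close> wherever \<open>u\<close> is invertible (with inverse \<open>w\<close>) and
  \<open>y\<close> is nilpotent.
\<close>

lemma inverse_of_unit_minus_nilpotent:
  fixes u w y e :: "'a::{ring,monoid_mult}"
  assumes uy: "u * y = y * u" and uw: "u * w * e = e" and we: "w * e = e * w"
    and nil: "y ^ N * e = 0"
  shows "(u - y) * (\<Sum>k<N. y ^ k * w ^ Suc k) * e = e"
proof -
  have uwk: "u * w ^ Suc k * e = w ^ k * e" for k
  proof -
    have "u * w ^ Suc k * e = u * w * (w ^ k * e)" by (simp add: mult.assoc)
    also have "\<dots> = u * w * (e * w ^ k)" using power_commutes_left[OF we, of k] by simp
    also have "\<dots> = u * w * e * w ^ k" by (simp only: mult.assoc)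
    finally show ?thesis using uw power_commutes_left[OF we, of k] by simp
  qed
  have step: "(u - y) * (y ^ k * w ^ Suc k) * e = y ^ k * w ^ k * e - y ^ Suc k * w ^ Suc k * e" for k
  proof -
    have "u * (y ^ k * w ^ Suc k) * e = y ^ k * (u * w ^ Suc k * e)"
      using power_commutes_left[of y u k] uy by (metis mult.assoc)
    moreover have "y * (y ^ k * w ^ Suc k) * e = y ^ Suc k * w ^ Suc k * e" by (simp add: mult.assoc)
    ultimately show ?thesis
      by (simp only: left_diff_distrib uwk) (simp only: mult.assoc)
  qed

  have "(u - y) * (\<Sum>k<N. y ^ k * w ^ Suc k) * e = (\<Sum>k<N. y ^ k * w ^ k * e - y ^ Suc k * w ^ Suc k * e)"
    using step by (simp only: sum_distrib_left sum_distrib_right)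
  also have "\<dots> = e - y ^ N * w ^ N * e"
    by (subst sum_lessThan_telescope') simp
  also have "y ^ N * w ^ N * e = y ^ N * (e * w ^ N)"
    using power_commutes_left[OF we, of N] by (simp add: mult.assoc)
  also have "\<dots> = 0" using nil by (simp add: mult.assoc[symmetric])
  finally show ?thesis by simp
qed

section \<open>Joint spectral idempotents\<close>

text \<open>
  A family of commuting operators on the left regular representation, indexed by \<open>A\<close>, is given only
  through its eigenspaces: \<open>Z b k v\<close> says that \<open>v\<close> lies in the eigenspace of the operator \<open>b\<close> with
  label \<open>k\<close>.  The commutative set \<open>C\<close> contains the spectral projections of the single operators.
  The same argument thus serves for genuine eigenspaces and for generalised ones.
\<close>

locale joint_spectrum =
  fixes A :: "'b set" and L :: "'l set" and C :: "'a::{ring,monoid_mult} set"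
    and Z :: "'b \<Rightarrow> 'l \<Rightarrow> 'a \<Rightarrow> bool"
  assumes finite_A: "finite A"
    and C_one: "1 \<in> C" and C_zero: "0 \<in> C"
    and C_mult: "x \<in> C \<Longrightarrow> y \<in> C \<Longrightarrow> x * y \<in> C"
    and C_commute: "x \<in> C \<Longrightarrow> y \<in> C \<Longrightarrow> x * y = y * x"
    and Z_zero: "Z b k 0"
    and Z_left: "b \<in> A \<Longrightarrow> Z b k v \<Longrightarrow> x \<in> C \<Longrightarrow> Z b k (x * v)"
    and Z_right: "Z b k v \<Longrightarrow> Z b k (v * y)"
    and Z_disjoint: "b \<in> A \<Longrightarrow> k \<in> L \<Longrightarrow> k' \<in> L \<Longrightarrow> k \<noteq> k' \<Longrightarrow> Z b k v \<Longrightarrow> Z b k' v \<Longrightarrow> v = 0"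
    and Z_decomp: "b \<in> A \<Longrightarrow>
      \<exists>K p. finite K \<and> K \<subseteq> L \<and> (\<forall>k\<in>K. p k \<in> C \<and> Z b k (p k)) \<and> sum p K = 1"
begin

definition joint_eigen :: "('b \<Rightarrow> 'l) \<Rightarrow> 'a \<Rightarrow> bool" where
  "joint_eigen s v \<longleftrightarrow> (\<forall>b\<in>A. Z b (s b) v)"

text \<open>
  The products of the spectral projections of the single operators decompose the unit.
\<close>

lemma joint_decomposition:
  assumes "finite B" "B \<subseteq> A"
  shows "\<exists>T p. finite T \<and> T \<subseteq> B \<rightarrow>\<^sub>E L \<and> (\<forall>s\<in>T. p s \<in> C \<and> (\<forall>b\<in>B. Z b (s b) (p s))) \<and> sum p T = 1"
  using assms
proof (induction B)
  case empty
  show ?case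
    by (rule exI[of _ "{\<lambda>x. undefined}"], rule exI[of _ "\<lambda>_. 1"]) (simp add: C_one)
next
  case (insert b B)
  then obtain T p where T: "finite T" "T \<subseteq> B \<rightarrow>\<^sub>E L"
    and p: "\<And>s. s \<in> T \<Longrightarrow> p s \<in> C" "\<And>s c. s \<in> T \<Longrightarrow> c \<in> B \<Longrightarrow> Z c (s c) (p s)" and sp: "sum p T = 1"
    by (metis insert_subset)
  obtain K r where K: "finite K" "K \<subseteq> L" and r: "\<And>k. k \<in> K \<Longrightarrow> r k \<in> C" "\<And>k. k \<in> K \<Longrightarrow> Z b k (r k)"
    and sr: "sum r K = 1"
    using Z_decomp[of b] insert.prems by (metis insert_subset)
  define ext where "ext = (\<lambda>(s, k). s(b := k) :: 'b \<Rightarrow> 'l)"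
  define p' where "p' s = r (s b) * p (restrict s B)" for s
  have restr: "restrict (s(b := k)) B = s" if "s \<in> T" for s k
    using that T(2) insert.hyps(2) by (fastforce simp: PiE_def extensional_def restrict_def fun_eq_iff)
  have inj: "inj_on ext (T \<times> K)"
  proof (rule inj_onI)
    fix x y assume *: "x \<in> T \<times> K" "y \<in> T \<times> K" and eq: "ext x = ext y"
    obtain s k s' k' where xy: "x = (s, k)" "y = (s', k')" by fastforce
    have "s(b := k) = s'(b := k')" using eq xy by (simp add: ext_def)
    then have "restrict (s(b := k)) B = restrict (s'(b := k')) B" "k = k'"
      by (simp, metis fun_upd_same)
    then show "x = y" using restr * xy by simp
  qed
  have "sum p' (ext ` (T \<times> K)) = (\<Sum>(s, k)\<in>T \<times> K. r k * p s)"
    by (subst sum.reindex[OF inj]) (auto intro!: sum.cong simp: ext_def p'_def restr)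
  also have "\<dots> = (\<Sum>s\<in>T. sum r K * p s)"
    by (simp only: sum.cartesian_product[symmetric] sum_distrib_right)
  also have "\<dots> = 1" using sr sp by simp
  finally have one: "sum p' (ext ` (T \<times> K)) = 1" .
  have sub: "ext ` (T \<times> K) \<subseteq> insert b B \<rightarrow>\<^sub>E L"
    using T(2) K(2) by (auto simp: ext_def PiE_def extensional_def Pi_def subset_iff)
  have good: "p' s \<in> C \<and> (\<forall>c\<in>insert b B. Z c (s c) (p' s))" if s: "s \<in> ext ` (T \<times> K)" for s
  proof -
    obtain s0 k where sk: "s0 \<in> T" "k \<in> K" "s = s0(b := k)" using s by (auto simp: ext_def)
    have p's: "p' s = r k * p s0" using sk restr by (simp add: p'_def)
    have comm: "r k * p s0 = p s0 * r k" using C_commute r(1) p(1) sk by simp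
    have "Z c (s c) (p' s)" if "c \<in> B" for c
      using that p(2)[of s0 c] sk r(1)[of k] insert.hyps(2) insert.prems Z_left[of c] p's by auto
    moreover have "Z b (s b) (p' s)"
      using Z_right[OF r(2)[of k], of "p s0"] p's sk by simp
    ultimately show ?thesis using C_mult r(1) p(1) sk p's by auto
  qed
  show ?case
    by (rule exI[of _ "ext ` (T \<times> K)"], rule exI[of _ p']) (use T(1) K(1) one sub good in auto)
qed

lemma eigenidempotents_exist:
  "\<exists>e. (\<forall>s\<in>A \<rightarrow>\<^sub>E L. e s \<in> C \<and> joint_eigen s (e s)) \<and>
     (\<exists>T. finite T \<and> T \<subseteq> A \<rightarrow>\<^sub>E L \<and> (\<forall>s. s \<notin> T \<longrightarrow> e s = 0) \<and> sum e T = 1)"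
proof -
  obtain T p where T: "finite T" "T \<subseteq> A \<rightarrow>\<^sub>E L"
    and p: "\<And>s. s \<in> T \<Longrightarrow> p s \<in> C" "\<And>s c. s \<in> T \<Longrightarrow> c \<in> A \<Longrightarrow> Z c (s c) (p s)" and sp: "sum p T = 1"
    using joint_decomposition[OF finite_A subset_refl] by metis
  define e where "e s = (if s \<in> T then p s else 0)" for s
  have "sum e T = 1" using sp by (simp add: e_def)
  moreover have "\<forall>s\<in>A \<rightarrow>\<^sub>E L. e s \<in> C \<and> joint_eigen s (e s)"
    using p by (auto simp: e_def joint_eigen_def Z_zero C_zero)
  moreover have "\<forall>s. s \<notin> T \<longrightarrow> e s = 0" by (simp add: e_def)
  ultimately show ?thesis using T by blast
qed

text \<open>
  On the labels in \<open>A \<rightarrow>\<^sub>E L\<close> the choice is unique: by \<open>eigenidempotent_fixes\<close> and \<open>eigenidempotent_kills\<close> below, an element of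
  the family is the projection onto its joint eigenspace along the others.
\<close>

definition eigenidempotent :: "('b \<Rightarrow> 'l) \<Rightarrow> 'a" where
  "eigenidempotent = (SOME e. (\<forall>s\<in>A \<rightarrow>\<^sub>E L. e s \<in> C \<and> joint_eigen s (e s)) \<and>
     (\<exists>T. finite T \<and> T \<subseteq> A \<rightarrow>\<^sub>E L \<and> (\<forall>s. s \<notin> T \<longrightarrow> e s = 0) \<and> sum e T = 1))"

lemma eigenidempotent_in_C: "s \<in> A \<rightarrow>\<^sub>E L \<Longrightarrow> eigenidempotent s \<in> C"
  and joint_eigen_eigenidempotent: "s \<in> A \<rightarrow>\<^sub>E L \<Longrightarrow> joint_eigen s (eigenidempotent s)"
  and eigenidempotent_finite: "\<exists>T. finite T \<and> T \<subseteq> A \<rightarrow>\<^sub>E L \<and> (\<forall>s. s \<notin> T \<longrightarrow> eigenidempotent s = 0) \<and>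
         sum eigenidempotent T = 1"
  using someI_ex[OF eigenidempotents_exist, folded eigenidempotent_def] by blast+

definition spectrum :: "('b \<Rightarrow> 'l) set" where
  "spectrum = {s \<in> A \<rightarrow>\<^sub>E L. eigenidempotent s \<noteq> 0}"

lemma finite_spectrum: "finite spectrum"
  and sum_eigenidempotent: "sum eigenidempotent spectrum = 1"
proof -
  obtain T where T: "finite T" "T \<subseteq> A \<rightarrow>\<^sub>E L" "\<forall>s. s \<notin> T \<longrightarrow> eigenidempotent s = 0"
         "sum eigenidempotent T = 1"
    using eigenidempotent_finite by blast
  have sub: "spectrum \<subseteq> T" using T(3) by (auto simp: spectrum_def)
  then show "finite spectrum" using T(1) finite_subset by blast
  have "sum eigenidempotent spectrum = sum eigenidempotent T"
    by (rule sum.mono_neutral_left) (use T sub in \<open>auto simp: spectrum_def\<close>)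
  then show "sum eigenidempotent spectrum = 1" using T(4) by simp
qed

lemma spectrum_subset: "spectrum \<subseteq> A \<rightarrow>\<^sub>E L"
  by (auto simp: spectrum_def)

lemma joint_eigen_right: "joint_eigen s v \<Longrightarrow> joint_eigen s (v * y)"
  by (auto simp: joint_eigen_def Z_right)

lemma joint_eigen_left: "joint_eigen s v \<Longrightarrow> x \<in> C \<Longrightarrow> joint_eigen s (x * v)"
  by (auto simp: joint_eigen_def Z_left)

lemma eigenidempotent_kills:
  assumes s: "s \<in> A \<rightarrow>\<^sub>E L" and s': "s' \<in> A \<rightarrow>\<^sub>E L" and "s \<noteq> s'" and v: "joint_eigen s' v"
  shows "eigenidempotent s * v = 0"
proof -
  obtain b where b: "b \<in> A" "s b \<noteq> s' b"
    using assms(3) s s' by (metis PiE_ext)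
  have "Z b (s b) (eigenidempotent s * v)"
    using joint_eigen_eigenidempotent[OF s] b(1) by (auto simp: joint_eigen_def intro: Z_right)
  moreover have "Z b (s' b) (eigenidempotent s * v)"
    using v b(1) eigenidempotent_in_C[OF s] by (auto simp: joint_eigen_def intro: Z_left)
  moreover have "s b \<in> L" "s' b \<in> L" using s s' b(1) by auto
  ultimately show ?thesis using Z_disjoint b by blast
qed

lemma eigenidempotent_fixes:
  assumes s: "s \<in> A \<rightarrow>\<^sub>E L" and v: "joint_eigen s v"
  shows "eigenidempotent s * v = v"
proof -
  have "v = (\<Sum>s'\<in>spectrum. eigenidempotent s' * v)"
    using sum_eigenidempotent by (simp add: sum_distrib_right[symmetric])
  also have "\<dots> = (\<Sum>s'\<in>spectrum. if s' = s then eigenidempotent s * v else 0)"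
    by (rule sum.cong) (use eigenidempotent_kills[OF _ s _ v] spectrum_subset in auto)
  also have "\<dots> = (if s \<in> spectrum then eigenidempotent s * v else 0)"
    by (simp add: finite_spectrum)
  also have "\<dots> = eigenidempotent s * v"
    using s by (auto simp: spectrum_def)
  finally show ?thesis by simp
qed

lemma joint_eigen_iff:
  assumes "s \<in> A \<rightarrow>\<^sub>E L"
  shows "joint_eigen s v \<longleftrightarrow> eigenidempotent s * v = v"
  using eigenidempotent_fixes[OF assms] joint_eigen_right[OF joint_eigen_eigenidempotent[OF assms]]
  by metis

lemma eigenidempotent_mult:
  assumes "s \<in> A \<rightarrow>\<^sub>E L" "s' \<in> A \<rightarrow>\<^sub>E L"
  shows "eigenidempotent s * eigenidempotent s' = (if s = s' then eigenidempotent s else 0)"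
  using eigenidempotent_fixes eigenidempotent_kills joint_eigen_eigenidempotent assms by auto

text \<open>
  The unit is a sum of joint eigenvectors.
\<close>

lemma eq_if_eq_on_eigenvectors:
  assumes "\<And>s v. s \<in> A \<rightarrow>\<^sub>E L \<Longrightarrow> joint_eigen s v \<Longrightarrow> x * v = y * v"
  shows "x = y"
proof -
  have "x = (\<Sum>s\<in>spectrum. x * eigenidempotent s)" "y = (\<Sum>s\<in>spectrum. y * eigenidempotent s)"
    using sum_eigenidempotent by (simp_all add: sum_distrib_left[symmetric])
  moreover have "x * eigenidempotent s = y * eigenidempotent s" if "s \<in> spectrum" for s
    using that assms joint_eigen_eigenidempotent spectrum_subset by blast
  ultimately show ?thesis by (metis (no_types, lifting) sum.cong)
qed

end

section \<open>Scalars and spectral decomposition\<close>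

lemma mult_eq_assoc: "a * b = c \<Longrightarrow> a * (b * w) = c * (w::'a::semigroup_mult)"
  by (metis mult.assoc)

text \<open>
  The class \<open>ring_1\<close> would force \<open>0 \<noteq> 1\<close>, which is not evident for an algebra given by generators
  and relations; hence \<open>{ring, monoid_mult}\<close> and a map \<open>\<kappa>\<close> that need not be injective.
\<close>

locale central_scalars =
  fixes \<kappa> :: "'k::field \<Rightarrow> 'a::{ring,monoid_mult}"
  assumes \<kappa>_add: "\<kappa> (x + y) = \<kappa> x + \<kappa> y"
    and \<kappa>_mult: "\<kappa> (x * y) = \<kappa> x * \<kappa> y"
    and \<kappa>_one: "\<kappa> 1 = 1"
    and \<kappa>_central: "\<kappa> x * z = z * \<kappa> x"
begin

lemma \<kappa>_left_commute: "z * (\<kappa> x * w) = \<kappa> x * (z * w)"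
  using \<kappa>_central[of x z] by (metis mult.assoc)

lemma \<kappa>_zero: "\<kappa> 0 = 0"
  using \<kappa>_add[of 0 0] by simp

lemma \<kappa>_diff: "\<kappa> (x - y) = \<kappa> x - \<kappa> y"
  using \<kappa>_add[of "x - y" y] by (simp add: algebra_simps)

lemma \<kappa>_sum: "\<kappa> (sum f T) = (\<Sum>s\<in>T. \<kappa> (f s))"
  by (induction T rule: infinite_finite_induct) (simp_all add: \<kappa>_zero \<kappa>_add)

lemma \<kappa>_left_inverse: "x \<noteq> 0 \<Longrightarrow> \<kappa> (inverse x) * \<kappa> x = 1"
  by (simp add: \<kappa>_mult[symmetric] \<kappa>_one)

lemma \<kappa>_cancel: "x \<noteq> 0 \<Longrightarrow> \<kappa> x * v = \<kappa> x * w \<longleftrightarrow> v = w"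
  by (metis \<kappa>_left_inverse mult.assoc mult_1)

lemma \<kappa>_mult_eq_zero: "x \<noteq> 0 \<Longrightarrow> \<kappa> x * v = 0 \<Longrightarrow> v = 0"
  using \<kappa>_cancel[of x v 0] by simp

lemma \<kappa>_bicommutant: "\<kappa> c \<in> bicommutant S"
  unfolding bicommutant_def using \<kappa>_central by blast

text \<open>
  By induction \<open>(x - c) w = 0\<close>, so \<open>x - c'\<close> acts on \<open>w\<close> as the invertible scalar \<open>c - c'\<close>.
\<close>

lemma generalised_eigenvectors_disjoint:
  assumes "c \<noteq> c'" "(x - \<kappa> c) ^ N * w = 0" "(x - \<kappa> c') ^ M * w = 0"
  shows "w = 0"
  using assms(2,3)
proof (induction N arbitrary: w)
  case 0
  then show ?case by simp
next
  case (Suc N)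
  let ?u = "(x - \<kappa> c) * w"
  have "(x - \<kappa> c') ^ M * ?u = (x - \<kappa> c) * ((x - \<kappa> c') ^ M * w)"
  proof -
    have "(x - \<kappa> c') * (x - \<kappa> c) = (x - \<kappa> c) * (x - \<kappa> c')"
      using \<kappa>_central[of c x] \<kappa>_central[of c' x] \<kappa>_central[of c "\<kappa> c'"] by (simp add: algebra_simps)
    from power_commutes_left[OF this, of M] show ?thesis by (simp only: mult.assoc[symmetric])
  qed
  moreover have "(x - \<kappa> c) ^ N * ?u = 0"
    using Suc.prems(1) by (simp add: mult.assoc[symmetric] power_commutes)
  ultimately have "?u = 0" using Suc.IH[of ?u] Suc.prems(2) by simp
  then have "(x - \<kappa> c') * w = \<kappa> (c - c') * w"
    by (simp add: algebra_simps \<kappa>_diff)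
  then have "(x - \<kappa> c') ^ m * w = \<kappa> ((c - c') ^ m) * w" for m
  proof (induction m)
    case 0
    then show ?case by (simp add: \<kappa>_one)
  next
    case (Suc m)
    have "(x - \<kappa> c') ^ Suc m * w = (x - \<kappa> c') * \<kappa> ((c - c') ^ m) * w"
      using Suc by (simp add: mult.assoc)
    also have "\<dots> = \<kappa> ((c - c') ^ m) * ((x - \<kappa> c') * w)"
      using \<kappa>_central[of "(c - c') ^ m" "x - \<kappa> c'"] by (simp add: mult.assoc[symmetric])
    finally show ?case using Suc.prems
      by (simp add: \<kappa>_mult mult.assoc[symmetric] \<kappa>_central[of "(c - c') ^ m" "\<kappa> (c - c')"])
  qed
  then show ?case
    using Suc.prems(2) \<kappa>_mult_eq_zero[of "(c - c') ^ M" w] assms(1) by simp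
qed

text \<open>
  On the generalised eigenspace of \<open>x\<close> at \<open>c'\<close>, the element \<open>x - c = (c' - c) + (x - c')\<close>
  is a nonzero scalar plus a nilpotent.
\<close>

lemma shifted_inverse:
  assumes "c \<noteq> c'" "(x - \<kappa> c') ^ N * p = 0" and x: "x \<in> bicommutant S"
  shows "\<exists>r\<in>bicommutant S. (x - \<kappa> c) * r * p = p"
proof -
  let ?w = "\<kappa> (inverse (c' - c))" and ?y = "\<kappa> c' - x"
  let ?r = "\<Sum>k<N. ?y ^ k * ?w ^ Suc k"
  have "(- z) ^ m = z ^ m \<or> (- z) ^ m = - (z ^ m)" for z :: 'a and m
    by (induction m) auto
  from this[of "x - \<kappa> c'" N] have nil: "?y ^ N * p = 0" using assms(2) by auto
  have "(\<kappa> (c' - c) - ?y) * ?r * p = p"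
    by (rule inverse_of_unit_minus_nilpotent[OF \<kappa>_central _ \<kappa>_central nil])
      (use assms(1) in \<open>simp add: \<kappa>_mult[symmetric] \<kappa>_one\<close>)
  moreover have "\<kappa> (c' - c) - ?y = x - \<kappa> c" by (simp add: \<kappa>_diff)
  moreover have "?r \<in> bicommutant S"
    by (intro bicommutant_sum bicommutant_mult bicommutant_power bicommutant_diff \<kappa>_bicommutant x)
  ultimately show ?thesis by auto
qed

definition linear_factors :: "'k list \<Rightarrow> 'a \<Rightarrow> 'a" where
  "linear_factors cs x = prod_list (map (\<lambda>c. x - \<kappa> c) cs)"

lemma linear_factors_simps [simp]:
  "linear_factors [] x = 1"
  "linear_factors (c # cs) x = (x - \<kappa> c) * linear_factors cs x"
  "linear_factors (cs @ ds) x = linear_factors cs x * linear_factors ds x"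
  by (simp_all add: linear_factors_def)

lemma linear_factors_intertwine: "y * f = f * x \<Longrightarrow> linear_factors cs y * f = f * linear_factors cs x"
proof (induction cs)
  case (Cons c cs)
  have "linear_factors (c # cs) y * f = (y - \<kappa> c) * f * linear_factors cs x"
    using Cons by (simp add: mult.assoc)
  also have "(y - \<kappa> c) * f = f * (x - \<kappa> c)"
    using Cons.prems \<kappa>_central[of c f] by (simp add: algebra_simps)
  finally show ?case by (simp add: mult.assoc)
qed simp

text \<open>
  Splitting off one factor \<open>x - c\<close>, the element \<open>(x - c) f\<close> decomposes by induction.  Its components
  at \<open>c' \<noteq> c\<close> lift to components of \<open>f\<close>, because \<open>x - c\<close> is invertible on them; what remains of
  \<open>f\<close> is annihilated by a power of \<open>x - c\<close>.
\<close>

lemma spectral_decomposition: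
  assumes comm: "\<And>s s'. s \<in> S \<Longrightarrow> s' \<in> S \<Longrightarrow> s * s' = s' * s"
    and x: "x \<in> bicommutant S" and "f \<in> bicommutant S" "linear_factors cs x * f = 0"
  shows "\<exists>p. (\<forall>c\<in>set cs. p c \<in> bicommutant S \<and> (\<exists>N. (x - \<kappa> c) ^ N * p c = 0)) \<and> sum p (set cs) = f"
  using assms(3,4)
proof (induction cs arbitrary: f)
  case Nil
  then show ?case by simp
next
  case (Cons c cs)
  have xc: "x - \<kappa> c \<in> bicommutant S" using x by (intro bicommutant_diff \<kappa>_bicommutant)
  let ?u = "(x - \<kappa> c) * f"
  have "x * (x - \<kappa> c) = (x - \<kappa> c) * x" using \<kappa>_central[of c x] by (simp add: algebra_simps)
  then have "linear_factors cs x * ?u = linear_factors (c # cs) x * f"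
    using linear_factors_intertwine[of x "x - \<kappa> c" x cs] by (simp add: mult.assoc[symmetric])
  then obtain p where p: "\<And>c. c \<in> set cs \<Longrightarrow> p c \<in> bicommutant S"
      "\<And>c. c \<in> set cs \<Longrightarrow> \<exists>N. (x - \<kappa> c) ^ N * p c = 0" and sp: "sum p (set cs) = ?u"
    using Cons.IH[of ?u] Cons.prems bicommutant_mult[OF xc] by (metis (no_types, lifting))
  have "\<exists>r. r \<in> bicommutant S \<and> (x - \<kappa> c) * r * p c' = p c'" if "c' \<in> set cs - {c}" for c'
    using that p(2)[of c'] shifted_inverse[OF _ _ x, of c c' _ "p c'"] by auto
  then obtain r where r: "\<And>c'. c' \<in> set cs - {c} \<Longrightarrow> r c' \<in> bicommutant S"
      "\<And>c'. c' \<in> set cs - {c} \<Longrightarrow> (x - \<kappa> c) * r c' * p c' = p c'"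
    by metis
  define p' where "p' c' = (if c' = c then f - (\<Sum>c'\<in>set cs - {c}. r c' * p c') else r c' * p c')" for c'
  have "sum p' (set (c # cs)) = p' c + sum p' (set cs - {c})"
    by (simp add: sum.insert_remove)
  also have "sum p' (set cs - {c}) = (\<Sum>c'\<in>set cs - {c}. r c' * p c')"
    by (rule sum.cong) (auto simp: p'_def)
  finally have sum: "sum p' (set (c # cs)) = f" by (simp add: p'_def)
  have in_bic: "p' c' \<in> bicommutant S" if "c' \<in> set (c # cs)" for c'
    using that p(1) r(1) Cons.prems(1)
    by (auto simp: p'_def intro!: bicommutant_diff bicommutant_sum bicommutant_mult)
  have "(x - \<kappa> c) * p' c = ?u - (\<Sum>c'\<in>set cs - {c}. p c')"
    using r(2) by (simp add: p'_def right_diff_distrib sum_distrib_left mult.assoc)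
  also have "\<dots> = (if c \<in> set cs then p c else 0)"
    by (simp add: sp[symmetric] sum_diff1)
  finally have pc: "(x - \<kappa> c) * p' c = (if c \<in> set cs then p c else 0)" .
  have "\<exists>N. (x - \<kappa> c) ^ N * p' c = 0"
  proof -
    obtain N where "(x - \<kappa> c) ^ N * (if c \<in> set cs then p c else 0) = 0"
      using p(2)[of c] by (cases "c \<in> set cs") auto
    then have "(x - \<kappa> c) ^ Suc N * p' c = 0"
      using pc by (simp only: power_Suc2 mult.assoc)
    then show ?thesis by blast
  qed
  moreover have "\<exists>N. (x - \<kappa> c') ^ N * p' c' = 0" if c': "c' \<in> set cs" "c' \<noteq> c" for c'
  proof -
    obtain N where N: "(x - \<kappa> c') ^ N * p c' = 0" using p(2) c' by blast
    have "(x - \<kappa> c') ^ N \<in> bicommutant S"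
      using x by (intro bicommutant_power bicommutant_diff \<kappa>_bicommutant)
    have "x * r c' = r c' * x" using bicommutant_commute[OF comm x r(1)] c' by simp
    then have "(x - \<kappa> c') ^ N * r c' = r c' * (x - \<kappa> c') ^ N"
      using \<kappa>_central[of c' "r c'"] by (intro power_commutes_left) (simp add: algebra_simps)
    then have "(x - \<kappa> c') ^ N * p' c' = r c' * ((x - \<kappa> c') ^ N * p c')"
      using c' by (simp add: p'_def mult.assoc[symmetric])
    then show ?thesis using N by (intro exI[of _ N]) simp
  qed
  ultimately show ?case using sum in_bic by (intro exI[of _ p']) auto
qed

text \<open>
  The Bernstein relations between a generator \<open>g\<close> and two consecutive Jucys--Murphy elements \<open>X\<close>
  and \<open>Y = q\<^sup>-\<^sup>1 g X g\<close>: multiply \<open>g X g\<close> by \<open>g\<close> on one side and apply the quadratic relation.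
\<close>

lemma hecke_commutation:
  assumes q: "q \<noteq> 0" and gXg: "g * X * g = \<kappa> q * Y" and gg: "g * g = \<kappa> q + \<kappa> (q - 1) * e * g"
    and ge: "g * e = e * g" and Xe: "X * e = e * X"
  shows hecke_upper: "Y * g = g * X + \<kappa> (q - 1) * e * Y"
    and hecke_lower: "X * g = g * Y - \<kappa> (q - 1) * e * Y"
proof -
  note c = \<kappa>_central[of q] \<kappa>_central[of "q - 1"]
  have "\<kappa> q * (Y * g) = g * X * (g * g)" using gXg by (simp add: mult.assoc[symmetric])
  also have "\<dots> = \<kappa> q * (g * X) + \<kappa> (q - 1) * (g * X * e * g)"
    by (simp add: gg distrib_left mult.assoc c(1)[of "g * X", symmetric]) (metis c mult.assoc)
  also have "g * X * e * g = e * (g * X * g)"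
    using ge Xe by (metis mult.assoc)
  also have "\<dots> = \<kappa> q * (e * Y)" using gXg c by (metis mult.assoc)
  also have "\<kappa> q * (g * X) + \<kappa> (q - 1) * (\<kappa> q * (e * Y)) = \<kappa> q * (g * X + \<kappa> (q - 1) * e * Y)"
    using c(2)[of "\<kappa> q"] by (simp add: distrib_left mult.assoc) (metis mult.assoc)
  finally show "Y * g = g * X + \<kappa> (q - 1) * e * Y" using q by (simp add: \<kappa>_cancel)
  have "\<kappa> q * (g * Y) = (g * g) * (X * g)" using gXg c by (metis mult.assoc)
  also have "\<dots> = \<kappa> q * (X * g) + \<kappa> (q - 1) * e * (g * X * g)"
    by (simp add: gg distrib_right mult.assoc)
  also have "\<kappa> (q - 1) * e * (g * X * g) = \<kappa> q * (\<kappa> (q - 1) * e * Y)"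
    using gXg c by (metis mult.assoc)
  also have "\<kappa> q * (X * g) + \<dots> = \<kappa> q * (X * g + \<kappa> (q - 1) * e * Y)"
    by (simp add: distrib_left)
  finally have "g * Y = X * g + \<kappa> (q - 1) * e * Y" using \<kappa>_cancel[OF q] by blast
  then show "X * g = g * Y - \<kappa> (q - 1) * e * Y" by simp
qed

text \<open>
  Modulo \<open>X - c\<close> the polynomial \<open>(q X - Y) (q Y - X)\<close> becomes \<open>- q (Y - q c) (Y - c / q)\<close>, so each
  root \<open>c\<close> of \<open>X\<close> can be traded for the roots \<open>q c\<close> and \<open>c / q\<close> of \<open>Y\<close>.
\<close>

lemma shifted_roots_annihilate:
  assumes q: "q \<noteq> 0" and XY: "X * Y = Y * X"
    and "linear_factors cs X * w = 0" "(\<kappa> q * X - Y) * (\<kappa> q * Y - X) * w = 0"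
  shows "linear_factors (concat (map (\<lambda>c. [q * c, c / q]) cs)) Y * w = 0"
  using assms(3,4)
proof (induction cs arbitrary: w)
  case (Cons c cs)
  let ?P = "linear_factors (concat (map (\<lambda>c. [q * c, c / q]) cs)) Y"
  let ?Q = "\<kappa> q" and ?a = "\<kappa> c"
  let ?w = "(X - ?a) * w" and ?F = "(Y - \<kappa> (q * c)) * (Y - \<kappa> (c / q))"
  note cen = \<kappa>_central[of q X, symmetric] \<kappa>_central[of q Y, symmetric] \<kappa>_central[of c X, symmetric]
    \<kappa>_central[of c Y, symmetric] \<kappa>_central[of c ?Q]
  note comm = cen XY[symmetric]
  note comms = comm comm[THEN mult_eq_assoc]
  have 1: "linear_factors cs X * (X - ?a) = (X - ?a) * linear_factors cs X"
    by (rule linear_factors_intertwine) (simp add: algebra_simps comms)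
  have 2: "(?Q * X - Y) * (?Q * Y - X) * (X - ?a) = (X - ?a) * ((?Q * X - Y) * (?Q * Y - X))"
    by (simp add: algebra_simps comms)
  have "linear_factors cs X * ?w = 0"
    using Cons.prems(1) 1 by (metis linear_factors_simps(2) mult.assoc)
  moreover have "(?Q * X - Y) * (?Q * Y - X) * ?w = 0"
    using Cons.prems(2) by (simp only: mult.assoc[of _ "X - ?a" w, symmetric] 2) (simp add: mult.assoc)
  ultimately have IH: "?P * ?w = 0" by (rule Cons.IH)
  have k: "?Q * (Y - \<kappa> (c / q)) = ?Q * Y - ?a"
    using q by (simp add: right_diff_distrib \<kappa>_mult[symmetric])
  let ?s = "?Q * ?Q * Y + Y - ?Q * (X + ?a)"
  have "?Q * ?F = (Y - \<kappa> (q * c)) * (?Q * (Y - \<kappa> (c / q)))"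
    using \<kappa>_central[of q "Y - \<kappa> (q * c)"] by (metis mult.assoc)
  also have "\<dots> = (Y - ?Q * ?a) * (?Q * Y - ?a)" by (simp only: k \<kappa>_mult)
  also have "\<dots> = ?s * (X - ?a) - (?Q * X - Y) * (?Q * Y - X)"
    by (simp add: algebra_simps comms)
  finally have F: "?Q * (?F * w) = ?s * ?w"
    using Cons.prems(2) by (metis (no_types, lifting) diff_zero left_diff_distrib mult.assoc)
  note roots = \<kappa>_central[of "q * c" Y, symmetric] \<kappa>_central[of "c / q" Y, symmetric]
    \<kappa>_central[of "q * c" "\<kappa> (c / q)"]
  have PF: "?P * ?F = ?F * ?P"
    by (rule linear_factors_intertwine) (simp add: left_diff_distrib right_diff_distrib mult.assoc roots roots[THEN mult_eq_assoc])
  have Ps: "?P * ?s = ?s * ?P"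
    by (rule linear_factors_intertwine) (simp add: algebra_simps comms)
  have "?Q * (?F * ?P * w) = ?P * (?Q * (?F * w))"
    by (simp only: PF[symmetric]) (simp only: mult.assoc \<kappa>_central[of q ?P, THEN mult_eq_assoc])
  also have "\<dots> = ?s * (?P * ?w)" unfolding F by (simp only: mult.assoc[symmetric] Ps)
  finally have "?F * ?P * w = 0"
    using IH \<kappa>_mult_eq_zero[OF q] by simp
  then show ?case by (simp add: mult.assoc)
qed simp

text \<open>
  Off the idempotent \<open>e\<close> the generator is invertible and exchanges \<open>X\<close> and \<open>Y\<close>, so both satisfy the
  same polynomial.  On \<open>e\<close> the intertwiner \<open>\<phi>\<close> plays this role, but its square is
  \<open>(q X - Y) (q Y - X)\<close> and need not be invertible; this accounts for the shifted roots.
\<close>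

lemma linear_factors_step:
  assumes q: "q \<noteq> 0" and gXg: "g * X * g = \<kappa> q * Y" and gg: "g * g = \<kappa> q + \<kappa> (q - 1) * e * g"
    and ge: "g * e = e * g" and Xe: "X * e = e * X" and Ye: "Y * e = e * Y" and ee: "e * e = e"
    and XY: "X * Y = Y * X" and cs: "linear_factors cs X = 0"
  shows "linear_factors (concat (map (\<lambda>c. [q * c, c / q]) cs) @ cs) Y = 0"
proof -
  note up = hecke_upper[OF q gXg gg ge Xe] and low = hecke_lower[OF q gXg gg ge Xe]
  let ?Q = "\<kappa> q"
  define P where "P = linear_factors cs Y"
  define P' where "P' = linear_factors (concat (map (\<lambda>c. [q * c, c / q]) cs)) Y"
  note cen = \<kappa>_central[of q X, symmetric] \<kappa>_central[of q Y, symmetric] \<kappa>_central[of q e, symmetric]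
    \<kappa>_central[of q g, symmetric]
  note rules = cen XY[symmetric] ge Xe Ye ee up low gg
  note rules = rules rules[THEN mult_eq_assoc]
  have "P * (g * (1 - e)) = g * (1 - e) * linear_factors cs X"
    unfolding P_def by (rule linear_factors_intertwine) (simp add: algebra_simps \<kappa>_diff \<kappa>_one rules)
  then have "P * (g * (1 - e)) * g = 0" using cs by simp
  moreover have "g * (1 - e) * g = ?Q * (1 - e)"
    by (simp add: algebra_simps \<kappa>_diff \<kappa>_one rules)
  ultimately have "?Q * (P * (1 - e)) = 0"
    using \<kappa>_central[of q P] by (metis mult.assoc)
  then have off: "P * (1 - e) = 0" by (rule \<kappa>_mult_eq_zero[OF q])
  \<comment> \<open>Multiplying \<open>g\<close> by \<open>X - Y\<close> makes the error term in \<open>Y g = g X + (q - 1) e Y\<close> a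
  multiple of \<open>X - Y\<close>, which the second summand cancels.\<close>
  define \<phi> where "\<phi> = e * (g * (X - Y) + \<kappa> (q - 1) * Y)"
  have "P * \<phi> = \<phi> * linear_factors cs X"
    unfolding P_def \<phi>_def
    by (rule linear_factors_intertwine) (simp add: algebra_simps \<kappa>_diff \<kappa>_one rules)
  then have "P * (\<phi> * \<phi>) = 0" using cs by (simp add: mult.assoc[symmetric])
  moreover have "\<phi> * \<phi> = (?Q * X - Y) * (?Q * Y - X) * e"
    unfolding \<phi>_def by (simp add: algebra_simps \<kappa>_diff \<kappa>_one rules)
  ultimately have "P * ((?Q * X - Y) * (?Q * Y - X)) * e = 0" by (simp add: mult.assoc)
  moreover have "P * ((?Q * X - Y) * (?Q * Y - X)) = (?Q * X - Y) * (?Q * Y - X) * P"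
    unfolding P_def by (rule linear_factors_intertwine) (simp add: algebra_simps rules)
  ultimately have "(?Q * X - Y) * (?Q * Y - X) * (P * e) = 0" by (simp add: mult.assoc)
  then have "P' * (P * e) = 0"
    unfolding P'_def using shifted_roots_annihilate[OF q XY, of cs "P * e"] cs by simp
  moreover have "P' * P = P' * (P * (1 - e)) + P' * (P * e)"
    by (simp add: algebra_simps)
  ultimately show ?thesis using off by (simp add: P_def P'_def)
qed

end

(* Indices are written a + 1; rewriting 1 to Suc 0 would hide them. *)
declare One_nat_def [simp del]

section \<open>Powers of the parameter\<close>

definition I_labels :: "'k::field \<Rightarrow> int set" where
  "I_labels q = (if quantum_char q = 0 then UNIV else {0..<int (quantum_char q)})"

text \<open>
  For \<open>q \<noteq> 1\<close> the sum \<open>1 + q + \<dots> + q\<^sup>m\<^sup>-\<^sup>1\<close> vanishes iff \<open>q\<^sup>m = 1\<close>, so the quantum characteristic is the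
  multiplicative order of \<open>q\<close>.  Hence the labels index the powers of \<open>q\<close> bijectively.
\<close>

lemma quantum_char_power:
  fixes q :: "'k::field"
  assumes "q \<noteq> 1"
  shows "quantum_char q > 0 \<Longrightarrow> q ^ quantum_char q = 1"
    and "0 < m \<Longrightarrow> q ^ m = 1 \<Longrightarrow> 0 < quantum_char q \<and> quantum_char q \<le> m"
proof -
  have root: "(\<Sum>k<m. q ^ k) = 0 \<longleftrightarrow> q ^ m = 1" for m
    using power_diff_1_eq[of q m] assms by auto
  show "q ^ quantum_char q = 1" if "quantum_char q > 0"
  proof -
    have "\<exists>m\<ge>1. (\<Sum>k<m. q ^ k) = 0" using that by (auto simp: quantum_char_def split: if_splits)
    then show ?thesis
      using LeastI_ex[of "\<lambda>m. 1 \<le> m \<and> (\<Sum>k<m. q ^ k) = 0"] root by (auto simp: quantum_char_def)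
  qed
  show "0 < quantum_char q \<and> quantum_char q \<le> m" if m: "0 < m" "q ^ m = 1"
  proof -
    have *: "1 \<le> m \<and> (\<Sum>k<m. q ^ k) = 0" using m root by auto
    then have "quantum_char q = (LEAST m. 1 \<le> m \<and> (\<Sum>k<m. q ^ k) = 0)"
      by (auto simp: quantum_char_def)
    then show ?thesis
      using Least_le[of "\<lambda>m. 1 \<le> m \<and> (\<Sum>k<m. q ^ k) = 0", OF *]
        LeastI[of "\<lambda>m. 1 \<le> m \<and> (\<Sum>k<m. q ^ k) = 0", OF *] by simp
  qed
qed

lemma powi_labels_inj:
  fixes q :: "'k::field"
  assumes q: "q \<noteq> 0" "q \<noteq> 1" and "k \<in> I_labels q" "l \<in> I_labels q" "q powi k = q powi l"
  shows "k = l"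
proof -
  have False if kl: "k < l" "k \<in> I_labels q" "l \<in> I_labels q" and eq: "q powi k = q powi l" for k l
  proof -
    have "q powi (l - k) = 1" using eq q by (simp add: power_int_diff)
    then have "q ^ nat (l - k) = 1" using kl(1) by (simp add: power_int_def)
    then have "0 < quantum_char q" "quantum_char q \<le> nat (l - k)"
      using quantum_char_power(2)[OF q(2), of "nat (l - k)"] kl(1) by auto
    then show False using kl by (auto simp: I_labels_def)
  qed
  then show ?thesis using assms(3-5) by (metis linorder_neqE)
qed

lemma powi_labels_surj:
  fixes q :: "'k::field"
  assumes q: "q \<noteq> 0" "q \<noteq> 1"
  shows "\<exists>l\<in>I_labels q. q powi l = q powi k"
proof (cases "quantum_char q = 0")
  case True
  then show ?thesis by (auto simp: I_labels_def)
next
  case False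
  let ?e = "int (quantum_char q)"
  have "q powi k = q powi (?e * (k div ?e) + k mod ?e)" by simp
  also have "\<dots> = (q powi ?e) powi (k div ?e) * q powi (k mod ?e)"
    using q by (simp only: power_int_add power_int_mult simp_thms)
  also have "q powi ?e = 1" using quantum_char_power(1)[OF q(2)] False by simp
  finally show ?thesis
    using False by (intro bexI[of _ "k mod ?e"]) (simp_all add: I_labels_def)
qed

lemma sum_powers_root_of_unity:
  fixes w :: "'k::field"
  assumes "w ^ d = 1"
  shows "(\<Sum>r<d. w ^ r) = (if w = 1 then of_nat d else 0)"
  using power_diff_1_eq[of w d] assms by auto

section \<open>The defining relations\<close>

text \<open>
  The defining relation of \<open>X\<close> is multiplied by \<open>q\<close>, and \<open>t\<^sub>a\<^sub>+\<^sub>1\<^sup>-\<^sup>r\<close> is written \<open>t\<^sub>a\<^sub>+\<^sub>1\<^sup>d\<^sup>-\<^sup>r\<close>, so that no inverses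
  occur.
\<close>

locale yokonuma_hecke = central_scalars \<kappa>
  for \<kappa> :: "'k::field \<Rightarrow> 'a::{ring,monoid_mult}" +
  fixes d n :: nat and q \<xi> :: 'k and g t ee X :: "nat \<Rightarrow> 'a"
  assumes n_pos: "1 \<le> n" and d_pos: "1 \<le> d" and d_unit: "of_nat d \<noteq> (0 :: 'k)"
    and \<xi>_primitive: "primitive_root_of_unity d \<xi>"
    and q_nonzero: "q \<noteq> 0" and q_not_one: "q \<noteq> 1"
    and t_power: "a \<in> {1..n} \<Longrightarrow> t a ^ d = 1"
    and t_commute: "a \<in> {1..n} \<Longrightarrow> b \<in> {1..n} \<Longrightarrow> t a * t b = t b * t a"
    and t_g: "a \<in> {1..n} \<Longrightarrow> b \<in> {1..<n} \<Longrightarrow> t a * g b = g b * t (Transposition.transpose b (b + 1) a)"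
    and ee_def: "a \<in> {1..<n} \<Longrightarrow> ee a = \<kappa> (inverse (of_nat d)) * (\<Sum>r<d. t a ^ r * t (a + 1) ^ (d - r))"
    and g_square: "a \<in> {1..<n} \<Longrightarrow> g a * g a = \<kappa> q + \<kappa> (q - 1) * ee a * g a"
    and g_braid: "1 \<le> a \<Longrightarrow> a + 1 < n \<Longrightarrow> g a * g (a + 1) * g a = g (a + 1) * g a * g (a + 1)"
    and g_far: "1 \<le> a \<Longrightarrow> a + 1 < b \<Longrightarrow> b < n \<Longrightarrow> g a * g b = g b * g a"
    and X_one: "X 1 = 1"
    and X_Suc: "a \<in> {1..<n} \<Longrightarrow> \<kappa> q * X (a + 1) = g a * X a * g a"
begin

subsection \<open>Eigenspaces of the torus\<close>

definition t_eigen :: "nat \<Rightarrow> nat \<Rightarrow> 'a \<Rightarrow> bool" where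
  "t_eigen b k v \<longleftrightarrow> t b * v = \<kappa> (\<xi> ^ k) * v"

lemma \<xi>_power_d: "\<xi> ^ d = 1"
  using \<xi>_primitive by (simp add: primitive_root_of_unity_def)

lemma \<xi>_nonzero: "\<xi> \<noteq> 0"
  using \<xi>_power_d d_pos by (auto simp: power_0_left)

lemma \<xi>_power_eq_one: "m < d \<Longrightarrow> \<xi> ^ m = 1 \<Longrightarrow> m = 0"
  using \<xi>_primitive by (auto simp: primitive_root_of_unity_def)

lemma \<xi>_power_inj:
  assumes "k \<in> {1..d}" "l \<in> {1..d}" "\<xi> ^ k = \<xi> ^ l"
  shows "k = l"
proof -
  have *: "k = l" if "k \<le> l" "k \<in> {1..d}" "l \<in> {1..d}" "\<xi> ^ k = \<xi> ^ l" for k l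
  proof -
    have "\<xi> ^ (l - k) = 1" using that \<xi>_nonzero by (simp add: power_diff)
    moreover have "l - k < d" using that by auto
    ultimately show ?thesis using \<xi>_power_eq_one that(1) by force
  qed
  show ?thesis
    using *[OF _ assms] *[OF _ assms(2,1) assms(3)[symmetric]] by (metis nat_le_linear)
qed

lemma t_bicommutant: "a \<in> {1..n} \<Longrightarrow> t a \<in> bicommutant (t ` {1..n})"
  by (rule bicommutant_base) simp

text \<open>
  Discrete Fourier transform on the cyclic group generated by \<open>t\<^sub>b\<close>.
\<close>

lemma t_decomposition:
  assumes b: "b \<in> {1..n}"
  shows "\<exists>p. (\<forall>k\<in>{1..d}. p k \<in> bicommutant (t ` {1..n}) \<and> t_eigen b k (p k)) \<and> sum p {1..d} = 1"
proof -
  define z where "z k = inverse (\<xi> ^ k)" for k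
  define p where "p k = \<kappa> (inverse (of_nat d)) * (\<Sum>r<d. \<kappa> (z k ^ r) * t b ^ r)" for k
  have zd: "z k ^ d = 1" for k
    using \<xi>_power_d by (simp add: z_def power_inverse) (metis mult.commute power_mult power_one)
  have bic: "p k \<in> bicommutant (t ` {1..n})" for k
    unfolding p_def
    by (intro bicommutant_mult bicommutant_sum bicommutant_power \<kappa>_bicommutant t_bicommutant b)
  have eig: "t_eigen b k (p k)" for k
  proof -
    have zx: "\<kappa> (\<xi> ^ k) * \<kappa> (z k ^ Suc r) = \<kappa> (z k ^ r)" for r
      using \<xi>_nonzero by (simp add: \<kappa>_mult[symmetric] z_def mult.assoc[symmetric])
    have "t b * (\<kappa> (z k ^ r) * t b ^ r) = \<kappa> (\<xi> ^ k) * (\<kappa> (z k ^ Suc r) * t b ^ Suc r)" for r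
      using \<kappa>_central[of "z k ^ r" "t b"] zx[of r]
      by (simp only: power_Suc[of "t b"]) (metis mult.assoc)
    then have "t b * (\<Sum>r<d. \<kappa> (z k ^ r) * t b ^ r)
        = \<kappa> (\<xi> ^ k) * (\<Sum>r<d. \<kappa> (z k ^ Suc r) * t b ^ Suc r)"
      by (simp only: sum_distrib_left)
    also have "(\<Sum>r<d. \<kappa> (z k ^ Suc r) * t b ^ Suc r) = (\<Sum>r<d. \<kappa> (z k ^ r) * t b ^ r)"
      using sum.lessThan_Suc_shift[of "\<lambda>r. \<kappa> (z k ^ r) * t b ^ r" d]
      by (simp add: zd t_power[OF b] add.commute)
    finally show ?thesis
      unfolding t_eigen_def p_def
      by (simp only: \<kappa>_left_commute[of "t b"] \<kappa>_left_commute[of "\<kappa> (\<xi> ^ k)" "inverse (of_nat d)"])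
  qed
  have "(\<Sum>k=1..d. z k ^ r) = (if r = 0 then of_nat d else 0)" if "r < d" for r
  proof -
    let ?w = "inverse (\<xi> ^ r)"
    have w: "?w ^ d = 1" using zd[of r] by (simp add: z_def)
    have "z k ^ r = ?w ^ k" for k by (simp add: z_def power_inverse mult.commute flip: power_mult)
    then have "(\<Sum>k=1..d. z k ^ r) = (\<Sum>k<d. ?w ^ Suc k)"
      by (simp only:) (rule sum.reindex_bij_witness[of _ Suc "\<lambda>k. k - 1"], auto)
    also have "\<dots> = (\<Sum>k<d. ?w ^ k)"
      using sum.lessThan_Suc_shift[of "\<lambda>k. ?w ^ k" d] w by (simp add: add.commute)
    also have "\<dots> = (if ?w = 1 then of_nat d else 0)" by (rule sum_powers_root_of_unity[OF w])
    also have "?w = 1 \<longleftrightarrow> r = 0" using \<xi>_power_eq_one[OF that] by auto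
    finally show ?thesis .
  qed
  then have "(\<Sum>k=1..d. \<Sum>r<d. \<kappa> (z k ^ r) * t b ^ r) = (\<Sum>r<d. \<kappa> (if r = 0 then of_nat d else 0) * t b ^ r)"
    by (subst sum.swap) (simp add: \<kappa>_sum[symmetric] sum_distrib_right[symmetric])
  also have "\<dots> = (\<Sum>r<d. if r = 0 then \<kappa> (of_nat d) else 0)"
    by (rule sum.cong) (auto simp: \<kappa>_zero)
  also have "\<dots> = \<kappa> (of_nat d)" using d_pos by simp
  finally have "sum p {1..d} = \<kappa> (inverse (of_nat d)) * \<kappa> (of_nat d)"
    by (simp add: p_def sum_distrib_left[symmetric])
  then have "sum p {1..d} = 1" using \<kappa>_left_inverse[OF d_unit] by simp
  with bic eig show ?thesis by blast
qed

sublocale tspec: joint_spectrum "{1..n}" "{1..d}" "bicommutant (t ` {1..n})" t_eigen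
proof
  show "finite {1..n}" by simp
  show "1 \<in> bicommutant (t ` {1..n})" "0 \<in> bicommutant (t ` {1..n})"
    by (rule bicommutant_one, rule bicommutant_zero)
  show "x * y \<in> bicommutant (t ` {1..n})" if "x \<in> bicommutant (t ` {1..n})" "y \<in> bicommutant (t ` {1..n})" for x y
    using bicommutant_mult that by blast
  show "x * y = y * x" if "x \<in> bicommutant (t ` {1..n})" "y \<in> bicommutant (t ` {1..n})" for x y
    by (rule bicommutant_commute[OF _ that]) (use t_commute in auto)
  show "t_eigen b k 0" for b k by (simp add: t_eigen_def)
  show "t_eigen b k (x * v)" if "b \<in> {1..n}" "t_eigen b k v" "x \<in> bicommutant (t ` {1..n})" for b k v x
  proof -
    have "x * t b = t b * x"
      by (rule bicommutantD[OF that(3)]) (use t_commute that(1) in auto)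
    then show ?thesis using that(2) \<kappa>_central[of "\<xi> ^ k" x] unfolding t_eigen_def by (metis mult.assoc)
  qed
  show "t_eigen b k (v * y)" if "t_eigen b k v" for b k v y
    using that by (simp add: t_eigen_def mult.assoc[symmetric])
  show "v = 0" if "k \<in> {1..d}" "k' \<in> {1..d}" "k \<noteq> k'" "t_eigen b k v" "t_eigen b k' v" for b k k' v
  proof -
    have "\<kappa> (\<xi> ^ k - \<xi> ^ k') * v = 0"
      using that(4,5) by (simp add: t_eigen_def \<kappa>_diff left_diff_distrib)
    then show ?thesis using \<kappa>_mult_eq_zero[of "\<xi> ^ k - \<xi> ^ k'" v] \<xi>_power_inj that(1-3) by auto
  qed
  show "\<exists>K p. finite K \<and> K \<subseteq> {1..d} \<and>
      (\<forall>k\<in>K. p k \<in> bicommutant (t ` {1..n}) \<and> t_eigen b k (p k)) \<and> sum p K = 1" if "b \<in> {1..n}" for b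
    using t_decomposition[OF that] by (intro exI[of _ "{1..d}"]) simp
qed

text \<open>
  On the eigenspace, \<open>e\<^sub>a\<close> is the average of the powers of \<open>\<xi> ^ j\<^sub>a / \<xi> ^ j\<^sub>b\<close>, where \<open>b = a + 1\<close>.
\<close>

lemma ee_eigen:
  assumes a: "a \<in> {1..<n}" and j: "j \<in> YH_J d n" and v: "tspec.joint_eigen j v"
  shows "ee a * v = (if j a = j (a + 1) then v else 0)"
proof -
  have va: "t a * v = \<kappa> (\<xi> ^ j a) * v" and vb: "t (a + 1) * v = \<kappa> (\<xi> ^ j (a + 1)) * v"
    using v a by (auto simp: tspec.joint_eigen_def t_eigen_def)
  have pw: "x ^ m * v = \<kappa> (c ^ m) * v" if "x * v = \<kappa> c * v" for x c m
  proof (induction m)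
    case (Suc m)
    have "x ^ Suc m * v = x * (\<kappa> (c ^ m) * v)" using Suc by (simp add: mult.assoc)
    also have "\<dots> = \<kappa> (c ^ m) * (x * v)" using \<kappa>_central[of "c ^ m" x] by (metis mult.assoc)
    also have "\<dots> = \<kappa> (c ^ Suc m) * v"
      using that by (simp add: \<kappa>_mult[symmetric] mult.assoc[symmetric] mult.commute)
    finally show ?case .
  qed (simp add: \<kappa>_one)
  define w where "w = \<xi> ^ j a * inverse (\<xi> ^ j (a + 1))"
  have jd: "(\<xi> ^ m) ^ d = 1" for m using \<xi>_power_d by (metis mult.commute power_mult power_one)
  have "t a ^ r * t (a + 1) ^ (d - r) * v = \<kappa> (w ^ r) * v" if "r < d" for r
  proof -
    have "t a ^ r * t (a + 1) ^ (d - r) * v = t a ^ r * (\<kappa> ((\<xi> ^ j (a + 1)) ^ (d - r)) * v)"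
      using pw[OF vb] by (simp only: mult.assoc)
    also have "\<dots> = \<kappa> ((\<xi> ^ j (a + 1)) ^ (d - r)) * (t a ^ r * v)"
      by (rule \<kappa>_left_commute)
    also have "\<dots> = \<kappa> ((\<xi> ^ j (a + 1)) ^ (d - r) * (\<xi> ^ j a) ^ r) * v"
      using pw[OF va] by (simp add: \<kappa>_mult mult.assoc)
    also have "(\<xi> ^ j (a + 1)) ^ (d - r) * (\<xi> ^ j a) ^ r = w ^ r"
      using jd[of "j (a + 1)"] \<xi>_nonzero that
      by (simp add: w_def power_mult_distrib power_diff power_inverse field_simps)
    finally show ?thesis .
  qed
  then have "(\<Sum>r<d. t a ^ r * t (a + 1) ^ (d - r)) * v = \<kappa> (\<Sum>r<d. w ^ r) * v"
    by (simp add: sum_distrib_right \<kappa>_sum)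
  also have "w ^ d = 1" using jd by (simp add: w_def power_mult_distrib power_inverse)
  then have "(\<Sum>r<d. w ^ r) = (if w = 1 then of_nat d else 0)" by (rule sum_powers_root_of_unity)
  also have "w = 1 \<longleftrightarrow> \<xi> ^ j a = \<xi> ^ j (a + 1)"
    using \<xi>_nonzero by (simp add: w_def field_simps)
  also have "\<dots> \<longleftrightarrow> j a = j (a + 1)"
    using \<xi>_power_inj[of "j a" "j (a + 1)"] j a by (force simp: YH_J_def PiE_def Pi_def)
  finally have "(\<Sum>r<d. t a ^ r * t (a + 1) ^ (d - r)) * v = (if j a = j (a + 1) then \<kappa> (of_nat d) * v else 0)"
    by (simp add: \<kappa>_zero)
  then show ?thesis
    unfolding ee_def[OF a] using \<kappa>_left_inverse[OF d_unit] by (simp add: mult.assoc) (metis mult.assoc mult_1)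
qed

lemma transpose_mem: "a \<in> {1..<n} \<Longrightarrow> b \<in> {1..n} \<Longrightarrow> Transposition.transpose a (a + 1) b \<in> {1..n}"
  by (auto simp: Transposition.transpose_def)

lemma t_eigen_g:
  assumes a: "a \<in> {1..<n}" and v: "tspec.joint_eigen j v"
  shows "tspec.joint_eigen (j \<circ> Transposition.transpose a (a + 1)) (g a * v)"
proof -
  have "t b * (g a * v) = \<kappa> (\<xi> ^ j (Transposition.transpose a (a + 1) b)) * (g a * v)" if b: "b \<in> {1..n}" for b
  proof -
    let ?s = "Transposition.transpose a (a + 1) b"
    have "t b * (g a * v) = g a * (t ?s * v)" using t_g[OF b a] by (metis mult.assoc)
    also have "t ?s * v = \<kappa> (\<xi> ^ j ?s) * v"
      using v transpose_mem[OF a b] by (simp add: tspec.joint_eigen_def t_eigen_def)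
    finally show ?thesis using \<kappa>_central[of "\<xi> ^ j ?s" "g a"] by (metis mult.assoc)
  qed
  then show ?thesis by (simp add: tspec.joint_eigen_def t_eigen_def)
qed

lemma transpose_comp_PiE:
  assumes "a \<in> {1..<n}" "f \<in> {1..n} \<rightarrow>\<^sub>E L"
  shows "f \<circ> Transposition.transpose a (a + 1) \<in> {1..n} \<rightarrow>\<^sub>E L"
  using assms by (auto simp: PiE_def Pi_def extensional_def Transposition.transpose_def)

lemma ee_idem: "a \<in> {1..<n} \<Longrightarrow> ee a * ee a = ee a"
  by (rule tspec.eq_if_eq_on_eigenvectors) (simp add: YH_J_def ee_eigen mult.assoc)

lemma g_ee: 
  assumes a: "a \<in> {1..<n}"
  shows "g a * ee a = ee a * g a"
proof (rule tspec.eq_if_eq_on_eigenvectors)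
  fix j v assume j: "j \<in> {1..n} \<rightarrow>\<^sub>E {1..d}" and v: "tspec.joint_eigen j v"
  show "g a * ee a * v = ee a * g a * v"
    using ee_eigen[OF a _ v] ee_eigen[OF a _ t_eigen_g[OF a v]] j transpose_comp_PiE[OF a j]
    by (auto simp: YH_J_def mult.assoc)
qed

subsection \<open>The Jucys--Murphy elements commute\<close>

lemma X_Suc_0: "X (Suc 0) = 1"
  using X_one unfolding One_nat_def .

lemma t_X: "a \<in> {1..n} \<Longrightarrow> b \<in> {1..n} \<Longrightarrow> t b * X a = X a * t b"
proof (induction a arbitrary: b)
  case 0
  then show ?case by simp
next
  case (Suc a)
  show ?case
  proof (cases "a = 0")
    case True
    then show ?thesis using True X_Suc_0 by simp
  next
    case False
    then have a: "a \<in> {1..<n}" using Suc.prems by auto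
    let ?s = "Transposition.transpose a (a + 1) b"
    have s: "?s \<in> {1..n}" using transpose_mem[OF a Suc.prems(2)] .
    have tg: "t b * g a = g a * t ?s" "t ?s * g a = g a * t b"
      using t_g[OF Suc.prems(2) a] t_g[OF s a] by simp_all
    have "\<kappa> q * (t b * X (a + 1)) = t b * (g a * X a * g a)"
      using X_Suc[OF a] \<kappa>_central[of q "t b"] by (metis mult.assoc)
    also have "\<dots> = g a * (t ?s * X a) * g a" by (simp add: tg mult.assoc[symmetric])
    also have "\<dots> = g a * (X a * t ?s) * g a" using Suc.IH[of ?s] a s by simp
    also have "\<dots> = g a * X a * g a * t b" by (simp add: tg mult.assoc)
    also have "\<dots> = \<kappa> q * (X (a + 1) * t b)" by (simp only: X_Suc[OF a, symmetric]) (simp only: mult.assoc)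
    finally show ?thesis by (simp only: \<kappa>_cancel[OF q_nonzero] Suc_eq_plus1)
  qed
qed

lemma ee_commute:
  assumes "a \<in> {1..<n}" and "\<And>b. b \<in> {1..n} \<Longrightarrow> t b * y = y * t b"
  shows "ee a * y = y * ee a"
proof -
  have "ee a \<in> bicommutant (t ` {1..n})"
    unfolding ee_def[OF assms(1)] using assms(1)
    by (intro bicommutant_mult bicommutant_sum bicommutant_power \<kappa>_bicommutant t_bicommutant) auto
  then show ?thesis by (rule bicommutantD) (use assms(2) in auto)
qed

lemma ee_X: "a \<in> {1..<n} \<Longrightarrow> b \<in> {1..n} \<Longrightarrow> X b * ee a = ee a * X b"
  using ee_commute t_X by metis

lemma X_upper:
  assumes "a \<in> {1..<n}"
  shows "X (a + 1) * g a = g a * X a + \<kappa> (q - 1) * ee a * X (a + 1)"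
  using hecke_upper[OF q_nonzero X_Suc[OF assms, symmetric] g_square[OF assms] g_ee[OF assms]]
    ee_X assms by auto

lemma X_lower:
  assumes "a \<in> {1..<n}"
  shows "X a * g a = g a * X (a + 1) - \<kappa> (q - 1) * ee a * X (a + 1)"
  using hecke_lower[OF q_nonzero X_Suc[OF assms, symmetric] g_square[OF assms] g_ee[OF assms]]
    ee_X assms by auto

lemma X_Suc_commute:
  assumes a: "a \<in> {1..<n}" and g: "g a * y = y * g a" and X: "X a * y = y * X a"
  shows "X (Suc a) * y = y * X (Suc a)"
proof -
  have "g a * X a * y = y * (g a * X a)" using g X by (metis mult.assoc)
  then have "g a * X a * g a * y = y * (g a * X a * g a)" using g by (metis mult.assoc)
  then have "\<kappa> q * (X (a + 1) * y) = y * (\<kappa> q * X (a + 1))"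
    by (simp only: X_Suc[OF a] mult.assoc[symmetric])
  then show ?thesis
    by (simp only: \<kappa>_left_commute \<kappa>_cancel[OF q_nonzero] Suc_eq_plus1)
qed

lemma X_commute_if_commute_g:
  assumes "a \<in> {1..n}" and "\<And>c. 1 \<le> c \<Longrightarrow> c < a \<Longrightarrow> g c * y = y * g c"
  shows "X a * y = y * X a"
  using assms
proof (induction a)
  case 0
  then show ?case by simp
next
  case (Suc a)
  show ?case
  proof (cases "a = 0")
    case True
    then show ?thesis using True X_Suc_0 by simp
  next
    case False
    then have a: "a \<in> {1..<n}" using Suc.prems by auto
    have "g a * y = y * g a" "X a * y = y * X a" using Suc a by auto
    then show ?thesis using X_Suc_commute[OF a] by simp
  qed
qed

lemma g_X_below:
  assumes "b \<in> {1..<n}" "a \<in> {1..b - 1}" 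
  shows "g b * X a = X a * g b"
  by (rule X_commute_if_commute_g[symmetric]) (use assms in \<open>auto intro!: g_far\<close>)

text \<open>
  Up to a scalar \<open>X\<^sub>b\<^sub>+\<^sub>2\<close> is \<open>h g X\<^sub>b g h\<close> with \<open>g = g\<^sub>b\<close> and \<open>h = g\<^sub>b\<^sub>+\<^sub>1\<close>; the braid relation moves
  \<open>g\<close> into this word as \<open>h\<close>, which commutes with \<open>X\<^sub>b\<close>, and moves it out again on the other side.
\<close>

lemma g_X_above:
  assumes b: "1 \<le> b" and "b + 2 \<le> a" "a \<le> n"
  shows "g b * X a = X a * g b"
  using assms(2,3)
proof (induction a rule: dec_induct)
  case base
  have b1: "b \<in> {1..<n}" "b + 1 \<in> {1..<n}" using b base by auto
  let ?h = "g (b + 1)"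
  have br: "g b * ?h * g b = ?h * g b * ?h" using g_braid b base by simp
  have hX: "?h * X b = X b * ?h" using g_X_below[OF b1(2), of b] b by simp
  have "\<kappa> q * (\<kappa> q * X (b + 2)) = \<kappa> q * (?h * X (b + 1) * ?h)"
    using X_Suc[OF b1(2)] by (simp add: add.assoc del: add_2_eq_Suc')
  also have "\<dots> = ?h * (\<kappa> q * X (b + 1)) * ?h" using \<kappa>_central[of q ?h] by (metis mult.assoc)
  finally have X2: "\<kappa> q * (\<kappa> q * X (b + 2)) = ?h * (g b * X b * g b) * ?h" using X_Suc[OF b1(1)] by simp
  have "g b * (?h * (g b * X b * g b) * ?h) = ?h * g b * (?h * X b) * g b * ?h"
    by (simp only: mult.assoc[symmetric] br)
  also have "\<dots> = ?h * g b * X b * (?h * g b * ?h)" by (simp add: hX mult.assoc)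
  also have "\<dots> = (?h * (g b * X b * g b) * ?h) * g b" by (simp only: br[symmetric]) (simp only: mult.assoc)
  finally have "g b * (\<kappa> q * (\<kappa> q * X (b + 2))) = \<kappa> q * (\<kappa> q * X (b + 2)) * g b"
    by (simp only: X2)
  then have "\<kappa> q * (\<kappa> q * (g b * X (b + 2))) = \<kappa> q * (\<kappa> q * (X (b + 2) * g b))"
    by (simp only: \<kappa>_left_commute[of "g b"] mult.assoc)
  then show ?case by (simp add: \<kappa>_cancel[OF q_nonzero])
next
  case (step a)
  then have a: "a \<in> {1..<n}" using b by auto
  have "g b * X a = X a * g b" "g b * g a = g a * g b" using step g_far[of b a] b by auto
  then show ?case using X_Suc_commute[OF a, of "g b"] by simp
qed

lemma g_X:
  assumes "b \<in> {1..<n}" "a \<in> {1..n}" "a \<noteq> b" "a \<noteq> b + 1"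
  shows "g b * X a = X a * g b"
  using g_X_below[of b a] g_X_above[of b a] assms by (cases "a < b") auto

lemma X_commute:
  assumes "a \<in> {1..n}" "b \<in> {1..n}"
  shows "X a * X b = X b * X a"
proof -
  have *: "X a * X b = X b * X a" if "a < b" "a \<in> {1..n}" "b \<in> {1..n}" for a b
    by (rule X_commute_if_commute_g) (use that g_X in auto)
  show ?thesis using *[of a b] *[of b a] assms by (cases a b rule: linorder_cases) auto
qed

lemma X_invertible:
  assumes "a \<in> {1..n}"
  shows "\<exists>z. X a * z = 1 \<and> z * X a = 1"
  using assms
proof (induction a)
  case 0
  then show ?case by simp
next
  case (Suc a)
  show ?case
  proof (cases "a = 0")
    case True
    then show ?thesis using True X_Suc_0 by simp
  next
    case False
    then have a: "a \<in> {1..<n}" using Suc.prems by auto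
    \<comment> \<open>By the quadratic relation this is \<open>q\<close> times the inverse of \<open>g\<^sub>a\<close>.\<close>
    let ?f = "g a - \<kappa> (q - 1) * ee a"
    obtain z where z: "X a * z = 1" "z * X a = 1" using Suc a by auto
    have f: "g a * ?f = \<kappa> q" "?f * g a = \<kappa> q"
      using g_square[OF a] g_ee[OF a] \<kappa>_central[of "q - 1" "g a"]
      by (simp_all add: algebra_simps) (metis mult.assoc)
    let ?i = "\<kappa> (inverse q)" and ?z = "\<kappa> (inverse q) * (?f * z * ?f)"
    have X: "X (a + 1) = ?i * (g a * X a * g a)"
      using X_Suc[OF a] \<kappa>_left_inverse[OF q_nonzero] by (metis mult.assoc mult_1)
    have i: "?i * \<kappa> q = 1" using \<kappa>_left_inverse[OF q_nonzero] .
    have "g a * X a * g a * (?f * z * ?f) = g a * X a * (g a * ?f) * z * ?f" by (simp only: mult.assoc)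
    also have "\<dots> = \<kappa> q * (g a * (X a * z) * ?f)" by (simp only: f) (metis \<kappa>_central mult.assoc)
    also have "\<dots> = \<kappa> q * \<kappa> q" by (simp add: z f)
    finally have 1: "g a * X a * g a * (?f * z * ?f) = \<kappa> q * \<kappa> q" .
    have "?f * z * ?f * (g a * X a * g a) = ?f * z * (?f * g a) * X a * g a" by (simp only: mult.assoc)
    also have "\<dots> = \<kappa> q * (?f * (z * X a) * g a)" by (simp only: f) (metis \<kappa>_central mult.assoc)
    also have "\<dots> = \<kappa> q * \<kappa> q" by (simp add: z f)
    finally have 2: "?f * z * ?f * (g a * X a * g a) = \<kappa> q * \<kappa> q" .
    have "(?i * u) * (?i * w) = ?i * ?i * (u * w)" for u w
      by (metis \<kappa>_central mult.assoc)
    then have "X (a + 1) * ?z = ?i * ?i * (\<kappa> q * \<kappa> q)" "?z * X (a + 1) = ?i * ?i * (\<kappa> q * \<kappa> q)"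
      using X 1 2 by simp_all
    moreover have "?i * ?i * (\<kappa> q * \<kappa> q) = 1" using i by (metis mult.assoc mult_1)
    ultimately show ?thesis by (metis Suc_eq_plus1)
  qed
qed

lemma X_spectrum:
  assumes "a \<in> {1..n}"
  shows "\<exists>cs. (\<forall>c\<in>set cs. \<exists>k::int. c = q powi k) \<and> linear_factors cs (X a) = 0"
  using assms
proof (induction a)
  case 0
  then show ?case by simp
next
  case (Suc a)
  show ?case
  proof (cases "a = 0")
    case True
    have "(1::'k) = q powi 0" by simp
    then show ?thesis using True X_Suc_0
      by (intro exI[of _ "[1]"]) (auto simp: \<kappa>_one intro: exI[of _ 0])
  next
    case False
    then have a: "a \<in> {1..<n}" using Suc.prems by auto
    then obtain cs where cs: "\<forall>c\<in>set cs. \<exists>k::int. c = q powi k" "linear_factors cs (X a) = 0"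
      using Suc by auto
    let ?ds = "concat (map (\<lambda>c. [q * c, c / q]) cs) @ cs"
    have "linear_factors ?ds (X (a + 1)) = 0"
      by (rule linear_factors_step[OF q_nonzero X_Suc[OF a, symmetric] g_square[OF a] g_ee[OF a]])
        (use a ee_X ee_idem X_commute cs in auto)
    moreover have "\<exists>k::int. c = q powi k" if "c \<in> set ?ds" for c
    proof -
      have "q * q powi k = q powi (k + 1)" "q powi k / q = q powi (k - 1)" for k
        using q_nonzero by (simp_all add: power_int_add power_int_diff)
      then show ?thesis using that cs(1) by fastforce
    qed
    ultimately show ?thesis by (metis Suc_eq_plus1)
  qed
qed

subsection \<open>Generalised eigenspaces of the Jucys--Murphy elements\<close>

definition X_eigen :: "nat \<Rightarrow> int \<Rightarrow> 'a \<Rightarrow> bool" where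
  "X_eigen b k v \<longleftrightarrow> (\<exists>N. (X b - \<kappa> (q powi k)) ^ N * v = 0)"

lemma X_bicommutant: "a \<in> {1..n} \<Longrightarrow> X a \<in> bicommutant (X ` {1..n})"
  by (rule bicommutant_base) simp

sublocale xspec: joint_spectrum "{1..n}" "I_labels q" "bicommutant (X ` {1..n})" X_eigen
proof
  let ?B = "bicommutant (X ` {1..n})"
  show "finite {1..n}" by simp
  show "1 \<in> ?B" "0 \<in> ?B"
    by (rule bicommutant_one, rule bicommutant_zero)
  show "x * y \<in> ?B" if "x \<in> ?B" "y \<in> ?B" for x y
    using bicommutant_mult that by blast
  show "x * y = y * x" if "x \<in> ?B" "y \<in> ?B" for x y
    by (rule bicommutant_commute[OF _ that]) (use X_commute in auto)
  show "X_eigen b k 0" for b k by (simp add: X_eigen_def)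
  show "X_eigen b k (x * v)" if "b \<in> {1..n}" "X_eigen b k v" "x \<in> ?B" for b k v x
  proof -
    from that(2) obtain N where N: "(X b - \<kappa> (q powi k)) ^ N * v = 0" by (auto simp: X_eigen_def)
    have "x * X b = X b * x"
      by (rule bicommutantD[OF that(3)]) (use X_commute that(1) in auto)
    then have "(X b - \<kappa> (q powi k)) * x = x * (X b - \<kappa> (q powi k))"
      using \<kappa>_central[of "q powi k" x] by (simp add: algebra_simps)
    from power_commutes_left[OF this, of N] have "(X b - \<kappa> (q powi k)) ^ N * (x * v) = x * ((X b - \<kappa> (q powi k)) ^ N * v)"
      by (simp only: mult.assoc[symmetric])
    then show ?thesis using N unfolding X_eigen_def by auto
  qed
  show "X_eigen b k (v * y)" if "X_eigen b k v" for b k v y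
    using that unfolding X_eigen_def by (metis mult.assoc mult_zero_left)
  show "v = 0" if "k \<in> I_labels q" "k' \<in> I_labels q" "k \<noteq> k'" "X_eigen b k v" "X_eigen b k' v" for b k k' v
  proof -
    have "q powi k \<noteq> q powi k'" using powi_labels_inj[OF q_nonzero q_not_one] that(1-3) by blast
    then show ?thesis
      using generalised_eigenvectors_disjoint that(4,5) unfolding X_eigen_def by blast
  qed
  show "\<exists>K p. finite K \<and> K \<subseteq> I_labels q \<and> (\<forall>k\<in>K. p k \<in> ?B \<and> X_eigen b k (p k)) \<and> sum p K = 1"
    if b: "b \<in> {1..n}" for b
  proof -
    obtain cs where cs: "\<forall>c\<in>set cs. \<exists>k::int. c = q powi k" "linear_factors cs (X b) = 0"
      using X_spectrum[OF b] by blast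
    obtain p where p: "\<And>c. c \<in> set cs \<Longrightarrow> p c \<in> ?B" "\<And>c. c \<in> set cs \<Longrightarrow> \<exists>N. (X b - \<kappa> c) ^ N * p c = 0"
      and sp: "sum p (set cs) = 1"
    proof -
      have comm: "s * s' = s' * s" if "s \<in> X ` {1..n}" "s' \<in> X ` {1..n}" for s s'
        using that X_commute by auto
      have "linear_factors cs (X b) * 1 = 0" using cs(2) by simp
      from spectral_decomposition[OF comm X_bicommutant[OF b] bicommutant_one this] show thesis
        using that by blast
    qed
    have "\<forall>c\<in>set cs. \<exists>k. k \<in> I_labels q \<and> q powi k = c"
      using cs(1) powi_labels_surj[OF q_nonzero q_not_one] by metis
    then obtain lab where lab: "\<And>c. c \<in> set cs \<Longrightarrow> lab c \<in> I_labels q" "\<And>c. c \<in> set cs \<Longrightarrow> q powi (lab c) = c"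
      by metis
    have inj: "inj_on lab (set cs)" using lab(2) by (metis inj_onI)
    have "(\<Sum>k\<in>lab ` set cs. p (q powi k)) = (\<Sum>c\<in>set cs. p c)"
      by (subst sum.reindex[OF inj]) (simp add: lab(2))
    then show ?thesis
      using p lab sp by (intro exI[of _ "lab ` set cs"] exI[of _ "\<lambda>k. p (q powi k)"]) (auto simp: X_eigen_def)
  qed
qed

subsection \<open>Weight vectors\<close>

abbreviation eI :: "(nat \<Rightarrow> int) \<Rightarrow> 'a" where "eI \<equiv> xspec.eigenidempotent"
abbreviation eJ :: "(nat \<Rightarrow> nat) \<Rightarrow> 'a" where "eJ \<equiv> tspec.eigenidempotent"
abbreviation \<sigma> :: "nat \<Rightarrow> nat \<Rightarrow> nat" where "\<sigma> a \<equiv> Transposition.transpose a (a + 1)"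

lemma YH_I_eq: "YH_I n q = {1..n} \<rightarrow>\<^sub>E I_labels q"
  by (simp add: YH_I_def I_labels_def)

lemma YH_J_eq: "YH_J d n = {1..n} \<rightarrow>\<^sub>E {1..d}"
  by (simp add: YH_J_def)

text \<open>
  The vectors of weight \<open>(i, j)\<close> form the right ideal generated by \<open>e(i) e(j)\<close>.
\<close>

definition weight :: "(nat \<Rightarrow> int) \<Rightarrow> (nat \<Rightarrow> nat) \<Rightarrow> 'a \<Rightarrow> bool" where
  "weight i j v \<longleftrightarrow> i \<in> YH_I n q \<and> j \<in> YH_J d n \<and> xspec.joint_eigen i v \<and> tspec.joint_eigen j v"

lemma weightD:
  assumes "weight i j v"
  shows "i \<in> YH_I n q" "j \<in> YH_J d n" "xspec.joint_eigen i v" "tspec.joint_eigen j v"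
    "b \<in> {1..n} \<Longrightarrow> X_eigen b (i b) v" "b \<in> {1..n} \<Longrightarrow> t b * v = \<kappa> (\<xi> ^ j b) * v"
  using assms by (auto simp: weight_def xspec.joint_eigen_def tspec.joint_eigen_def t_eigen_def)

lemma weight_right: "weight i j v \<Longrightarrow> weight i j (v * y)"
  by (simp add: weight_def xspec.joint_eigen_right tspec.joint_eigen_right)

lemma weight_X_bicommutant:
  assumes x: "x \<in> bicommutant (X ` {1..n})" and v: "weight i j v"
  shows "weight i j (x * v)"
proof -
  have "t b * (x * v) = \<kappa> (\<xi> ^ j b) * (x * v)" if b: "b \<in> {1..n}" for b
  proof -
    have "x * t b = t b * x" by (rule bicommutantD[OF x]) (use t_X[OF _ b] in auto)
    then have "t b * (x * v) = x * (t b * v)" by (simp add: mult.assoc[symmetric])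
    then show ?thesis using weightD(6)[OF v b] by (simp add: \<kappa>_left_commute)
  qed
  then show ?thesis
    using v xspec.joint_eigen_left[OF _ x] by (auto simp: weight_def tspec.joint_eigen_def t_eigen_def)
qed

lemma weight_idempotents:
  assumes "i \<in> YH_I n q" "j \<in> YH_J d n"
  shows "weight i j (eI i * eJ j)"
proof -
  have i: "i \<in> {1..n} \<rightarrow>\<^sub>E I_labels q" and j: "j \<in> {1..n} \<rightarrow>\<^sub>E {1..d}"
    using assms by (simp_all add: YH_I_eq YH_J_eq)
  have "t b * (eI i * eJ j) = \<kappa> (\<xi> ^ j b) * (eI i * eJ j)" if b: "b \<in> {1..n}" for b
  proof -
    have "eI i * t b = t b * eI i"
      by (rule bicommutantD[OF xspec.eigenidempotent_in_C[OF i]]) (use t_X[OF _ b] in auto)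
    then have "t b * (eI i * eJ j) = eI i * (t b * eJ j)" by (simp add: mult.assoc[symmetric])
    also have "t b * eJ j = \<kappa> (\<xi> ^ j b) * eJ j"
      using tspec.joint_eigen_eigenidempotent[OF j] b by (simp add: tspec.joint_eigen_def t_eigen_def)
    finally show ?thesis by (simp add: \<kappa>_left_commute)
  qed
  then show ?thesis
    using assms xspec.joint_eigen_right[OF xspec.joint_eigen_eigenidempotent[OF i]]
    by (auto simp: weight_def tspec.joint_eigen_def t_eigen_def)
qed

text \<open>
  The products \<open>e(i) e(j)\<close> are weight vectors and add up to the unit.
\<close>

lemma eq_if_eq_on_weights:
  assumes "\<And>i j v. weight i j v \<Longrightarrow> x * v = y * v"
  shows "x = y"
proof (rule xspec.eq_if_eq_on_eigenvectors)
  fix i v assume i: "i \<in> {1..n} \<rightarrow>\<^sub>E I_labels q" and v: "xspec.joint_eigen i v"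
  have "x * eI i = y * eI i"
  proof (rule tspec.eq_if_eq_on_eigenvectors)
    fix j w assume j: "j \<in> {1..n} \<rightarrow>\<^sub>E {1..d}" and w: "tspec.joint_eigen j w"
    have "weight i j (eI i * eJ j * w)"
      using weight_right weight_idempotents i j by (simp add: YH_I_eq YH_J_eq)
    then have "x * (eI i * eJ j * w) = y * (eI i * eJ j * w)" by (rule assms)
    then show "x * eI i * w = y * eI i * w"
      using tspec.eigenidempotent_fixes[OF j w] by (simp add: mult.assoc)
  qed
  then have "x * (eI i * v) = y * (eI i * v)" by (simp add: mult.assoc[symmetric])
  then show "x * v = y * v" using xspec.eigenidempotent_fixes[OF i v] by simp
qed

lemma \<sigma>_YH_I: "a \<in> {1..<n} \<Longrightarrow> i \<in> YH_I n q \<Longrightarrow> i \<circ> \<sigma> a \<in> YH_I n q"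
  and \<sigma>_YH_J: "a \<in> {1..<n} \<Longrightarrow> j \<in> YH_J d n \<Longrightarrow> j \<circ> \<sigma> a \<in> YH_J d n"
  unfolding YH_I_eq YH_J_eq by (rule transpose_comp_PiE; assumption)+

subsection \<open>Inverses of differences of Jucys--Murphy elements\<close>

lemma X_difference_inverse:
  assumes a: "a \<in> {1..n}" and b: "b \<in> {1..n}" and i: "i \<in> {1..n} \<rightarrow>\<^sub>E I_labels q" and ne: "i a \<noteq> i b"
  shows "\<exists>r\<in>bicommutant (X ` {1..n}). (X a - X b) * r * eI i = eI i"
proof -
  let ?B = "bicommutant (X ` {1..n})" and ?c = "q powi i a" and ?c' = "q powi i b"
  have eig: "X_eigen b' (i b') (eI i)" if "b' \<in> {1..n}" for b'
    using xspec.joint_eigen_eigenidempotent[OF i] that by (simp add: xspec.joint_eigen_def)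
  obtain N M where N: "(X a - \<kappa> ?c) ^ N * eI i = 0" and M: "(X b - \<kappa> ?c') ^ M * eI i = 0"
    using eig[OF a] eig[OF b] by (auto simp: X_eigen_def)
  have "?c' \<noteq> ?c"
    using powi_labels_inj[OF q_nonzero q_not_one, of "i a" "i b"] ne i a b by (auto simp: PiE_def Pi_def)
  \<comment> \<open>Write \<open>X\<^sub>a - X\<^sub>b = (X\<^sub>a - c') - (X\<^sub>b - c')\<close>: the first term is invertible on \<open>e(i)\<close>, since
  \<open>c'\<close> is not an eigenvalue of \<open>X\<^sub>a\<close> there, and the second one is nilpotent.\<close>
  then obtain w where w: "w \<in> ?B" "(X a - \<kappa> ?c') * w * eI i = eI i"
    using shifted_inverse[OF _ N X_bicommutant[OF a]] by blast
  let ?r = "\<Sum>k<M. (X b - \<kappa> ?c') ^ k * w ^ Suc k"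
  have y: "X b - \<kappa> ?c' \<in> ?B" by (intro bicommutant_diff \<kappa>_bicommutant X_bicommutant b)
  have u: "X a - \<kappa> ?c' \<in> ?B" by (intro bicommutant_diff \<kappa>_bicommutant X_bicommutant a)
  have "(X a - \<kappa> ?c' - (X b - \<kappa> ?c')) * ?r * eI i = eI i"
    by (rule inverse_of_unit_minus_nilpotent[OF xspec.C_commute[OF u y] w(2)
          xspec.C_commute[OF w(1) xspec.eigenidempotent_in_C[OF i]] M])
  moreover have "?r \<in> ?B" by (intro bicommutant_sum bicommutant_mult bicommutant_power y w(1))
  ultimately show ?thesis by auto
qed

text \<open>
  Only finitely many \<open>e(i)\<close> are nonzero, so the inverses on the single \<open>e(i)\<close> can be added up.
\<close>

lemma R_exists:
  assumes a: "a \<in> {1..n}" and b: "b \<in> {1..n}"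
  shows "\<exists>r\<in>bicommutant (X ` {1..n}). \<forall>i v. i \<in> YH_I n q \<longrightarrow> i a \<noteq> i b \<longrightarrow> xspec.joint_eigen i v
           \<longrightarrow> (X a - X b) * (r * v) = v"
proof -
  let ?B = "bicommutant (X ` {1..n})" and ?S = "{i \<in> xspec.spectrum. i a \<noteq> i b}"
  have S: "i \<in> {1..n} \<rightarrow>\<^sub>E I_labels q" if "i \<in> ?S" for i using that xspec.spectrum_subset by auto
  have "\<forall>i\<in>?S. \<exists>r. r \<in> ?B \<and> (X a - X b) * r * eI i = eI i"
    using X_difference_inverse[OF a b S] by blast
  from bchoice[OF this] obtain r
    where r: "\<And>i. i \<in> ?S \<Longrightarrow> r i \<in> ?B" "\<And>i. i \<in> ?S \<Longrightarrow> (X a - X b) * r i * eI i = eI i"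
    by blast
  have fin: "finite ?S" using xspec.finite_spectrum by simp
  define R where "R = (\<Sum>i\<in>?S. r i * eI i)"
  have "R \<in> ?B" unfolding R_def
    by (intro bicommutant_sum bicommutant_mult r xspec.eigenidempotent_in_C S)
  moreover have "(X a - X b) * (R * v) = v"
    if i: "i \<in> YH_I n q" "i a \<noteq> i b" and v: "xspec.joint_eigen i v" for i v
  proof (cases "i \<in> ?S")
    case True
    have "R * v = (\<Sum>k\<in>?S. r k * (eI k * v))" by (simp add: R_def sum_distrib_right mult.assoc)
    also have "\<dots> = (\<Sum>k\<in>?S. if k = i then r i * (eI i * v) else 0)"
      by (rule sum.cong) (use xspec.eigenidempotent_kills[OF S S[OF True] _ v] in auto)
    also have "\<dots> = r i * (eI i * v)" using True fin by simp
    finally have "(X a - X b) * (R * v) = (X a - X b) * r i * eI i * v" by (simp add: mult.assoc)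
    then show ?thesis using r(2)[OF True] xspec.eigenidempotent_fixes[OF S[OF True] v] by simp
  next
    case False
    then have "eI i = 0" using i by (auto simp: xspec.spectrum_def YH_I_eq)
    then have "v = 0" using xspec.eigenidempotent_fixes[of i v] i v by (simp add: YH_I_eq)
    then show ?thesis by simp
  qed
  ultimately show ?thesis by blast
qed

text \<open>
  The fraction \<open>1 / (X\<^sub>a - X\<^sub>b)\<close>, simultaneously on all weight spaces where it makes sense.
\<close>

definition R :: "nat \<Rightarrow> nat \<Rightarrow> 'a" where
  "R a b = (SOME r. r \<in> bicommutant (X ` {1..n}) \<and> (\<forall>i v. i \<in> YH_I n q \<longrightarrow> i a \<noteq> i b \<longrightarrow>
     xspec.joint_eigen i v \<longrightarrow> (X a - X b) * (r * v) = v))"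

lemma R_bicommutant: "a \<in> {1..n} \<Longrightarrow> b \<in> {1..n} \<Longrightarrow> R a b \<in> bicommutant (X ` {1..n})"
  and R_eigen: "a \<in> {1..n} \<Longrightarrow> b \<in> {1..n} \<Longrightarrow> i \<in> YH_I n q \<Longrightarrow> i a \<noteq> i b \<Longrightarrow> xspec.joint_eigen i v \<Longrightarrow>
    (X a - X b) * (R a b * v) = v"
  using someI_ex[OF R_exists[of a b, unfolded Bex_def], folded R_def] by blast+

lemma R_X: "a \<in> {1..n} \<Longrightarrow> b \<in> {1..n} \<Longrightarrow> c \<in> {1..n} \<Longrightarrow> R a b * X c = X c * R a b"
  using xspec.C_commute R_bicommutant X_bicommutant by blast

lemma R_R: "a \<in> {1..n} \<Longrightarrow> b \<in> {1..n} \<Longrightarrow> a' \<in> {1..n} \<Longrightarrow> b' \<in> {1..n} \<Longrightarrow> R a b * R a' b' = R a' b' * R a b"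
  using xspec.C_commute R_bicommutant by blast

lemma R_eigen_inverse:
  assumes ab: "a \<in> {1..n}" "b \<in> {1..n}" and v: "xspec.joint_eigen i v" "i \<in> YH_I n q" and ne: "i a \<noteq> i b"
  shows "(X a - X b) * (R a b * v) = v" "R a b * ((X a - X b) * v) = v"
proof -
  show 1: "(X a - X b) * (R a b * v) = v" using R_eigen assms by blast
  have "R a b * (X a - X b) = (X a - X b) * R a b"
    using R_X ab by (simp add: algebra_simps)
  then show "R a b * ((X a - X b) * v) = v" using 1 by (simp add: mult.assoc[symmetric])
qed

lemma R_inverse:
  assumes "a \<in> {1..n}" "b \<in> {1..n}" "weight i j v" "i a \<noteq> i b"
  shows "(X a - X b) * (R a b * v) = v" "R a b * ((X a - X b) * v) = v"
  using R_eigen_inverse[OF assms(1,2) weightD(3,1)[OF assms(3)] assms(4)] by blast+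

text \<open>
  An operator intertwining \<open>X\<^sub>a, X\<^sub>b\<close> with \<open>X\<^sub>a\<^sub>', X\<^sub>b\<^sub>'\<close> intertwines the inverses of the differences.
\<close>

lemma R_intertwine:
  assumes ab: "a \<in> {1..n}" "b \<in> {1..n}" "a' \<in> {1..n}" "b' \<in> {1..n}"
    and v: "weight i j v" and ne: "i a \<noteq> i b" "i' a' \<noteq> i' b'"
    and f: "\<And>w. weight i j w \<Longrightarrow> weight i' j' (f * w)"
    and fa: "\<And>w. weight i j w \<Longrightarrow> X a' * (f * w) = f * (X a * w)"
    and fb: "\<And>w. weight i j w \<Longrightarrow> X b' * (f * w) = f * (X b * w)"
  shows "R a' b' * (f * v) = f * (R a b * v)"
proof -
  let ?w = "R a b * v"
  have w: "weight i j ?w" using weight_X_bicommutant[OF R_bicommutant[OF ab(1,2)] v] .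
  have "f * v = f * ((X a - X b) * ?w)" using R_inverse(1)[OF ab(1,2) v ne(1)] by simp
  also have "\<dots> = (X a' - X b') * (f * ?w)"
    using fa[OF w] fb[OF w] by (simp add: left_diff_distrib right_diff_distrib)
  finally show ?thesis using R_inverse(2)[OF ab(3,4) f[OF w] ne(2)] by simp
qed

text \<open>
  The coefficient \<open>(q - 1) X\<^sub>b / (X\<^sub>a - X\<^sub>b) = (1 - q) (1 - X\<^sub>a X\<^sub>b\<^sup>-\<^sup>1)\<^sup>-\<^sup>1\<close> of the identity in the intertwiner.
\<close>

definition coef :: "nat \<Rightarrow> nat \<Rightarrow> 'a" where
  "coef a b = \<kappa> (q - 1) * X b * R a b"

lemma coef_bicommutant: "a \<in> {1..n} \<Longrightarrow> b \<in> {1..n} \<Longrightarrow> coef a b \<in> bicommutant (X ` {1..n})"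
  unfolding coef_def by (intro bicommutant_mult \<kappa>_bicommutant X_bicommutant R_bicommutant)

lemma coef_X: "a \<in> {1..n} \<Longrightarrow> b \<in> {1..n} \<Longrightarrow> c \<in> {1..n} \<Longrightarrow> coef a b * X c = X c * coef a b"
  using xspec.C_commute coef_bicommutant X_bicommutant by blast

lemma coef_coef: "a \<in> {1..n} \<Longrightarrow> b \<in> {1..n} \<Longrightarrow> a' \<in> {1..n} \<Longrightarrow> b' \<in> {1..n} \<Longrightarrow>
   coef a b * coef a' b' = coef a' b' * coef a b"
  using xspec.C_commute coef_bicommutant by blast

lemma weight_X: "a \<in> {1..n} \<Longrightarrow> weight i j v \<Longrightarrow> weight i j (X a * v)"
  and weight_R: "a \<in> {1..n} \<Longrightarrow> b \<in> {1..n} \<Longrightarrow> weight i j v \<Longrightarrow> weight i j (R a b * v)"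
  and weight_coef: "a \<in> {1..n} \<Longrightarrow> b \<in> {1..n} \<Longrightarrow> weight i j v \<Longrightarrow> weight i j (coef a b * v)"
  using weight_X_bicommutant X_bicommutant R_bicommutant coef_bicommutant by blast+

lemma coef_intertwine:
  assumes ab: "a \<in> {1..n}" "b \<in> {1..n}" "a' \<in> {1..n}" "b' \<in> {1..n}"
    and v: "weight i j v" and ne: "i a \<noteq> i b" "i' a' \<noteq> i' b'"
    and f: "\<And>w. weight i j w \<Longrightarrow> weight i' j' (f * w)"
    and fa: "\<And>w. weight i j w \<Longrightarrow> X a' * (f * w) = f * (X a * w)"
    and fb: "\<And>w. weight i j w \<Longrightarrow> X b' * (f * w) = f * (X b * w)"
  shows "coef a' b' * (f * v) = f * (coef a b * v)"
  using R_intertwine[OF assms] fb[OF weight_R[OF ab(1,2) v]]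
  by (simp add: coef_def mult.assoc \<kappa>_left_commute)

lemma coef_swap:
  assumes ab: "a \<in> {1..n}" "b \<in> {1..n}" and v: "weight i j v" and ne: "i a \<noteq> i b"
  shows "coef b a * v = \<kappa> (1 - q) * v - coef a b * v"
proof -
  have "R b a * v = R b a * ((X a - X b) * (R a b * v))" using R_inverse(1)[OF ab v ne] by simp
  also have "\<dots> = - (R b a * ((X b - X a) * (R a b * v)))" by (simp add: algebra_simps)
  also have "\<dots> = - (R a b * v)"
    using R_inverse(2)[OF ab(2,1) weight_R[OF ab v]] ne by simp
  finally have R: "R b a * v = - (R a b * v)" .
  have "coef b a * v + coef a b * v = - (\<kappa> (q - 1) * ((X a - X b) * (R a b * v)))"
    by (simp add: coef_def mult.assoc R algebra_simps)
  also have "\<dots> = \<kappa> (1 - q) * v"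
    using R_inverse(1)[OF ab v ne] by (simp add: \<kappa>_diff algebra_simps)
  finally show ?thesis by (simp add: algebra_simps)
qed

lemma X_coef:
  assumes ab: "a \<in> {1..n}" "b \<in> {1..n}" and v: "weight i j v" and ne: "i a \<noteq> i b"
  shows "X a * (coef a b * v) = X b * (coef a b * v) + \<kappa> (q - 1) * (X b * v)"
proof -
  have "(X a - X b) * (coef a b * v) = coef a b * ((X a - X b) * v)"
  proof -
    have "(X a - X b) * coef a b = coef a b * (X a - X b)"
      using coef_X[OF ab ab(1)] coef_X[OF ab ab(2)] by (simp add: algebra_simps)
    then show ?thesis by (simp add: mult.assoc[symmetric])
  qed
  also have "\<dots> = \<kappa> (q - 1) * (X b * v)"
    using R_inverse(2)[OF ab v ne] by (simp add: coef_def mult.assoc)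
  finally show ?thesis by (simp add: algebra_simps)
qed

subsection \<open>Products of coefficients\<close>

text \<open>
  Apply the inverse of \<open>X\<^sub>a - X\<^sub>c = (X\<^sub>a - X\<^sub>b) + (X\<^sub>b - X\<^sub>c)\<close> to the product of the two fractions.
\<close>

lemma R_partial_fractions:
  assumes abc: "a \<in> {1..n}" "b \<in> {1..n}" "c \<in> {1..n}" and v: "weight i j v"
    and ne: "i a \<noteq> i b" "i b \<noteq> i c" "i a \<noteq> i c"
  shows "R a b * (R b c * v) = R a c * (R b c * v) + R a c * (R a b * v)"
proof -
  note w = v weight_R[OF abc(1,2) v] weight_R[OF abc(2,3) v] weight_R[OF abc(1,2) weight_R[OF abc(2,3) v]]
  let ?u = "R a b * (R b c * v)"
  have "R a c * ((X a - X c) * ?u) = ?u" using R_inverse(2)[OF abc(1,3) w(4) ne(3)] .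
  moreover have "(X a - X c) * ?u = (X a - X b) * ?u + (X b - X c) * ?u" by (simp add: algebra_simps)
  moreover have "(X a - X b) * ?u = R b c * v" using R_inverse(1)[OF abc(1,2) w(3) ne(1)] .
  moreover have "(X b - X c) * ?u = R a b * v"
  proof -
    have "?u = R b c * (R a b * v)" using R_R[OF abc(1,2,2,3)] by (simp add: mult.assoc[symmetric])
    then show ?thesis using R_inverse(1)[OF abc(2,3) w(2) ne(2)] by simp
  qed
  ultimately show ?thesis by (simp add: distrib_left)
qed

text \<open>The partial fraction identity behind the braid relation of the intertwiners.\<close>

lemma coef_partial_fractions:
  assumes abc: "a \<in> {1..n}" "b \<in> {1..n}" "c \<in> {1..n}" and v: "weight i j v"
    and ne: "i a \<noteq> i b" "i b \<noteq> i c" "i a \<noteq> i c"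
  shows "coef a b * (coef a c * v) = coef a b * (coef b c * v) - coef a c * (coef b c * v) - \<kappa> (q - 1) * (coef a c * v)"
proof -
  let ?k = "\<kappa> (q - 1)"
  note RX = R_X[OF abc(1,2)] R_X[OF abc(2,3)] R_X[OF abc(1,3)]
  note comm = RX[OF abc(1)] RX[OF abc(2)] RX[OF abc(3)] R_R[OF abc(1,3) abc(1,2)] X_commute[OF abc(3,2)]
  note comms = comm[THEN mult_eq_assoc] mult.assoc
    \<kappa>_left_commute[of "X a"] \<kappa>_left_commute[of "X b"] \<kappa>_left_commute[of "X c"] \<kappa>_left_commute[of "R a b"]
    \<kappa>_left_commute[of "R b c"] \<kappa>_left_commute[of "R a c"]
  let ?u = "R a c * (R b c * v)" and ?w = "R a b * (R a c * v)"
  have pf: "R a b * (R b c * v) = ?u + ?w"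
    using R_partial_fractions[OF abc v ne] comms by simp
  have ps: "coef a b * (coef a c * v) = ?k * (?k * (X b * (X c * ?w)))"
    by (simp add: coef_def comms)
  have pr: "coef a b * (coef b c * v) = ?k * (?k * (X b * (X c * (?u + ?w))))"
    by (simp add: coef_def comms pf)
  have sr: "coef a c * (coef b c * v) = ?k * (?k * (X c * (X c * ?u)))"
    by (simp add: coef_def comms)
  have "coef a c * v = ?k * (X c * (R a c * ((X b - X c) * (R b c * v))))"
    using R_inverse(1)[OF abc(2,3) v ne(2)] by (simp add: coef_def mult.assoc)
  also have "\<dots> = ?k * (X b * (X c * ?u)) - ?k * (X c * (X c * ?u))"
    by (simp add: left_diff_distrib right_diff_distrib comms)
  finally have s: "coef a c * v = \<dots>" .
  show ?thesis unfolding ps pr sr unfolding s by (simp add: algebra_simps)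
qed

subsection \<open>The intertwiners\<close>

text \<open>
  The label set is infinite if \<open>q\<close> is not a root of unity, but only finitely many idempotents are
  nonzero.
\<close>

definition support_sum :: "('s \<Rightarrow> 'a) \<Rightarrow> 's set \<Rightarrow> 'a" where
  "support_sum f S = sum f {s \<in> S. f s \<noteq> 0}"

definition ePar :: "nat set set \<Rightarrow> 'a" where
  "ePar A = sum eJ {j \<in> YH_J d n. \<forall>a\<in>{1..n}. \<forall>b\<in>{1..n}. j a = j b \<longleftrightarrow> same_block A a b}"

definition \<Phi> :: "nat \<Rightarrow> 'a" where
  "\<Phi> a = g a
     + \<kappa> (1 - q) * support_sum (\<lambda>(i, A). - (X (a + 1) * R a (a + 1)) * (eI i * ePar A))
        {(i, A). i \<in> YH_I n q \<and> A \<in> SetPar n \<and> i a \<noteq> i (a + 1) \<and> same_block A a (a + 1)}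
     + support_sum (\<lambda>(i, A). eI i * ePar A)
        {(i, A). i \<in> YH_I n q \<and> A \<in> SetPar n \<and> i a = i (a + 1) \<and> same_block A a (a + 1)}"

text \<open>
  On vectors of weight \<open>(i, j)\<close> the idempotent of a set partition is the identity for the partition
  into level sets of \<open>j\<close> and zero for every other one.
\<close>

definition blocks :: "(nat \<Rightarrow> nat) \<Rightarrow> nat set set" where
  "blocks j = (\<lambda>a. {b \<in> {1..n}. j b = j a}) ` {1..n}"

lemma blocks_SetPar: "blocks j \<in> SetPar n"
  unfolding SetPar_def blocks_def by (auto intro!: partition_onI simp: disjnt_def)

lemma same_block_blocks: "a \<in> {1..n} \<Longrightarrow> b \<in> {1..n} \<Longrightarrow> same_block (blocks j) a b \<longleftrightarrow> j a = j b"
  unfolding same_block_def blocks_def by auto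

lemma eq_blocks:
  assumes A: "A \<in> SetPar n" and same: "\<And>a b. a \<in> {1..n} \<Longrightarrow> b \<in> {1..n} \<Longrightarrow> j a = j b \<longleftrightarrow> same_block A a b"
  shows "A = blocks j"
proof -
  have part: "partition_on {1..n} A" using A by (simp add: SetPar_def)
  have block: "B = {b \<in> {1..n}. j b = j a}" if B: "B \<in> A" "a \<in> B" for B a
  proof -
    have sub: "B' \<subseteq> {1..n}" if "B' \<in> A" for B' using partition_onD1[OF part] that by auto
    then have a: "a \<in> {1..n}" using B by blast
    have "b \<in> B \<longleftrightarrow> same_block A b a" for b
      unfolding same_block_def using B partition_onD2[OF part] by (auto simp: disjoint_def)
    then show ?thesis using same[OF _ a] sub[OF B(1)] by blast
  qed
  show ?thesis
  proof
    show "A \<subseteq> blocks j"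
    proof
      fix B assume B: "B \<in> A"
      then obtain a where a: "a \<in> B" using partition_onD3[OF part] by fastforce
      then have "a \<in> {1..n}" using B partition_onD1[OF part] by auto
      then show "B \<in> blocks j" using block[OF B a] by (auto simp: blocks_def)
    qed
    show "blocks j \<subseteq> A"
    proof
      fix B assume "B \<in> blocks j"
      then obtain a where a: "a \<in> {1..n}" "B = {b \<in> {1..n}. j b = j a}" by (auto simp: blocks_def)
      then obtain B' where "B' \<in> A" "a \<in> B'" using partition_onD1[OF part] by auto
      then show "B \<in> A" using block a by blast
    qed
  qed
qed

lemma eJ_weight:
  assumes v: "weight i j v" and j': "j' \<in> YH_J d n"
  shows "eJ j' * v = (if j' = j then v else 0)"
  using tspec.eigenidempotent_fixes[OF _ weightD(4)[OF v]] tspec.eigenidempotent_kills[OF _ _ _ weightD(4)[OF v], of j']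
    weightD(2)[OF v] j' by (auto simp: YH_J_eq)

lemma eI_weight:
  assumes v: "weight i j v" and i': "i' \<in> YH_I n q"
  shows "eI i' * v = (if i' = i then v else 0)"
  using xspec.eigenidempotent_fixes[OF _ weightD(3)[OF v]] xspec.eigenidempotent_kills[OF _ _ _ weightD(3)[OF v], of i']
    weightD(1)[OF v] i' by (auto simp: YH_I_eq)

lemma finite_YH_J: "finite (YH_J d n)"
  unfolding YH_J_def by (rule finite_PiE) auto

lemma sum_eJ_weight:
  assumes v: "weight i j v" and S: "S \<subseteq> YH_J d n"
  shows "sum eJ S * v = (if j \<in> S then v else 0)"
proof -
  have "sum eJ S * v = (\<Sum>j'\<in>S. if j' = j then v else 0)"
    unfolding sum_distrib_right by (rule sum.cong) (use eJ_weight[OF v] S in auto)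
  then show ?thesis using finite_subset[OF S finite_YH_J] by simp
qed

lemma ePar_weight:
  assumes v: "weight i j v" and A: "A \<in> SetPar n"
  shows "ePar A * v = (if A = blocks j then v else 0)"
proof -
  have "(\<forall>a\<in>{1..n}. \<forall>b\<in>{1..n}. j a = j b \<longleftrightarrow> same_block A a b) \<longleftrightarrow> A = blocks j"
    using eq_blocks[OF A, of j] same_block_blocks[of _ _ j] by metis
  then show ?thesis
    unfolding ePar_def using sum_eJ_weight[OF v] weightD(2)[OF v] by (subst sum_eJ_weight[OF v]) auto
qed

lemma finite_SetPar: "finite (SetPar n)"
proof (rule finite_subset)
  show "SetPar n \<subseteq> Pow (Pow {1..n})" by (auto simp: SetPar_def partition_on_def)
qed simp

lemma support_sum_weight:
  assumes v: "weight i j v" and T: "T \<subseteq> YH_I n q \<times> SetPar n"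
  shows "support_sum (\<lambda>(i, A). h * (eI i * ePar A)) T * v = (if (i, blocks j) \<in> T then h * v else 0)"
proof -
  let ?f = "\<lambda>(i, A). h * (eI i * ePar A)" and ?S = "{p \<in> T. (\<lambda>(i, A). h * (eI i * ePar A)) p \<noteq> 0}"
  have "?S \<subseteq> xspec.spectrum \<times> SetPar n"
  proof
    fix p assume p: "p \<in> ?S"
    obtain i' A where "p = (i', A)" by force
    moreover have "eI i' \<noteq> 0" using p calculation by auto
    ultimately show "p \<in> xspec.spectrum \<times> SetPar n"
      using p T by (auto simp: xspec.spectrum_def YH_I_eq)
  qed
  then have fin: "finite ?S" using finite_subset xspec.finite_spectrum finite_SetPar by blast
  have f: "?f p * v = (if p = (i, blocks j) then h * v else 0)" if "p \<in> T" for p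
  proof -
    obtain i' A where p: "p = (i', A)" by force
    then have iA: "i' \<in> YH_I n q" "A \<in> SetPar n" using that T by auto
    show ?thesis using p ePar_weight[OF v iA(2)] eI_weight[OF v iA(1)] by (auto simp: mult.assoc)
  qed
  have "support_sum ?f T * v = (\<Sum>p\<in>?S. ?f p * v)"
    by (simp add: support_sum_def sum_distrib_right)
  also have "\<dots> = (\<Sum>p\<in>?S. if p = (i, blocks j) then h * v else 0)"
    by (rule sum.cong) (use f in auto)
  also have "\<dots> = (if (i, blocks j) \<in> ?S then h * v else 0)" using fin by simp
  also have "\<dots> = (if (i, blocks j) \<in> T then h * v else 0)"
    using f[of "(i, blocks j)"] by auto
  finally show ?thesis .
qed

text \<open>
  On \<open>v\<close> only the summand for \<open>i\<close> and the partition into level sets of \<open>j\<close> survives.  All relations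
  of the intertwiners are derived from this description.
\<close>

lemma \<Phi>_weight:
  assumes a: "1 \<le> a" "a < n" and b: "b = a + 1" and v: "weight i j v"
  shows "\<Phi> a * v = g a * v + (if j a \<noteq> j b then 0 else if i a = i b then v else coef a b * v)"
proof -
  let ?T = "\<lambda>P. {(i, A). i \<in> YH_I n q \<and> A \<in> SetPar n \<and> P i A \<and> same_block A a (a + 1)}"
  have sub: "?T P \<subseteq> YH_I n q \<times> SetPar n" for P by auto
  have mem: "(i, blocks j) \<in> ?T P \<longleftrightarrow> P i (blocks j) \<and> j a = j b" for P
    using weightD(1)[OF v] blocks_SetPar same_block_blocks[of a b j] a b by auto
  note s1 = support_sum_weight[OF v sub, of "- (X (a + 1) * R a (a + 1))" "\<lambda>i A. i a \<noteq> i (a + 1)", unfolded mem]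
  note s2 = support_sum_weight[OF v sub, of 1 "\<lambda>i A. i a = i (a + 1)", unfolded mem mult_1]
  have k: "\<kappa> (1 - q) = - \<kappa> (q - 1)" by (simp add: \<kappa>_diff)
  show ?thesis
    unfolding \<Phi>_def distrib_right mult.assoc[of "\<kappa> (1 - q)"] s1 s2
    by (simp add: b coef_def k mult.assoc)
qed

subsection \<open>Intertwining relations on weight vectors\<close>

lemma coef_X_left: "a \<in> {1..n} \<Longrightarrow> b \<in> {1..n} \<Longrightarrow> c \<in> {1..n} \<Longrightarrow> coef a b * (X c * w) = X c * (coef a b * w)"
  using coef_X by (simp add: mult.assoc[symmetric])

text \<open>
  If \<open>f\<close> intertwines \<open>y\<close> and \<open>x\<close> up to a term \<open>z\<close>, then it maps the generalised kernel of \<open>y\<close> to that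
  of \<open>x\<close>, as long as \<open>x\<close> is nilpotent on the values of \<open>z\<close>.
\<close>

lemma nilpotent_transfer:
  assumes x: "x \<in> bicommutant (X ` {1..n})" and y: "y \<in> bicommutant (X ` {1..n})"
    and z: "z \<in> bicommutant (X ` {1..n})"
    and f: "\<And>w. weight i j w \<Longrightarrow> x * (f * w) = f * (y * w) + z * w"
    and "weight i j v" "y ^ m * v = 0" "x ^ l * (z * v) = 0"
  shows "x ^ (m + l) * (f * v) = 0"
  using assms(5-)
proof (induction m arbitrary: v)
  case 0
  then show ?case by simp
next
  case (Suc m)
  have comm: "x ^ l * z * y = y * (x ^ l * z)"
    by (rule xspec.C_commute[OF _ y]) (intro bicommutant_mult bicommutant_power x z)
  have 1: "x ^ (m + l) * (f * (y * v)) = 0"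
  proof (rule Suc.IH)
    show "weight i j (y * v)" using weight_X_bicommutant[OF y Suc.prems(1)] .
    show "y ^ m * (y * v) = 0" using Suc.prems(2) by (simp only: mult.assoc[symmetric] power_Suc2)
    have "x ^ l * (z * (y * v)) = x ^ l * z * y * v" by (simp only: mult.assoc)
    also have "\<dots> = y * (x ^ l * z) * v" by (simp only: comm)
    also have "\<dots> = y * (x ^ l * (z * v))" by (simp only: mult.assoc)
    finally show "x ^ l * (z * (y * v)) = 0" using Suc.prems(3) by simp
  qed
  have "x ^ (m + l) * (z * v) = x ^ m * (x ^ l * (z * v))" by (simp only: power_add mult.assoc)
  then have 2: "x ^ (m + l) * (z * v) = 0" using Suc.prems(3) by simp
  have "x ^ (Suc m + l) * (f * v) = x ^ (m + l) * (x * (f * v))"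
    by (simp only: add_Suc power_Suc2 mult.assoc)
  also have "\<dots> = 0" using f[OF Suc.prems(1)] 1 2 by (simp add: distrib_left)
  finally show ?case .
qed

context
  fixes a b :: nat
  assumes a: "1 \<le> a" and b: "b = a + 1" and bn: "b \<le> n"
begin

lemma ab_mem: "a \<in> {1..n}" "b \<in> {1..n}" "a \<in> {1..<n}" "a < n"
  using a b bn by auto

lemmas \<Phi>_weight' = \<Phi>_weight[OF a ab_mem(4) b]

lemma ee_weight: "weight i j v \<Longrightarrow> ee a * v = (if j a = j b then v else 0)"
  using ee_eigen[OF ab_mem(3)] weightD b by simp

lemma g_g_weight:
  assumes v: "weight i j v"
  shows "g a * (g a * v) = \<kappa> q * v + (if j a = j b then \<kappa> (q - 1) * (g a * v) else 0)"
proof -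
  have "g a * (g a * v) = (\<kappa> q + \<kappa> (q - 1) * (g a * ee a)) * v"
    using g_square[OF ab_mem(3)] g_ee[OF ab_mem(3)] by (simp add: mult.assoc[symmetric])
  then show ?thesis using ee_weight[OF v] by (simp add: distrib_right mult.assoc)
qed

lemma X_g_upper:
  assumes v: "weight i j v"
  shows "X b * (g a * v) = g a * (X a * v) + (if j a = j b then \<kappa> (q - 1) * (X b * v) else 0)"
proof -
  have "X b * (g a * v) = (X b * g a) * v" by (simp add: mult.assoc)
  also have "X b * g a = g a * X a + \<kappa> (q - 1) * (X b * ee a)"
    using X_upper[OF ab_mem(3)] ee_X[OF ab_mem(3,2)] b by (simp add: mult.assoc)
  finally show ?thesis using ee_weight[OF v] by (simp add: distrib_right mult.assoc)
qed

lemma X_g_lower: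
  assumes v: "weight i j v"
  shows "X a * (g a * v) = g a * (X b * v) - (if j a = j b then \<kappa> (q - 1) * (X b * v) else 0)"
proof -
  have "X a * (g a * v) = (X a * g a) * v" by (simp add: mult.assoc)
  also have "X a * g a = g a * X b - \<kappa> (q - 1) * (X b * ee a)"
    using X_lower[OF ab_mem(3)] ee_X[OF ab_mem(3,2)] b by (simp add: mult.assoc)
  finally show ?thesis using ee_weight[OF v] by (simp add: left_diff_distrib mult.assoc)
qed

text \<open>
  The error \<open>(q - 1) X\<^sub>b\<close> in the Bernstein relation equals \<open>(X\<^sub>a - X\<^sub>b) c\<^sub>a\<^sub>b\<close>, so the coefficient in \<open>\<Phi>\<^sub>a\<close>
  cancels it.  Adding the identity instead leaves \<open>(q - 1) X\<^sub>b + X\<^sub>b - X\<^sub>a = q X\<^sub>b - X\<^sub>a\<close>.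
\<close>

lemma X_\<Phi>_upper:
  assumes v: "weight i j v"
  shows "X b * (\<Phi> a * v) = \<Phi> a * (X a * v)
    + (if i a = i b \<and> j a = j b then \<kappa> q * (X b * v) - X a * v else 0)"
  using X_g_upper[OF v] X_coef[OF ab_mem(1,2) v] coef_X_left[OF ab_mem(1,2,1)]
  by (simp add: \<Phi>_weight'[OF v] \<Phi>_weight'[OF weight_X[OF ab_mem(1) v]] distrib_left \<kappa>_diff \<kappa>_one
      left_diff_distrib)

lemma X_\<Phi>_lower:
  assumes v: "weight i j v"
  shows "X a * (\<Phi> a * v) = \<Phi> a * (X b * v)
    - (if i a = i b \<and> j a = j b then \<kappa> q * (X b * v) - X a * v else 0)"
  using X_g_lower[OF v] X_coef[OF ab_mem(1,2) v] coef_X_left[OF ab_mem(1,2,2)]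
  by (simp add: \<Phi>_weight'[OF v] \<Phi>_weight'[OF weight_X[OF ab_mem(2) v]] distrib_left \<kappa>_diff \<kappa>_one
      left_diff_distrib)

lemma X_\<Phi>_other:
  assumes v: "weight i j v" and c: "c \<in> {1..n}" "c \<noteq> a" "c \<noteq> b"
  shows "X c * (\<Phi> a * v) = \<Phi> a * (X c * v)"
proof -
  have "X c * (g a * v) = g a * (X c * v)"
    using g_X[OF ab_mem(3) c(1,2)] c(3) b by (simp add: mult.assoc[symmetric])
  then show ?thesis
    using coef_X_left[OF ab_mem(1,2) c(1)]
    by (simp add: \<Phi>_weight'[OF v] \<Phi>_weight'[OF weight_X[OF c(1) v]] distrib_left)
qed

text \<open>
  If \<open>i\<^sub>a = i\<^sub>b\<close> and \<open>j\<^sub>a = j\<^sub>b\<close>, then \<open>\<Phi>\<^sub>a\<close> intertwines the Jucys--Murphy elements only up to a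
  lower-order term; that term is nilpotent, so the generalised eigenspaces are still preserved.
\<close>

lemma weight_\<Phi>:
  assumes v: "weight i j v"
  shows "weight (i \<circ> Transposition.transpose a b) (j \<circ> Transposition.transpose a b) (\<Phi> a * v)"
proof -
  let ?s = "Transposition.transpose a b" and ?B = "bicommutant (X ` {1..n})"
  let ?z = "if i a = i b \<and> j a = j b then \<kappa> q * X b - X a else 0"
  have z: "?z \<in> ?B"
    using bicommutant_zero ab_mem by (auto intro!: bicommutant_diff bicommutant_mult \<kappa>_bicommutant X_bicommutant)
  have X_eig: "X_eigen c (i (?s c)) (\<Phi> a * v)" if c: "c \<in> {1..n}" for c
  proof -
    let ?k = "\<kappa> (q powi i (?s c))"
    let ?x = "X c - ?k" and ?y = "X (?s c) - ?k"
    \<comment> \<open>The errors at \<open>a\<close> and \<open>b\<close> are opposite; there is none at the other indices.\<close>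
    define e where "e = (if c = a then - 1 else if c = b then 1 else 0 :: 'a)"
    have e: "e \<in> ?B" unfolding e_def
      using bicommutant_zero bicommutant_one bicommutant_minus[OF bicommutant_one] by auto
    have sc: "?s c \<in> {1..n}" using transpose_mem[OF ab_mem(3) c] b by simp
    have x: "?x \<in> ?B" and y: "?y \<in> ?B"
      by (intro bicommutant_diff \<kappa>_bicommutant X_bicommutant c sc)+
    have ez: "e * ?z \<in> ?B" by (rule bicommutant_mult[OF e z])
    have f: "?x * (\<Phi> a * w) = \<Phi> a * (?y * w) + e * ?z * w" if w: "weight i j w" for w
    proof -
      have "X c * (\<Phi> a * w) = \<Phi> a * (X (?s c) * w) + e * ?z * w"
        using X_\<Phi>_upper[OF w] X_\<Phi>_lower[OF w] X_\<Phi>_other[OF w c]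
        by (auto simp: e_def Transposition.transpose_def left_diff_distrib mult.assoc)
      then show ?thesis by (simp add: left_diff_distrib right_diff_distrib \<kappa>_left_commute)
    qed
    obtain m where m: "?y ^ m * v = 0"
      using weightD(5)[OF v sc] by (auto simp: X_eigen_def)
    have "\<exists>l. ?x ^ l * (e * ?z * v) = 0"
    proof (cases "i a = i b \<and> (c = a \<or> c = b)")
      case True
      then have "i (?s c) = i c" by (auto simp: Transposition.transpose_def)
      then obtain l where l: "?x ^ l * v = 0"
        using weightD(5)[OF v c] by (auto simp: X_eigen_def)
      have "?x ^ l * (e * ?z) = e * ?z * ?x ^ l"
        by (rule xspec.C_commute[OF bicommutant_power[OF x] ez])
      then have "?x ^ l * (e * ?z * v) = e * ?z * (?x ^ l * v)"
        by (simp only: mult.assoc[symmetric])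
      then show ?thesis using l by auto
    next
      case False
      then have "e * ?z = 0" by (auto simp: e_def)
      then show ?thesis by simp
    qed
    then obtain l where "?x ^ l * (e * ?z * v) = 0" by blast
    from nilpotent_transfer[OF x y ez f v m this] show ?thesis by (auto simp: X_eigen_def)
  qed
  have "tspec.joint_eigen (j \<circ> ?s) (\<Phi> a * v)"
  proof -
    have g: "tspec.joint_eigen (j \<circ> ?s) (g a * v)"
      using t_eigen_g[OF ab_mem(3) weightD(4)[OF v]] b by simp
    have "j \<circ> ?s = j" if "j a = j b" using that by (auto simp: fun_eq_iff Transposition.transpose_def)
    then have "tspec.joint_eigen (j \<circ> ?s) w" if "weight i j w" "j a = j b" for w
      using weightD(4)[OF that(1)] that(2) by simp
    then have h: "tspec.joint_eigen (j \<circ> ?s) v \<and> tspec.joint_eigen (j \<circ> ?s) (coef a b * v)" if "j a = j b"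
      using v weight_coef[OF ab_mem(1,2) v] that by blast
    show ?thesis
      using g h by (auto simp: \<Phi>_weight'[OF v] tspec.joint_eigen_def t_eigen_def distrib_left)
  qed
  moreover have "xspec.joint_eigen (i \<circ> ?s) (\<Phi> a * v)"
    using X_eig by (simp add: xspec.joint_eigen_def)
  ultimately show ?thesis
    using weightD(1,2)[OF v] \<sigma>_YH_I[OF ab_mem(3)] \<sigma>_YH_J[OF ab_mem(3)] b by (simp add: weight_def)
qed

text \<open>Away from the exceptional case, \<open>\<Phi>\<^sub>a\<close> permutes the Jucys--Murphy elements, hence the coefficients.\<close>

lemma X_\<Phi>:
  assumes v: "weight i j v" and ne: "i a \<noteq> i b \<or> j a \<noteq> j b" and c: "c \<in> {1..n}"
  shows "X (Transposition.transpose a b c) * (\<Phi> a * v) = \<Phi> a * (X c * v)"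
  using X_\<Phi>_upper[OF v] X_\<Phi>_lower[OF v] X_\<Phi>_other[OF v c] ne
  by (auto simp: Transposition.transpose_def)

lemma coef_\<Phi>:
  assumes v: "weight i j v" and ne: "i a \<noteq> i b \<or> j a \<noteq> j b"
    and cd: "c \<in> {1..n}" "d' \<in> {1..n}" and icd: "i c \<noteq> i d'"
  shows "coef (Transposition.transpose a b c) (Transposition.transpose a b d') * (\<Phi> a * v) = \<Phi> a * (coef c d' * v)"
proof -
  have s: "Transposition.transpose a b x \<in> {1..n}" if "x \<in> {1..n}" for x
    using transpose_mem[OF ab_mem(3) that] b by simp
  show ?thesis
    by (rule coef_intertwine[OF cd s[OF cd(1)] s[OF cd(2)] v icd _ weight_\<Phi>])
      (use icd ne cd X_\<Phi> in auto)
qed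

text \<open>
  In the generic case \<open>c\<^sub>a\<^sub>b \<Phi>\<^sub>a = \<Phi>\<^sub>a c\<^sub>b\<^sub>a\<close>, and the terms linear in \<open>g\<^sub>a\<close> cancel because
  \<open>c\<^sub>a\<^sub>b + c\<^sub>b\<^sub>a = 1 - q\<close>.
\<close>

lemma \<Phi>_square:
  assumes v: "weight i j v"
  shows "\<Phi> a * (\<Phi> a * v) =
    (if j a \<noteq> j b then \<kappa> q * v
     else if i a = i b then \<kappa> (q + 1) * (\<Phi> a * v)
     else \<kappa> q * v + coef a b * (coef b a * v))"
proof (cases "j a = j b \<and> i a \<noteq> i b")
  case True
  let ?w = "coef b a * v"
  have w: "weight i j ?w" by (rule weight_coef[OF ab_mem(2,1) v])
  have "coef a b * (\<Phi> a * v) = \<Phi> a * ?w"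
    using coef_\<Phi>[OF v, of b a] True ab_mem by auto
  also have "\<dots> = g a * ?w + coef a b * ?w" using True by (simp add: \<Phi>_weight'[OF w])
  finally have 1: "coef a b * (\<Phi> a * v) = g a * ?w + coef a b * ?w" .
  have "\<Phi> a * (\<Phi> a * v) = g a * (\<Phi> a * v) + coef a b * (\<Phi> a * v)"
    using True by (simp add: \<Phi>_weight'[OF weight_\<Phi>[OF v]])
  also have "g a * (\<Phi> a * v) = \<kappa> q * v + \<kappa> (q - 1) * (g a * v) + g a * (coef a b * v)"
    using True by (simp add: \<Phi>_weight'[OF v] distrib_left g_g_weight[OF v])
  finally have 2: "\<Phi> a * (\<Phi> a * v) = \<kappa> q * v + \<kappa> (q - 1) * (g a * v) + g a * (coef a b * v)
     + (g a * ?w + coef a b * ?w)" by (simp only: 1)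
  have "g a * ?w = \<kappa> (1 - q) * (g a * v) - g a * (coef a b * v)"
    using coef_swap[OF ab_mem(1,2) v] True by (simp add: right_diff_distrib \<kappa>_left_commute)
  then have "\<Phi> a * (\<Phi> a * v) = \<kappa> q * v + coef a b * ?w"
    unfolding 2 by (simp add: \<kappa>_diff \<kappa>_one algebra_simps)
  then show ?thesis using True by simp
next
  case False
  have "\<Phi> a * (\<Phi> a * v) = g a * (\<Phi> a * v) + (if j a \<noteq> j b then 0 else \<Phi> a * v)"
    using False by (auto simp: \<Phi>_weight'[OF weight_\<Phi>[OF v]])
  also have "g a * (\<Phi> a * v) = g a * (g a * v) + (if j a \<noteq> j b then 0 else g a * v)"
    using False by (auto simp: \<Phi>_weight'[OF v] distrib_left)
  finally show ?thesis
    using False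
    by (auto simp: \<Phi>_weight'[OF v] g_g_weight[OF v] \<kappa>_add \<kappa>_diff \<kappa>_one algebra_simps)
qed

end

text \<open>
  The coefficient of each intertwiner, \<open>h\<close> or \<open>k\<close> in the proof, commutes with the other intertwiner,
  since that one permutes only the Jucys--Murphy elements and labels at its own two indices.
\<close>

lemma \<Phi>_\<Phi>_far:
  assumes v: "weight i j v" and a: "1 \<le> a" and b: "a + 1 < b" "b < n"
  shows "\<Phi> a * (\<Phi> b * v) = \<Phi> b * (\<Phi> a * v)"
proof -
  define a' b' where "a' = a + 1" and "b' = b + 1"
  have m: "a \<in> {1..n}" "a' \<in> {1..n}" "b \<in> {1..n}" "b' \<in> {1..n}" and le: "a' \<le> n" "b' \<le> n" "1 \<le> b"
    using a b by (auto simp: a'_def b'_def)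
  have d: "a \<noteq> b" "a \<noteq> b'" "a' \<noteq> b" "a' \<noteq> b'" "b \<noteq> a" "b' \<noteq> a" "b \<noteq> a'" "b' \<noteq> a'"
    using b by (auto simp: a'_def b'_def)
  note A = a a'_def le(1) and B = le(3) b'_def le(2)
  define h where "h = (if j a \<noteq> j a' then 0 else if i a = i a' then 1 else coef a a')"
  define k where "k = (if j b \<noteq> j b' then 0 else if i b = i b' then 1 else coef b b')"
  have \<Phi>a: "\<Phi> a * w = g a * w + h * w"
    if "weight i' j' w" "i' a = i a" "i' a' = i a'" "j' a = j a" "j' a' = j a'" for i' j' w
    using \<Phi>_weight'[OF A that(1)] that(2-) by (auto simp: h_def)
  have \<Phi>b: "\<Phi> b * w = g b * w + k * w"
    if "weight i' j' w" "i' b = i b" "i' b' = i b'" "j' b = j b" "j' b' = j b'" for i' j' w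
    using \<Phi>_weight'[OF B that(1)] that(2-) by (auto simp: k_def)
  have s: "Transposition.transpose b b' a = a" "Transposition.transpose b b' a' = a'"
    "Transposition.transpose a a' b = b" "Transposition.transpose a a' b' = b'"
    using d by (auto simp: Transposition.transpose_def)
  have wa: "weight (i \<circ> Transposition.transpose a a') (j \<circ> Transposition.transpose a a') (\<Phi> a * v)"
    using weight_\<Phi>[OF A v] .
  have wb: "weight (i \<circ> Transposition.transpose b b') (j \<circ> Transposition.transpose b b') (\<Phi> b * v)"
    using weight_\<Phi>[OF B v] .
  have kv: "k * (\<Phi> a * v) = \<Phi> a * (k * v)"
  proof (cases "j b \<noteq> j b' \<or> i b = i b'")
    case False
    have "coef b b' * (\<Phi> a * v) = \<Phi> a * (coef b b' * v)"
    proof (rule coef_intertwine[OF m(3,4,3,4) v _ _ weight_\<Phi>[OF A]])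
      show "X b * (\<Phi> a * w) = \<Phi> a * (X b * w)" if "weight i j w" for w
        by (rule X_\<Phi>_other[OF A that m(3) d(5,7)])
      show "X b' * (\<Phi> a * w) = \<Phi> a * (X b' * w)" if "weight i j w" for w
        by (rule X_\<Phi>_other[OF A that m(4) d(6,8)])
    qed (use False s in simp_all)
    then show ?thesis using False by (simp add: k_def)
  qed (auto simp: k_def)
  have hv: "h * (\<Phi> b * v) = \<Phi> b * (h * v)"
  proof (cases "j a \<noteq> j a' \<or> i a = i a'")
    case False
    have "coef a a' * (\<Phi> b * v) = \<Phi> b * (coef a a' * v)"
    proof (rule coef_intertwine[OF m(1,2,1,2) v _ _ weight_\<Phi>[OF B]])
      show "X a * (\<Phi> b * w) = \<Phi> b * (X a * w)" if "weight i j w" for w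
        by (rule X_\<Phi>_other[OF B that m(1) d(1,2)])
      show "X a' * (\<Phi> b * w) = \<Phi> b * (X a' * w)" if "weight i j w" for w
        by (rule X_\<Phi>_other[OF B that m(2) d(3,4)])
    qed (use False s in simp_all)
    then show ?thesis using False by (simp add: h_def)
  qed (auto simp: h_def)
  have wh: "weight i j (h * v)" and wk: "weight i j (k * v)"
  proof -
    have "h \<in> bicommutant (X ` {1..n})" "k \<in> bicommutant (X ` {1..n})"
      using coef_bicommutant m by (auto simp: h_def k_def bicommutant_zero bicommutant_one)
    then show "weight i j (h * v)" "weight i j (k * v)" using weight_X_bicommutant v by blast+
  qed
  have hk: "h * (k * v) = k * (h * v)"
    using coef_coef m by (auto simp: h_def k_def mult.assoc[symmetric])
  have gg: "g a * (g b * v) = g b * (g a * v)"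
    using g_far[OF a b] by (simp add: mult.assoc[symmetric])
  have "\<Phi> a * (\<Phi> b * v) = g a * (\<Phi> b * v) + \<Phi> b * (h * v)"
    using \<Phi>a[OF wb] hv s by simp
  also have "\<dots> = g a * (g b * v) + g a * (k * v) + g b * (h * v) + k * (h * v)"
    using \<Phi>b[OF v] \<Phi>b[OF wh] by (simp add: distrib_left add.assoc)
  also have "\<dots> = g b * (\<Phi> a * v) + \<Phi> a * (k * v)"
    using \<Phi>a[OF v] \<Phi>a[OF wk] gg hk by (simp add: distrib_left algebra_simps)
  also have "\<dots> = \<Phi> b * (\<Phi> a * v)"
    using \<Phi>b[OF wa] kv s by simp
  finally show ?thesis .
qed

lemma coef_denominator:
  assumes x: "x \<in> {1..n}" "y \<in> {1..n}" and w: "weight i j w" and ne: "i x \<noteq> i y"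
  shows "coef x y * ((X x - X y) * w) = \<kappa> (q - 1) * (X y * w)"
  using R_inverse(2)[OF x w ne] by (simp add: coef_def mult.assoc)

text \<open>
  \<open>X\<^sub>x / (X\<^sub>x - X\<^sub>y) = 1 + X\<^sub>y / (X\<^sub>x - X\<^sub>y)\<close>.
\<close>

lemma X_R:
  assumes x: "x \<in> {1..n}" "y \<in> {1..n}" and v: "weight i j v" and ne: "i x \<noteq> i y"
  shows "\<kappa> (q - 1) * (X x * (R x y * v)) = \<kappa> (q - 1) * v + coef x y * v"
proof -
  have "X x * (R x y * v) = v + X y * (R x y * v)"
    using R_inverse(1)[OF x v ne] by (simp add: algebra_simps)
  then show ?thesis by (simp add: distrib_left coef_def mult.assoc)
qed

lemma weight_diff:
  assumes v: "weight i j v" and w: "weight i j w"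
  shows "weight i j (v - w)"
proof -
  have "eI i * v = v" "eI i * w = w" "eJ j * v = v" "eJ j * w = w"
    using eI_weight[OF v] eI_weight[OF w] eJ_weight[OF v] eJ_weight[OF w] weightD(1,2)[OF v] by simp_all
  then show ?thesis
    using v xspec.joint_eigen_iff[of i "v - w"] tspec.joint_eigen_iff[of j "v - w"]
    by (simp add: weight_def YH_I_eq YH_J_eq right_diff_distrib)
qed

text \<open>
  If both labels agree, then \<open>g\<^sub>a\<close> differs from \<open>\<Phi>\<^sub>a\<close> by the identity, and \<open>\<Phi>\<^sub>a\<close> preserves the weight.
\<close>

lemma weight_g:
  assumes ab: "1 \<le> a" "b = a + 1" "b \<le> n" and v: "weight i j v" and same: "i a = i b" "j a = j b"
  shows "weight i j (g a * v)"
proof -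
  have "i \<circ> Transposition.transpose a b = i" "j \<circ> Transposition.transpose a b = j"
    using same by (auto simp: fun_eq_iff Transposition.transpose_def)
  then have "weight i j (\<Phi> a * v - v)" using weight_\<Phi>[OF ab v] weight_diff v by simp
  moreover have "g a * v = \<Phi> a * v - v" using \<Phi>_weight'[OF ab v] same by simp
  ultimately show ?thesis by simp
qed

subsection \<open>The braid relation up to correction terms\<close>

context
  fixes a b c :: nat
  assumes a1: "1 \<le> a" and b: "b = a + 1" and c: "c = b + 1" and cn: "c \<le> n"
begin

lemma abc_mem: "a \<in> {1..n}" "b \<in> {1..n}" "c \<in> {1..n}" and b_le: "b \<le> n" and b1: "1 \<le> b"
  using a1 b c cn by auto

lemmas left_pair = a1 b b_le
lemmas right_pair = b1 c cn

lemma transpose_abc: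
  "Transposition.transpose a b a = b" "Transposition.transpose a b b = a" "Transposition.transpose a b c = c"
  "Transposition.transpose b c a = a" "Transposition.transpose b c b = c" "Transposition.transpose b c c = b"
  using b c by (auto simp: Transposition.transpose_def)

lemma g_braid_abc: "g b * (g a * (g b * v)) = g a * (g b * (g a * v))"
  using g_braid[of a] a1 b c cn by (simp add: mult.assoc[symmetric])

lemmas coef_commute =
  coef_coef[OF abc_mem(2,3) abc_mem(1,2), THEN mult_eq_assoc]
  coef_coef[OF abc_mem(1,3) abc_mem(1,2), THEN mult_eq_assoc]
  coef_coef[OF abc_mem(2,3) abc_mem(1,3), THEN mult_eq_assoc]

lemmas scalar_commute = \<kappa>_left_commute[of "g a"] \<kappa>_left_commute[of "g b"]
  \<kappa>_left_commute[of "coef a b"] \<kappa>_left_commute[of "coef b c"] \<kappa>_left_commute[of "coef a c"]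

lemma coef_reorder:
  "coef b c * (coef a b * v) = coef a b * (coef b c * v)"
  "coef a c * (coef a b * v) = coef a b * (coef a c * v)"
  "coef b c * (coef a c * v) = coef a c * (coef b c * v)"
  using coef_commute[of v] by (simp_all add: mult.assoc)

text \<open>Two consecutive intertwiners, expanded with all coefficients on the right.\<close>

lemma two_intertwiners_up:
  assumes u: "weight i j u" and j: "j a = j b" "j b = j c" and i: "i a \<noteq> i c" "i b \<noteq> i c"
  shows "\<Phi> a * (\<Phi> b * u) = g a * (g b * u) + g a * (coef b c * u) + g b * (coef a c * u) + coef a c * (coef b c * u)"
proof -
  have y: "weight (i \<circ> Transposition.transpose b c) (j \<circ> Transposition.transpose b c) (\<Phi> b * u)"
    by (rule weight_\<Phi>[OF right_pair u])
  have "coef a b * (\<Phi> b * u) = \<Phi> b * (coef a c * u)"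
    using coef_\<Phi>[OF right_pair u _ abc_mem(1,3)] i by (simp add: transpose_abc)
  also have "\<dots> = g b * (coef a c * u) + coef b c * (coef a c * u)"
    using \<Phi>_weight'[OF right_pair weight_coef[OF abc_mem(1,3) u]] i j by simp
  finally show ?thesis
    using \<Phi>_weight'[OF left_pair y] \<Phi>_weight'[OF right_pair u] i j by (simp add: transpose_abc distrib_left coef_reorder)
qed

lemma two_intertwiners_down:
  assumes u: "weight i j u" and j: "j a = j b" "j b = j c" and i: "i a \<noteq> i b" "i a \<noteq> i c"
  shows "\<Phi> b * (\<Phi> a * u) = g b * (g a * u) + g b * (coef a b * u) + g a * (coef a c * u) + coef a b * (coef a c * u)"
proof -
  have y: "weight (i \<circ> Transposition.transpose a b) (j \<circ> Transposition.transpose a b) (\<Phi> a * u)"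
    by (rule weight_\<Phi>[OF left_pair u])
  have "coef b c * (\<Phi> a * u) = \<Phi> a * (coef a c * u)"
    using coef_\<Phi>[OF left_pair u _ abc_mem(1,3)] i by (simp add: transpose_abc)
  also have "\<dots> = g a * (coef a c * u) + coef a b * (coef a c * u)"
    using \<Phi>_weight'[OF left_pair weight_coef[OF abc_mem(1,3) u]] i j by simp
  finally show ?thesis
    using \<Phi>_weight'[OF right_pair y] \<Phi>_weight'[OF left_pair u] i j by (simp add: transpose_abc distrib_left)
qed

text \<open>
  Hecke commutation of a coefficient with a generator inside a block \<open>i\<^sub>a = i\<^sub>b \<noteq> i\<^sub>c\<close>, where the
  coefficient \<open>coef a b\<close> itself has no meaning.
\<close>

lemma coef_g_lower:
  assumes v: "weight i j v" and j: "j a = j b" and i: "i a = i b" "i b \<noteq> i c"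
  shows "coef b c * (g a * v) = g a * (coef a c * v) - \<kappa> (q - 1) * (coef a c * v) - coef a c * (coef b c * v)"
    and "coef a c * (g a * v) = g a * (coef b c * v) + \<kappa> (q - 1) * (coef a c * v) + coef a c * (coef b c * v)"
proof -
  let ?k = "\<kappa> (q - 1)"
  note abc = abc_mem
  have ac: "i a \<noteq> i c" using i by simp
  note Rac = weight_R[OF abc(1,3) v] and Rbc = weight_R[OF abc(2,3) v]
  have Xcg: "X c * (g a * w) = g a * (X c * w)" for w
    using g_X[of a c] b c a1 cn by (simp add: mult.assoc[symmetric])
  have gw: "weight i j (g a * w)" if "weight i j w" for w
    by (rule weight_g[OF left_pair that i(1) j])
  note comm = R_X[OF abc(2,3,2), THEN mult_eq_assoc] R_X[OF abc(1,3,2), THEN mult_eq_assoc]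
    R_R[OF abc(2,3) abc(1,3), THEN mult_eq_assoc]
  note comm = comm[unfolded mult.assoc]
  have k2: "?k * (X c * (R a c * (?k * (X b * (R b c * v))))) = ?k * (coef a c * v) + coef a c * (coef b c * v)"
    unfolding X_R[OF abc(2,3) v i(2)]
    by (simp add: coef_def distrib_left mult.assoc \<kappa>_left_commute[of "X c"] \<kappa>_left_commute[of "R a c"])
  have "(X b - X c) * (g a * (R a c * v)) = g a * ((X a - X c) * (R a c * v)) + ?k * (X b * (R a c * v))"
    using X_g_upper[OF left_pair Rac] j Xcg by (simp add: left_diff_distrib right_diff_distrib)
  then have "g a * (R a c * v) = R b c * (g a * v + ?k * (X b * (R a c * v)))"
    using R_inverse(1)[OF abc(1,3) v ac] R_inverse(2)[OF abc(2,3) gw[OF Rac] i(2)] by simp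
  then have 1: "R b c * (g a * v) = g a * (R a c * v) - R a c * (?k * (X b * (R b c * v)))"
    by (simp add: distrib_left \<kappa>_left_commute[of "R b c"] \<kappa>_left_commute[of "R a c"] comm)
  show "coef b c * (g a * v) = g a * (coef a c * v) - \<kappa> (q - 1) * (coef a c * v) - coef a c * (coef b c * v)"
    using k2 by (simp add: coef_def[of b c] mult.assoc 1 right_diff_distrib Xcg)
      (simp add: coef_def mult.assoc \<kappa>_left_commute[of "g a"])
  have "(X a - X c) * (g a * (R b c * v)) = g a * ((X b - X c) * (R b c * v)) - ?k * (X b * (R b c * v))"
    using X_g_lower[OF left_pair Rbc] j Xcg by (simp add: left_diff_distrib right_diff_distrib)
  then have "g a * (R b c * v) = R a c * (g a * v - ?k * (X b * (R b c * v)))"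
    using R_inverse(1)[OF abc(2,3) v i(2)] R_inverse(2)[OF abc(1,3) gw[OF Rbc] ac] by simp
  then have 2: "R a c * (g a * v) = g a * (R b c * v) + R a c * (?k * (X b * (R b c * v)))"
    by (simp add: right_diff_distrib)
  show "coef a c * (g a * v) = g a * (coef b c * v) + \<kappa> (q - 1) * (coef a c * v) + coef a c * (coef b c * v)"
    using k2 by (simp add: coef_def[of a c] mult.assoc 2 distrib_left Xcg)
      (simp add: coef_def mult.assoc \<kappa>_left_commute[of "g a"])
qed

lemma coef_g_upper:
  assumes v: "weight i j v" and j: "j b = j c" and i: "i b = i c" "i a \<noteq> i b"
  shows "coef a b * (g b * v) = g b * (coef a c * v) - \<kappa> (q - 1) * (coef a c * v) - coef a b * (coef a c * v)"
    and "coef a c * (g b * v) = g b * (coef a b * v) + \<kappa> (q - 1) * (coef a c * v) + coef a b * (coef a c * v)"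
proof -
  let ?k = "\<kappa> (q - 1)"
  note abc = abc_mem
  have ac: "i a \<noteq> i c" using i by simp
  note Rac = weight_R[OF abc(1,3) v] and Rab = weight_R[OF abc(1,2) v]
  have Xag: "X a * (g b * w) = g b * (X a * w)" for w
    using g_X[of b a] b c a1 cn by (simp add: mult.assoc[symmetric])
  have gw: "weight i j (g b * w)" if "weight i j w" for w
    by (rule weight_g[OF right_pair that i(1) j])
  have "(X a - X b) * (g b * (R a c * v)) = g b * ((X a - X c) * (R a c * v)) + ?k * (X c * (R a c * v))"
    using X_g_lower[OF right_pair Rac] j Xag by (simp add: left_diff_distrib right_diff_distrib)
  then have "g b * (R a c * v) = R a b * (g b * v + coef a c * v)"
    using R_inverse(1)[OF abc(1,3) v ac] R_inverse(2)[OF abc(1,2) gw[OF Rac] i(2)]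
    by (simp add: coef_def mult.assoc)
  then have 1: "R a b * (g b * v) = g b * (R a c * v) - R a b * (coef a c * v)"
    by (simp add: distrib_left)
  have "coef a b * (g b * v) = ?k * (X b * (g b * (R a c * v))) - coef a b * (coef a c * v)"
    by (simp add: coef_def[of a b] mult.assoc 1 right_diff_distrib)
  also have "X b * (g b * (R a c * v)) = g b * (X c * (R a c * v)) - coef a c * v"
    using X_g_lower[OF right_pair Rac] j by (simp add: coef_def mult.assoc)
  finally show "coef a b * (g b * v) = g b * (coef a c * v) - \<kappa> (q - 1) * (coef a c * v) - coef a b * (coef a c * v)"
    by (simp add: coef_def[of a c] mult.assoc right_diff_distrib \<kappa>_left_commute[of "g b"])
  have "(X a - X c) * (g b * (R a b * v)) = g b * ((X a - X b) * (R a b * v)) - ?k * (X c * (R a b * v))"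
    using X_g_upper[OF right_pair Rab] j Xag by (simp add: left_diff_distrib right_diff_distrib)
  then have "g b * (R a b * v) = R a c * (g b * v - ?k * (X c * (R a b * v)))"
    using R_inverse(1)[OF abc(1,2) v i(2)] R_inverse(2)[OF abc(1,3) gw[OF Rab] ac] by simp
  also have "\<dots> = R a c * (g b * v) - coef a c * (R a b * v)"
    using R_X[OF abc(1,3,3), THEN mult_eq_assoc]
    by (simp add: right_diff_distrib \<kappa>_left_commute[of "R a c"] coef_def mult.assoc)
  finally have 2: "R a c * (g b * v) = g b * (R a b * v) + coef a c * (R a b * v)" by simp
  have "coef a c * (g b * v) = ?k * (X c * (g b * (R a b * v)) + X c * (coef a c * (R a b * v)))"
    by (simp add: coef_def[of a c] mult.assoc 2 distrib_left)
  also have "X c * (g b * (R a b * v)) = g b * (X b * (R a b * v)) + ?k * (X c * (R a b * v))"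
    using X_g_upper[OF right_pair Rab] j by simp
  also have "\<dots> + X c * (coef a c * (R a b * v)) = g b * (X b * (R a b * v)) + X a * (coef a c * (R a b * v))"
    using X_coef[OF abc(1,3) Rab ac] by simp
  also have "X a * (coef a c * (R a b * v)) = coef a c * (X a * (R a b * v))"
    using coef_X_left[OF abc(1,3,1)] by simp
  also have "?k * (g b * (X b * (R a b * v)) + coef a c * (X a * (R a b * v)))
    = g b * (coef a b * v) + coef a c * (?k * (X a * (R a b * v)))"
    by (simp add: distrib_left coef_def[of a b] mult.assoc \<kappa>_left_commute[of "g b"] \<kappa>_left_commute[of "coef a c"])
  also have "?k * (X a * (R a b * v)) = ?k * v + coef a b * v" by (rule X_R[OF abc(1,2) v i(2)])
  finally show "coef a c * (g b * v) = g b * (coef a b * v) + \<kappa> (q - 1) * (coef a c * v) + coef a b * (coef a c * v)"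
    by (simp add: distrib_left scalar_commute coef_reorder)
qed

text \<open>
  Every product of intertwiners is a combination of words in \<open>g\<^sub>a, g\<^sub>b\<close> with coefficients on the right.
  After \<open>g\<^sub>a\<^sup>2\<close> and \<open>g\<^sub>b\<^sup>2\<close> are reduced, the two sides differ only in the coefficients of \<open>g\<^sub>a\<close> and
  \<open>g\<^sub>b\<close>, which agree by the partial fraction identity.
\<close>

lemma braid_distinct:
  assumes v: "weight i j v" and j: "j a = j b" "j b = j c" and i: "i a \<noteq> i b" "i b \<noteq> i c" "i a \<noteq> i c"
  shows "\<Phi> a * (\<Phi> b * (\<Phi> a * v)) = \<Phi> b * (\<Phi> a * (\<Phi> b * v))"
proof -
  let ?A = "g a" and ?B = "g b" and ?p = "coef a b" and ?r = "coef b c" and ?s = "coef a c" and ?k = "\<kappa> (q - 1)"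
  note wp = weight_coef[OF abc_mem(1,2) v] and wr = weight_coef[OF abc_mem(2,3) v] and ws = weight_coef[OF abc_mem(1,3) v]
  have \<Phi>a: "\<Phi> a * w = ?A * w + ?p * w" if "weight i j w" for w
    using \<Phi>_weight'[OF left_pair that] i j by simp
  have up: "\<Phi> a * (\<Phi> b * w) = ?A * (?B * w) + ?A * (?r * w) + ?B * (?s * w) + ?s * (?r * w)"
    if "weight i j w" for w by (rule two_intertwiners_up[OF that j i(3,2)])
  have wa: "weight (i \<circ> Transposition.transpose a b) (j \<circ> Transposition.transpose a b) (\<Phi> a * v)"
    by (rule weight_\<Phi>[OF left_pair v])
  have r\<Phi>: "?r * (\<Phi> a * w) = \<Phi> a * (?s * w)" and s\<Phi>: "?s * (\<Phi> a * w) = \<Phi> a * (?r * w)" if "weight i j w" for w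
    using coef_\<Phi>[OF left_pair that _ abc_mem(1,3)] coef_\<Phi>[OF left_pair that _ abc_mem(2,3)] i by (simp_all add: transpose_abc)
  have "\<Phi> a * (\<Phi> b * (\<Phi> a * v)) = ?A * (?B * (\<Phi> a * v)) + ?A * (?r * (\<Phi> a * v)) + ?B * (?s * (\<Phi> a * v)) +
     ?s * (?r * (\<Phi> a * v))"
    by (rule two_intertwiners_up[OF wa]) (use i j in \<open>simp_all add: transpose_abc\<close>)
  also have "\<dots> = ?A * (?B * (\<Phi> a * v)) + ?A * (\<Phi> a * (?s * v)) + ?B * (\<Phi> a * (?r * v)) + \<Phi> a * (?r * (?s * v))"
    using r\<Phi>[OF v] s\<Phi>[OF v] s\<Phi>[OF ws] by simp
  finally have L: "\<Phi> a * (\<Phi> b * (\<Phi> a * v)) = \<dots>" .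
  let ?u = "\<Phi> a * (\<Phi> b * v)"
  have wb: "weight (i \<circ> Transposition.transpose b c) (j \<circ> Transposition.transpose b c) (\<Phi> b * v)"
    by (rule weight_\<Phi>[OF right_pair v])
  have wu: "weight (i \<circ> Transposition.transpose b c \<circ> Transposition.transpose a b)
      (j \<circ> Transposition.transpose b c \<circ> Transposition.transpose a b) ?u"
    by (rule weight_\<Phi>[OF left_pair wb])
  have "?r * ?u = \<Phi> a * (?s * (\<Phi> b * v))"
    using coef_\<Phi>[OF left_pair wb _ abc_mem(1,3)] i by (simp add: transpose_abc)
  also have "?s * (\<Phi> b * v) = \<Phi> b * (?p * v)"
    using coef_\<Phi>[OF right_pair v _ abc_mem(1,2)] i by (simp add: transpose_abc)
  finally have "\<Phi> b * ?u = ?B * ?u + \<Phi> a * (\<Phi> b * (?p * v))"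
    using \<Phi>_weight'[OF right_pair wu] i j by (simp add: transpose_abc)
  then have R: "\<Phi> b * ?u = ?B * (?A * (?B * v) + ?A * (?r * v) + ?B * (?s * v) + ?s * (?r * v))
     + (?A * (?B * (?p * v)) + ?A * (?r * (?p * v)) + ?B * (?s * (?p * v)) + ?s * (?r * (?p * v)))"
    by (simp only: up[OF v] up[OF wp])
  note pf = coef_partial_fractions[OF abc_mem v i]
  have pfA: "?A * (?p * (?s * v)) = ?A * (?p * (?r * v)) - ?A * (?s * (?r * v)) - ?k * (?A * (?s * v))"
    and pfB: "?B * (?p * (?s * v)) = ?B * (?p * (?r * v)) - ?B * (?s * (?r * v)) - ?k * (?B * (?s * v))"
    unfolding pf by (simp_all add: right_diff_distrib scalar_commute)
  have sq: "?A * (?A * (?s * v)) = \<kappa> q * (?s * v) + ?k * (?A * (?s * v))"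
    "?B * (?B * (?s * v)) = \<kappa> q * (?s * v) + ?k * (?B * (?s * v))"
    using g_g_weight[OF left_pair ws] g_g_weight[OF right_pair ws] j by simp_all
  show ?thesis
    unfolding L R unfolding \<Phi>a[OF v] \<Phi>a[OF ws] \<Phi>a[OF wr] \<Phi>a[OF weight_coef[OF abc_mem(2,3) ws]]
    by (simp add: distrib_left g_braid_abc coef_reorder sq pfA pfB)
qed

text \<open>
  As \<open>g\<^sub>a\<close> preserves the weight of \<open>v\<close> but is not an intertwiner, the coefficients have to be moved past
  it by \<open>coef_g_lower\<close>; their product is symmetric in \<open>a\<close> and \<open>b\<close> and commutes with \<open>g\<^sub>a\<close>.
\<close>

lemma braid_first_two_equal:
  assumes v: "weight i j v" and j: "j a = j b" "j b = j c" and i: "i a = i b" "i b \<noteq> i c"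
  shows "\<Phi> a * (\<Phi> b * (\<Phi> a * v)) = \<Phi> b * (\<Phi> a * (\<Phi> b * v))"
proof -
  let ?A = "g a" and ?B = "g b" and ?r = "coef b c" and ?s = "coef a c" and ?k = "\<kappa> (q - 1)"
  note wr = weight_coef[OF abc_mem(2,3) v] and ws = weight_coef[OF abc_mem(1,3) v]
  have ac: "i a \<noteq> i c" using i by simp
  have up: "\<Phi> a * (\<Phi> b * w) = ?A * (?B * w) + ?A * (?r * w) + ?B * (?s * w) + ?s * (?r * w)"
    if "weight i j w" for w by (rule two_intertwiners_up[OF that j ac i(2)])
  have wA: "weight i j (?A * v)" by (rule weight_g[OF left_pair v i(1) j(1)])
  have y: "\<Phi> a * v = ?A * v + v" using \<Phi>_weight'[OF left_pair v] i j by simp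
  have L: "\<Phi> a * (\<Phi> b * (\<Phi> a * v)) = \<Phi> a * (\<Phi> b * (?A * v)) + \<Phi> a * (\<Phi> b * v)"
    unfolding y by (simp add: distrib_left)
  let ?u = "\<Phi> a * (\<Phi> b * v)"
  have wb: "weight (i \<circ> Transposition.transpose b c) (j \<circ> Transposition.transpose b c) (\<Phi> b * v)"
    by (rule weight_\<Phi>[OF right_pair v])
  have wu: "weight (i \<circ> Transposition.transpose b c \<circ> Transposition.transpose a b)
      (j \<circ> Transposition.transpose b c \<circ> Transposition.transpose a b) ?u"
    by (rule weight_\<Phi>[OF left_pair wb])
  have R: "\<Phi> b * ?u = ?B * ?u + ?u"
    using \<Phi>_weight'[OF right_pair wu] i j by (simp add: transpose_abc)
  note h = coef_g_lower[OF v j(1) i] and h' = coef_g_lower[OF wr j(1) i]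
  have sq: "?A * (?A * (?s * v)) = \<kappa> q * (?s * v) + ?k * (?A * (?s * v))"
    "?B * (?B * (?s * v)) = \<kappa> q * (?s * v) + ?k * (?B * (?s * v))"
    using g_g_weight[OF left_pair ws] g_g_weight[OF right_pair ws] j by simp_all
  have "?s * (?r * (?A * v)) = ?r * (?s * (?A * v))" by (simp only: coef_reorder)
  also have "\<dots> = ?A * (?s * (?r * v))"
    unfolding h(2) by (simp add: h'(1) distrib_left coef_reorder scalar_commute)
  finally have rs: "?s * (?r * (?A * v)) = ?A * (?s * (?r * v))" .
  show ?thesis
    unfolding L R unfolding up[OF wA] up[OF v] rs
    by (simp add: distrib_left right_diff_distrib g_braid_abc coef_reorder sq h scalar_commute)
qed

lemma braid_last_two_equal:
  assumes v: "weight i j v" and j: "j a = j b" "j b = j c" and i: "i b = i c" "i a \<noteq> i b"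
  shows "\<Phi> a * (\<Phi> b * (\<Phi> a * v)) = \<Phi> b * (\<Phi> a * (\<Phi> b * v))"
proof -
  let ?A = "g a" and ?B = "g b" and ?p = "coef a b" and ?s = "coef a c" and ?k = "\<kappa> (q - 1)"
  note wp = weight_coef[OF abc_mem(1,2) v] and ws = weight_coef[OF abc_mem(1,3) v]
  have ac: "i a \<noteq> i c" using i by simp
  have down: "\<Phi> b * (\<Phi> a * w) = ?B * (?A * w) + ?B * (?p * w) + ?A * (?s * w) + ?p * (?s * w)"
    if "weight i j w" for w by (rule two_intertwiners_down[OF that j i(2) ac])
  have wB: "weight i j (?B * v)" by (rule weight_g[OF right_pair v i(1) j(2)])
  have y: "\<Phi> b * v = ?B * v + v" using \<Phi>_weight'[OF right_pair v] i j by simp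
  have R: "\<Phi> b * (\<Phi> a * (\<Phi> b * v)) = \<Phi> b * (\<Phi> a * (?B * v)) + \<Phi> b * (\<Phi> a * v)"
    unfolding y by (simp add: distrib_left)
  let ?u = "\<Phi> b * (\<Phi> a * v)"
  have wa: "weight (i \<circ> Transposition.transpose a b) (j \<circ> Transposition.transpose a b) (\<Phi> a * v)"
    by (rule weight_\<Phi>[OF left_pair v])
  have wu: "weight (i \<circ> Transposition.transpose a b \<circ> Transposition.transpose b c)
      (j \<circ> Transposition.transpose a b \<circ> Transposition.transpose b c) ?u"
    by (rule weight_\<Phi>[OF right_pair wa])
  have L: "\<Phi> a * ?u = ?A * ?u + ?u"
    using \<Phi>_weight'[OF left_pair wu] i j by (simp add: transpose_abc)
  note h = coef_g_upper[OF v j(2) i] and h' = coef_g_upper[OF wp j(2) i]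
  have sq: "?A * (?A * (?s * v)) = \<kappa> q * (?s * v) + ?k * (?A * (?s * v))"
    "?B * (?B * (?s * v)) = \<kappa> q * (?s * v) + ?k * (?B * (?s * v))"
    using g_g_weight[OF left_pair ws] g_g_weight[OF right_pair ws] j by simp_all
  have ps: "?p * (?s * (?B * v)) = ?B * (?p * (?s * v))"
    unfolding h(2) by (simp add: h'(1) distrib_left coef_reorder scalar_commute)
  show ?thesis
    unfolding L R unfolding down[OF wB] down[OF v] ps
    by (simp add: distrib_left right_diff_distrib g_braid_abc coef_reorder sq h scalar_commute)
qed

text \<open>
  After the first intertwiner two adjacent labels agree, and the middle intertwiner is a generator plus
  the identity.  The two expansions agree except for the coefficients of \<open>1\<close>: at the weight of \<open>v\<close> the
  fraction \<open>c\<^sub>a\<^sub>c\<close> is undefined, so that no partial fraction identity relates them.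
\<close>

lemma braid_outer_equal:
  assumes v: "weight i j v" and j: "j a = j b" "j b = j c" and i: "i a = i c" "i a \<noteq> i b"
  shows "\<Phi> a * (\<Phi> b * (\<Phi> a * v)) = \<Phi> b * (\<Phi> a * (\<Phi> b * v))
    + (coef a b * (coef a b * (coef b c * v)) - coef a b * (coef b c * (coef b c * v))
       + (\<kappa> (1 - q) * (coef a b * v) - coef a b * (coef a b * v))
       - (\<kappa> (1 - q) * (coef b c * v) - coef b c * (coef b c * v)))"
proof -
  let ?A = "g a" and ?B = "g b" and ?p = "coef a b" and ?r = "coef b c" and ?s = "coef a c" and ?k = "\<kappa> (q - 1)"
  have bc: "i b \<noteq> i c" using i by simp
  note wp = weight_coef[OF abc_mem(1,2) v] and wr = weight_coef[OF abc_mem(2,3) v]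
  have \<Phi>a: "\<Phi> a * w = ?A * w + ?p * w" and \<Phi>b: "\<Phi> b * w = ?B * w + ?r * w" if "weight i j w" for w
    using \<Phi>_weight'[OF left_pair that] \<Phi>_weight'[OF right_pair that] i j bc by simp_all
  let ?y = "\<Phi> a * v" and ?z = "\<Phi> b * v"
  let ?ja = "j \<circ> Transposition.transpose a b" and ?ia = "i \<circ> Transposition.transpose a b"
  let ?jb = "j \<circ> Transposition.transpose b c" and ?ib = "i \<circ> Transposition.transpose b c"
  have wy: "weight ?ia ?ja ?y" by (rule weight_\<Phi>[OF left_pair v])
  have wz: "weight ?ib ?jb ?z" by (rule weight_\<Phi>[OF right_pair v])
  have By: "\<Phi> b * ?y = ?B * ?y + ?y" using \<Phi>_weight'[OF right_pair wy] i j by (simp add: transpose_abc)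
  have Az: "\<Phi> a * ?z = ?A * ?z + ?z" using \<Phi>_weight'[OF left_pair wz] i j by (simp add: transpose_abc)
  have ja: "?ja b = ?ja c" "?ia b = ?ia c" "?ia a \<noteq> ?ia b" using i j by (simp_all add: transpose_abc)
  have jb: "?jb a = ?jb b" "?ib a = ?ib b" "?ib b \<noteq> ?ib c" using i j by (simp_all add: transpose_abc)
  have wBy: "weight ?ia ?ja (?B * ?y)" by (rule weight_g[OF right_pair wy ja(2,1)])
  have wAz: "weight ?ib ?jb (?A * ?z)" by (rule weight_g[OF left_pair wz jb(2,1)])
  have \<Phi>ay: "\<Phi> a * w = ?A * w + ?p * w" if "weight ?ia ?ja w" for w
    using \<Phi>_weight'[OF left_pair that] i j by (simp add: transpose_abc)
  have \<Phi>bz: "\<Phi> b * w = ?B * w + ?r * w" if "weight ?ib ?jb w" for w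
    using \<Phi>_weight'[OF right_pair that] i j by (simp add: transpose_abc)
  have sy: "?s * (\<Phi> a * w) = \<Phi> a * (?r * w)" and py: "?p * (\<Phi> a * w) = \<Phi> a * (coef b a * w)" if "weight i j w" for w
    using coef_\<Phi>[OF left_pair that _ abc_mem(2,3)] coef_\<Phi>[OF left_pair that _ abc_mem(2,1)] i bc by (simp_all add: transpose_abc)
  have sz: "?s * (\<Phi> b * w) = \<Phi> b * (?p * w)" and rz: "?r * (\<Phi> b * w) = \<Phi> b * (coef c b * w)" if "weight i j w" for w
    using coef_\<Phi>[OF right_pair that _ abc_mem(1,2)] coef_\<Phi>[OF right_pair that _ abc_mem(3,2)] i bc by (simp_all add: transpose_abc)
  have ba: "coef b a * v = - (?k * v) - ?p * v"
    using coef_swap[OF abc_mem(1,2) v i(2)] by (simp add: \<kappa>_diff algebra_simps)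
  have cb: "coef c b * v = - (?k * v) - ?r * v"
    using coef_swap[OF abc_mem(2,3) v bc] by (simp add: \<kappa>_diff algebra_simps)
  have L: "\<Phi> a * (\<Phi> b * ?y) = ?A * (?B * ?y) + ?B * (?s * ?y) - ?k * (?s * ?y) - ?s * (?p * ?y) + ?A * ?y + ?p * ?y"
    unfolding By distrib_left \<Phi>ay[OF wBy] \<Phi>ay[OF wy] coef_g_upper(1)[OF wy ja]
    by (simp add: coef_reorder)
  have R: "\<Phi> b * (\<Phi> a * ?z) = ?B * (?A * ?z) + ?A * (?s * ?z) - ?k * (?s * ?z) - ?s * (?r * ?z) + ?B * ?z + ?r * ?z"
    unfolding Az distrib_left \<Phi>bz[OF wAz] \<Phi>bz[OF wz] coef_g_lower(1)[OF wz jb]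
    by (simp add: coef_reorder)
  have ry: "?s * ?y = ?A * (?r * v) + ?p * (?r * v)" using sy[OF v] \<Phi>a[OF wr] by simp
  have rz': "?s * ?z = ?B * (?p * v) + ?r * (?p * v)" using sz[OF v] \<Phi>b[OF wp] by simp
  have wba: "weight i j (coef b a * v)" by (rule weight_coef[OF abc_mem(2,1) v])
  have wcb: "weight i j (coef c b * v)" by (rule weight_coef[OF abc_mem(3,2) v])
  have py': "?p * ?y = ?A * (coef b a * v) + ?p * (coef b a * v)" using py[OF v] \<Phi>a[OF wba] by simp
  have rz'': "?r * ?z = ?B * (coef c b * v) + ?r * (coef c b * v)" using rz[OF v] \<Phi>b[OF wcb] by simp
  have spy: "?s * (?p * ?y) = ?A * (?r * (coef b a * v)) + ?p * (?r * (coef b a * v))"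
    unfolding py[OF v] sy[OF wba] by (rule \<Phi>a[OF weight_coef[OF abc_mem(2,3) wba]])
  have srz: "?s * (?r * ?z) = ?B * (?p * (coef c b * v)) + ?r * (?p * (coef c b * v))"
    unfolding rz[OF v] sz[OF wcb] by (rule \<Phi>b[OF weight_coef[OF abc_mem(1,2) wcb]])
  have sq: "?A * (?A * v) = \<kappa> q * v + ?k * (?A * v)" "?B * (?B * v) = \<kappa> q * v + ?k * (?B * v)"
    using g_g_weight[OF left_pair v] g_g_weight[OF right_pair v] j by simp_all
  show ?thesis
    unfolding L R unfolding spy srz unfolding ry rz' py' rz'' unfolding ba cb \<Phi>a[OF v] \<Phi>b[OF v]
    by (simp add: distrib_left right_diff_distrib g_braid_abc coef_reorder sq scalar_commute \<kappa>_diff \<kappa>_one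
        left_diff_distrib)
qed

text \<open>
  All intertwiners are \<open>g + 1\<close>, so this is the deviation of \<open>g + 1\<close> from the braid relation.
\<close>

lemma braid_all_equal:
  assumes v: "weight i j v" and j: "j a = j b" "j b = j c" and i: "i a = i b" "i b = i c"
  shows "\<Phi> a * (\<Phi> b * (\<Phi> a * v)) = \<Phi> b * (\<Phi> a * (\<Phi> b * v)) + \<kappa> q * (\<Phi> a * v) - \<kappa> q * (\<Phi> b * v)"
proof -
  have \<Phi>a: "\<Phi> a * w = g a * w + w" and \<Phi>b: "\<Phi> b * w = g b * w + w" if "weight i j w" for w
    using \<Phi>_weight'[OF left_pair that] \<Phi>_weight'[OF right_pair that] i j by simp_all
  note ga = weight_g[OF left_pair _ i(1) j(1)] and gb = weight_g[OF right_pair _ i(2) j(2)]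
  have sq: "g a * (g a * v) = \<kappa> q * v + \<kappa> (q - 1) * (g a * v)" "g b * (g b * v) = \<kappa> q * v + \<kappa> (q - 1) * (g b * v)"
    using g_g_weight[OF left_pair v] g_g_weight[OF right_pair v] j by simp_all
  show ?thesis
    by (simp add: \<Phi>a \<Phi>b ga gb v distrib_left g_braid_abc sq \<kappa>_diff \<kappa>_one left_diff_distrib)
qed

text \<open>
  When \<open>j\<close> is not constant on \<open>a, b, c\<close>, at most one of the three intertwiners on either side has a
  second summand.  Its coefficient \<open>h\<close> can be moved to the right end, and it multiplies the same word
  in the generators on both sides.
\<close>

lemma braid_first_block:
  assumes v: "weight i j v" and j: "j a = j b" "j b \<noteq> j c"
  shows "\<Phi> a * (\<Phi> b * (\<Phi> a * v)) = \<Phi> b * (\<Phi> a * (\<Phi> b * v))"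
proof -
  let ?h = "if i a = i b then 1 else coef a b"
  have wh: "weight i j (?h * v)" using v weight_coef[OF abc_mem(1,2) v] by simp
  have AB: "\<Phi> a * (\<Phi> b * w) = g a * (g b * w)" if "weight i j w" for w
    using \<Phi>_weight'[OF left_pair weight_\<Phi>[OF right_pair that]] \<Phi>_weight'[OF right_pair that] j by (simp add: transpose_abc)
  note wa = weight_\<Phi>[OF left_pair v] and wb = weight_\<Phi>[OF right_pair v]
  have "\<Phi> a * (\<Phi> b * (\<Phi> a * v)) = g a * (g b * (\<Phi> a * v))"
    using \<Phi>_weight'[OF left_pair weight_\<Phi>[OF right_pair wa]] \<Phi>_weight'[OF right_pair wa] j by (simp add: transpose_abc)
  also have "\<dots> = g a * (g b * (g a * v + ?h * v))" using \<Phi>_weight'[OF left_pair v] j by simp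
  also have "\<dots> = g b * (g a * (g b * v)) + g a * (g b * (?h * v))"
    by (simp only: distrib_left g_braid_abc)
  finally have L: "\<Phi> a * (\<Phi> b * (\<Phi> a * v)) = \<dots>" .
  let ?u = "\<Phi> a * (\<Phi> b * v)"
  have "coef b c * ?u = \<Phi> a * (\<Phi> b * (coef a b * v))" if "i a \<noteq> i b"
    using coef_\<Phi>[OF left_pair wb _ abc_mem(1,3)] coef_\<Phi>[OF right_pair v _ abc_mem(1,2)] that j by (simp add: transpose_abc)
  then have "\<Phi> b * ?u = g b * ?u + \<Phi> a * (\<Phi> b * (?h * v))"
    using \<Phi>_weight'[OF right_pair weight_\<Phi>[OF left_pair wb]] j by (simp add: transpose_abc)
  then show ?thesis unfolding L AB[OF v] AB[OF wh] by simp
qed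

lemma braid_last_block:
  assumes v: "weight i j v" and j: "j a \<noteq> j b" "j b = j c"
  shows "\<Phi> a * (\<Phi> b * (\<Phi> a * v)) = \<Phi> b * (\<Phi> a * (\<Phi> b * v))"
proof -
  let ?h = "if i b = i c then 1 else coef b c"
  have wh: "weight i j (?h * v)" using v weight_coef[OF abc_mem(2,3) v] by simp
  have BA: "\<Phi> b * (\<Phi> a * w) = g b * (g a * w)" if "weight i j w" for w
    using \<Phi>_weight'[OF right_pair weight_\<Phi>[OF left_pair that]] \<Phi>_weight'[OF left_pair that] j by (simp add: transpose_abc)
  note wa = weight_\<Phi>[OF left_pair v] and wb = weight_\<Phi>[OF right_pair v]
  have "\<Phi> b * (\<Phi> a * (\<Phi> b * v)) = g b * (g a * (\<Phi> b * v))"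
    using \<Phi>_weight'[OF right_pair weight_\<Phi>[OF left_pair wb]] \<Phi>_weight'[OF left_pair wb] j by (simp add: transpose_abc)
  also have "\<dots> = g b * (g a * (g b * v + ?h * v))" using \<Phi>_weight'[OF right_pair v] j by simp
  also have "\<dots> = g a * (g b * (g a * v)) + g b * (g a * (?h * v))"
    by (simp only: distrib_left g_braid_abc)
  finally have R: "\<Phi> b * (\<Phi> a * (\<Phi> b * v)) = \<dots>" .
  let ?u = "\<Phi> b * (\<Phi> a * v)"
  have "coef a b * ?u = \<Phi> b * (\<Phi> a * (coef b c * v))" if "i b \<noteq> i c"
    using coef_\<Phi>[OF right_pair wa _ abc_mem(1,3)] coef_\<Phi>[OF left_pair v _ abc_mem(2,3)] that j by (simp add: transpose_abc)
  then have "\<Phi> a * ?u = g a * ?u + \<Phi> b * (\<Phi> a * (?h * v))"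
    using \<Phi>_weight'[OF left_pair weight_\<Phi>[OF right_pair wa]] j by (simp add: transpose_abc)
  then show ?thesis unfolding R BA[OF v] BA[OF wh] by simp
qed

text \<open>
  Here it is the middle intertwiner that contributes \<open>h\<close>, multiplied by \<open>g\<^sub>a\<^sup>2\<close> on one side and by
  \<open>g\<^sub>b\<^sup>2\<close> on the other; both squares are \<open>q\<close> because the labels \<open>j\<close> differ.
\<close>

lemma braid_outer_block:
  assumes v: "weight i j v" and j: "j a = j c" "j a \<noteq> j b"
  shows "\<Phi> a * (\<Phi> b * (\<Phi> a * v)) = \<Phi> b * (\<Phi> a * (\<Phi> b * v))"
proof -
  let ?h = "if i a = i c then 1 else coef a c"
  have wh: "weight i j (?h * v)" using v weight_coef[OF abc_mem(1,3) v] by simp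
  have \<Phi>a: "\<Phi> a * w = g a * w" and \<Phi>b: "\<Phi> b * w = g b * w" if "weight i j w" for w
    using \<Phi>_weight'[OF left_pair that] \<Phi>_weight'[OF right_pair that] j by simp_all
  note wa = weight_\<Phi>[OF left_pair v] and wb = weight_\<Phi>[OF right_pair v]
  have "coef b c * (\<Phi> a * v) = \<Phi> a * (coef a c * v)" if "i a \<noteq> i c"
    using coef_\<Phi>[OF left_pair v _ abc_mem(1,3)] that j by (simp add: transpose_abc)
  then have 1: "\<Phi> b * (\<Phi> a * v) = g b * (\<Phi> a * v) + \<Phi> a * (?h * v)"
    using \<Phi>_weight'[OF right_pair wa] j by (simp add: transpose_abc)
  have "\<Phi> a * (\<Phi> b * (\<Phi> a * v)) = g a * (\<Phi> b * (\<Phi> a * v))"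
    using \<Phi>_weight'[OF left_pair weight_\<Phi>[OF right_pair wa]] j by (simp add: transpose_abc)
  also have "\<dots> = g a * (g b * (g a * v)) + g a * (g a * (?h * v))"
    unfolding 1 unfolding \<Phi>a[OF v] \<Phi>a[OF wh] by (simp only: distrib_left)
  also have "g a * (g a * (?h * v)) = \<kappa> q * (?h * v)" using g_g_weight[OF left_pair wh] j by simp
  finally have L: "\<Phi> a * (\<Phi> b * (\<Phi> a * v)) = g a * (g b * (g a * v)) + \<kappa> q * (?h * v)" .
  have "coef a b * (\<Phi> b * v) = \<Phi> b * (coef a c * v)" if "i a \<noteq> i c"
    using coef_\<Phi>[OF right_pair v _ abc_mem(1,3)] that j by (simp add: transpose_abc)
  then have 2: "\<Phi> a * (\<Phi> b * v) = g a * (\<Phi> b * v) + \<Phi> b * (?h * v)"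
    using \<Phi>_weight'[OF left_pair wb] j by (simp add: transpose_abc)
  have "\<Phi> b * (\<Phi> a * (\<Phi> b * v)) = g b * (\<Phi> a * (\<Phi> b * v))"
    using \<Phi>_weight'[OF right_pair weight_\<Phi>[OF left_pair wb]] j by (simp add: transpose_abc)
  also have "\<dots> = g b * (g a * (g b * v)) + g b * (g b * (?h * v))"
    unfolding 2 unfolding \<Phi>b[OF v] \<Phi>b[OF wh] by (simp only: distrib_left)
  also have "g b * (g b * (?h * v)) = \<kappa> q * (?h * v)" using g_g_weight[OF right_pair wh] j by simp
  finally have R: "\<Phi> b * (\<Phi> a * (\<Phi> b * v)) = g b * (g a * (g b * v)) + \<kappa> q * (?h * v)" .
  show ?thesis unfolding L R by (simp only: g_braid_abc)
qed

lemma braid_distinct_blocks: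
  assumes v: "weight i j v" and j: "j a \<noteq> j b" "j b \<noteq> j c" "j a \<noteq> j c"
  shows "\<Phi> a * (\<Phi> b * (\<Phi> a * v)) = \<Phi> b * (\<Phi> a * (\<Phi> b * v))"
proof -
  note wa = weight_\<Phi>[OF left_pair v] and wb = weight_\<Phi>[OF right_pair v]
  have "\<Phi> a * (\<Phi> b * (\<Phi> a * v)) = g a * (g b * (g a * v))"
    using \<Phi>_weight'[OF left_pair weight_\<Phi>[OF right_pair wa]] \<Phi>_weight'[OF right_pair wa] \<Phi>_weight'[OF left_pair v] j
    by (simp add: transpose_abc)
  moreover have "\<Phi> b * (\<Phi> a * (\<Phi> b * v)) = g b * (g a * (g b * v))"
    using \<Phi>_weight'[OF right_pair weight_\<Phi>[OF left_pair wb]] \<Phi>_weight'[OF left_pair wb] \<Phi>_weight'[OF right_pair v] j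
    by (simp add: transpose_abc)
  ultimately show ?thesis by (simp only: g_braid_abc)
qed

lemma braid_generic:
  assumes v: "weight i j v" and "\<not> (i a = i c \<and> j a = j b \<and> j b = j c)"
  shows "\<Phi> a * (\<Phi> b * (\<Phi> a * v)) = \<Phi> b * (\<Phi> a * (\<Phi> b * v))"
proof (cases "j a = j b \<and> j b = j c")
  case True
  then show ?thesis
    using assms(2) braid_distinct[OF v] braid_first_two_equal[OF v] braid_last_two_equal[OF v] by metis
next
  case False
  then show ?thesis
    using braid_first_block[OF v] braid_last_block[OF v] braid_outer_block[OF v] braid_distinct_blocks[OF v]
    by metis
qed

text \<open>
  Writing \<open>v\<close> as the common denominator applied to \<open>w\<close> turns every coefficient into a polynomial,
  and the correction term of \<open>braid_outer_equal\<close> into the numerator of \<open>Z\<^sub>a\<close>.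
\<close>

lemma braid_correction:
  assumes w: "weight i j w" and i: "i a \<noteq> i b" "i b \<noteq> i c"
    and v: "v = (X a - X b) * ((X a - X b) * ((X b - X c) * ((X b - X c) * w)))"
  shows "coef a b * (coef a b * (coef b c * v)) - coef a b * (coef b c * (coef b c * v))
       + (\<kappa> (1 - q) * (coef a b * v) - coef a b * (coef a b * v))
       - (\<kappa> (1 - q) * (coef b c * v) - coef b c * (coef b c * v))
    = \<kappa> ((1 - q) ^ 2) * ((X a * X c - X b ^ 2) * ((X a * X b - \<kappa> q * X b * X c) * w))"
proof -
  let ?k = "\<kappa> (q - 1)" and ?x = "X a" and ?y = "X b" and ?z = "X c" and ?p = "coef a b" and ?r = "coef b c"
  let ?D = "?x - ?y" and ?E = "?y - ?z"
  have wD: "weight i j (?D * u)" and wE: "weight i j (?E * u)" if "weight i j u" for u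
    using weight_X_bicommutant[OF bicommutant_diff[OF X_bicommutant[OF abc_mem(1)] X_bicommutant[OF abc_mem(2)]] that]
      weight_X_bicommutant[OF bicommutant_diff[OF X_bicommutant[OF abc_mem(2)] X_bicommutant[OF abc_mem(3)]] that]
    by simp_all
  have XX: "?y * ?x = ?x * ?y" "?z * ?x = ?x * ?z" "?z * ?y = ?y * ?z"
    using X_commute abc_mem by blast+
  have XX': "?y * (?x * u) = ?x * (?y * u)" "?z * (?x * u) = ?x * (?z * u)" "?z * (?y * u) = ?y * (?z * u)" for u
    using XX by (simp_all add: mult.assoc[symmetric])
  have p: "?p * (?D * u) = ?k * (?y * u)" and r: "?r * (?E * u) = ?k * (?z * u)" if "weight i j u" for u
    using coef_denominator[OF abc_mem(1,2) that i(1)] coef_denominator[OF abc_mem(2,3) that i(2)] by simp_all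
  have pX: "?p * (?y * u) = ?y * (?p * u)" "?p * (?z * u) = ?z * (?p * u)"
    "?r * (?y * u) = ?y * (?r * u)" "?r * (?z * u) = ?z * (?r * u)" for u
    using coef_X_left abc_mem by blast+
  have rD: "?r * (?D * u) = ?D * (?r * u)" for u
    using coef_X_left[OF abc_mem(2,3,1)] by (simp add: left_diff_distrib right_diff_distrib pX)
  have rv: "?r * v = ?k * (?z * (?D * (?D * (?E * w))))"
    unfolding v rD r[OF wE[OF w]] by (simp add: \<kappa>_left_commute[of ?D] left_diff_distrib right_diff_distrib XX' \<kappa>_left_commute[of ?x] \<kappa>_left_commute[of ?y])
  have pv: "?p * v = ?k * (?y * (?D * (?E * (?E * w))))"
    unfolding v by (rule p[OF wD[OF wE[OF wE[OF w]]]])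
  have prv: "?p * (?r * v) = ?k * (?z * (?k * (?y * (?D * (?E * w)))))"
    unfolding rv by (simp add: \<kappa>_left_commute[of ?p] pX p[OF wD[OF wE[OF w]]])
  have pprv: "?p * (?p * (?r * v)) = ?k * (?z * (?k * (?y * (?k * (?y * (?E * w))))))"
    unfolding prv by (simp add: \<kappa>_left_commute[of ?p] pX p[OF wE[OF w]])
  have "?p * (?r * (?r * v)) = ?r * (?p * (?r * v))" by (simp only: coef_reorder)
  also have "\<dots> = ?k * (?z * (?k * (?y * (?D * (?k * (?z * w))))))"
    unfolding prv by (simp only: \<kappa>_left_commute[of ?r] pX rD r[OF w])
  finally have prrv: "?p * (?r * (?r * v)) = \<dots>" .
  have ppv: "?p * (?p * v) = ?k * (?y * (?k * (?y * (?E * (?E * w)))))"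
    unfolding pv by (simp add: \<kappa>_left_commute[of ?p] pX p[OF wE[OF wE[OF w]]])
  have "?r * (?r * v) = ?k * (?z * (?D * (?D * (?k * (?z * w)))))"
    unfolding rv by (simp only: \<kappa>_left_commute[of ?r] pX rD r[OF w])
  then have rrv: "?r * (?r * v) = ?k * (?z * (?D * (?D * (?k * (?z * w)))))" .
  define Q where "Q = \<kappa> q"
  have kQ: "?k = Q - 1" "\<kappa> (1 - q) = 1 - Q" "\<kappa> ((1 - q) ^ 2) = (1 - Q) * (1 - Q)" "\<kappa> q = Q"
    by (simp_all add: Q_def \<kappa>_diff \<kappa>_one \<kappa>_mult power2_eq_square)
  have QX: "?x * (Q * u) = Q * (?x * u)" "?y * (Q * u) = Q * (?y * u)" "?z * (Q * u) = Q * (?z * u)" for u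
    unfolding Q_def by (rule \<kappa>_left_commute)+
  show ?thesis
    unfolding pprv prrv unfolding ppv rrv unfolding pv rv unfolding kQ unfolding power2_eq_square
    by (simp add: left_diff_distrib right_diff_distrib mult.assoc XX' QX)
qed

end

text \<open>
  As in the previous lemma, with the denominator \<open>(X\<^sub>a - X\<^sub>b)\<^sup>2\<close>.
\<close>

lemma square_correction:
  assumes ab: "a \<in> {1..n}" "b \<in> {1..n}" and w: "weight i j w" and i: "i a \<noteq> i b"
    and v: "v = (X a - X b) * ((X a - X b) * w)"
  shows "\<kappa> q * v + coef a b * (coef b a * v) = (\<kappa> q * X a - X b) * ((X a - \<kappa> q * X b) * w)"
proof -
  let ?k = "\<kappa> (q - 1)" and ?x = "X a" and ?y = "X b"
  have XX: "?y * ?x = ?x * ?y" using X_commute ab by blast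
  have XX': "?y * (?x * u) = ?x * (?y * u)" for u using XX by (simp add: mult.assoc[symmetric])
  have D: "weight i j ((?y - ?x) * w)"
    by (rule weight_X_bicommutant[OF bicommutant_diff[OF X_bicommutant X_bicommutant] w]) (use ab in auto)
  have "v = (?y - ?x) * ((?y - ?x) * w)" by (simp add: v algebra_simps)
  then have ba: "coef b a * v = ?k * (?x * ((?y - ?x) * w))"
    using coef_denominator[OF ab(2,1) D] i by simp
  have "coef a b * (coef b a * v) = - (?k * (?x * (coef a b * ((?x - ?y) * w))))"
    unfolding ba \<kappa>_left_commute[of "coef a b"] coef_X_left[OF ab ab(1)] by (simp add: algebra_simps)
  also have "\<dots> = - (?k * (?x * (?k * (?y * w))))" by (simp only: coef_denominator[OF ab w i])
  finally have pp: "coef a b * (coef b a * v) = - (?k * (?x * (?k * (?y * w))))" .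
  define Q where "Q = \<kappa> q"
  have kQ: "?k = Q - 1" "\<kappa> q = Q" by (simp_all add: Q_def \<kappa>_diff \<kappa>_one)
  have QX: "?x * (Q * u) = Q * (?x * u)" "?y * (Q * u) = Q * (?y * u)" for u
    unfolding Q_def by (rule \<kappa>_left_commute)+
  show ?thesis
    unfolding pp unfolding v kQ by (simp add: left_diff_distrib right_diff_distrib mult.assoc XX' QX)
qed

subsection \<open>From weight vectors to sums of idempotents\<close>

lemma eq_on_idempotent:
  assumes i: "i \<in> YH_I n q" and S: "S \<subseteq> YH_J d n"
    and eq: "\<And>j v. j \<in> S \<Longrightarrow> weight i j v \<Longrightarrow> x * v = y * v"
  shows "x * (eI i * sum eJ S) = y * (eI i * sum eJ S)"
proof -
  have "x * (eI i * eJ j) = y * (eI i * eJ j)" if "j \<in> S" for j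
    using eq[OF that weight_idempotents[OF i]] that S by blast
  then show ?thesis by (simp only: sum_distrib_left cong: sum.cong)
qed

lemma idempotent_weight:
  assumes v: "weight i' j' v" and i: "i \<in> YH_I n q" and S: "S \<subseteq> YH_J d n"
  shows "eI i * sum eJ S * v = (if i = i' \<and> j' \<in> S then v else 0)"
  using sum_eJ_weight[OF v S] eI_weight[OF v i] by (auto simp: mult.assoc)

lemma eigen_idempotent: "i \<in> YH_I n q \<Longrightarrow> xspec.joint_eigen i (eI i * x)"
  using xspec.joint_eigen_right[OF xspec.joint_eigen_eigenidempotent] by (simp add: YH_I_eq)

lemma \<sigma>_\<sigma>: "f \<circ> \<sigma> a \<circ> \<sigma> a = f"
  by (simp add: fun_eq_iff)

text \<open>
  On a vector of weight \<open>(i', j')\<close> both sides test whether \<open>(i', j')\<close> is \<open>(i, j)\<close> with \<open>j\<close> in \<open>S\<close>: the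
  left side before, the right side after the weight has been permuted by \<open>\<Phi>\<^sub>a\<close>.
\<close>

lemma \<Phi>_permutes_idempotents:
  assumes a: "1 \<le> a" "a < n" and i: "i \<in> YH_I n q" and S: "S \<subseteq> YH_J d n"
  shows "\<Phi> a * (eI i * sum eJ S) = eI (i \<circ> \<sigma> a) * sum eJ ((\<lambda>j. j \<circ> \<sigma> a) ` S) * \<Phi> a"
proof (rule eq_if_eq_on_weights)
  fix i' j' v assume v: "weight i' j' v"
  have a': "a \<in> {1..<n}" using a by simp
  have w: "weight (i' \<circ> \<sigma> a) (j' \<circ> \<sigma> a) (\<Phi> a * v)" by (rule weight_\<Phi>[OF a(1) refl _ v]) (use a in simp)
  have S': "(\<lambda>j. j \<circ> \<sigma> a) ` S \<subseteq> YH_J d n" using S \<sigma>_YH_J[OF a'] by auto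
  have inj: "f \<circ> \<sigma> a = f' \<circ> \<sigma> a \<longleftrightarrow> f = f'" for f f' :: "nat \<Rightarrow> 'x"
    using \<sigma>_\<sigma>[of f a] \<sigma>_\<sigma>[of f' a] by metis
  have mem: "j' \<circ> \<sigma> a \<in> (\<lambda>j. j \<circ> \<sigma> a) ` S \<longleftrightarrow> j' \<in> S"
    unfolding image_iff inj by auto
  have "\<Phi> a * (eI i * sum eJ S) * v = \<Phi> a * (if i = i' \<and> j' \<in> S then v else 0)"
    using idempotent_weight[OF v i S] by (simp add: mult.assoc)
  also have "\<dots> = eI (i \<circ> \<sigma> a) * sum eJ ((\<lambda>j. j \<circ> \<sigma> a) ` S) * (\<Phi> a * v)"
    using idempotent_weight[OF w \<sigma>_YH_I[OF a' i] S'] unfolding inj mem by simp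
  finally show "\<Phi> a * (eI i * sum eJ S) * v = eI (i \<circ> \<sigma> a) * sum eJ ((\<lambda>j. j \<circ> \<sigma> a) ` S) * \<Phi> a * v"
    by (simp add: mult.assoc)
qed

lemma \<Phi>_X_commute:
  assumes "1 \<le> a" "a < n" "b \<in> {1..n}" "b \<noteq> a" "b \<noteq> a + 1"
  shows "\<Phi> a * X b = X b * \<Phi> a"
  by (rule eq_if_eq_on_weights)
    (use X_\<Phi>_other[OF assms(1) refl _ _ assms(3-)] assms(2) in \<open>simp add: mult.assoc\<close>)

lemma \<Phi>_commute:
  assumes "1 \<le> a" "a < n" "1 \<le> b" "b < n" "\<bar>int a - int b\<bar> > 1"
  shows "\<Phi> a * \<Phi> b = \<Phi> b * \<Phi> a"
proof (rule eq_if_eq_on_weights)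
  fix i j v assume v: "weight i j v"
  have "a + 1 < b \<or> b + 1 < a" using assms(5) by linarith
  then have "\<Phi> a * (\<Phi> b * v) = \<Phi> b * (\<Phi> a * v)"
    using \<Phi>_\<Phi>_far[OF v assms(1) _ assms(4)] \<Phi>_\<Phi>_far[OF v assms(3) _ assms(2)] by auto
  then show "\<Phi> a * \<Phi> b * v = \<Phi> b * \<Phi> a * v" by (simp add: mult.assoc)
qed

text \<open>
  \<open>inverts i v r\<close>: left multiplication by \<open>r\<close> inverts left multiplication by \<open>v\<close> on the right
  ideal generated by \<open>eI i\<close>.
\<close>

definition inverts :: "(nat \<Rightarrow> int) \<Rightarrow> 'a \<Rightarrow> 'a \<Rightarrow> bool" where
  "inverts i v r \<longleftrightarrow> v \<in> bicommutant (X ` {1..n}) \<and> r \<in> bicommutant (X ` {1..n}) \<and>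
     (\<forall>z. xspec.joint_eigen i z \<longrightarrow> r * (v * z) = z)"

lemma inverts_difference:
  assumes ab: "a \<in> {1..n}" "b \<in> {1..n}" and i: "i \<in> YH_I n q" and ne: "i a \<noteq> i b"
  shows "inverts i (X a - X b) (R a b)"
  unfolding inverts_def
  using R_eigen_inverse(2)[OF ab _ i ne] bicommutant_diff[OF X_bicommutant X_bicommutant] R_bicommutant ab by blast

lemma inverts_mult:
  assumes vr: "inverts i v r" and vr': "inverts i v' r'"
  shows "inverts i (v * v') (r * r')"
proof -
  have mem: "v \<in> bicommutant (X ` {1..n})" "r \<in> bicommutant (X ` {1..n})"
    "v' \<in> bicommutant (X ` {1..n})" "r' \<in> bicommutant (X ` {1..n})"
    using vr vr' by (auto simp: inverts_def)
  have "r * r' * (v * v' * z) = z" if z: "xspec.joint_eigen i z" for z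
  proof -
    have "r * r' * (v * v' * z) = r * (r' * v) * (v' * z)" by (simp only: mult.assoc)
    also have "r' * v = v * r'" by (rule xspec.C_commute) (use mem in auto)
    also have "r * (v * r') * (v' * z) = r * (v * (r' * (v' * z)))" by (simp only: mult.assoc)
    finally show ?thesis using vr vr' z by (simp add: inverts_def)
  qed
  then show ?thesis using mem by (simp add: inverts_def bicommutant_mult)
qed

lemma inverts_right:
  assumes vr: "inverts i v r" and z: "xspec.joint_eigen i z"
  shows "v * (r * z) = z"
proof -
  have "v * r = r * v" by (rule xspec.C_commute) (use vr in \<open>auto simp: inverts_def\<close>)
  then have "v * (r * z) = r * (v * z)" by (simp only: mult.assoc[symmetric])
  then show ?thesis using vr z by (simp add: inverts_def)
qed

text \<open>
  \<open>1 - X\<^sub>a X\<^sub>b\<^sup>-\<^sup>1 = - (X\<^sub>a - X\<^sub>b) X\<^sub>b\<^sup>-\<^sup>1\<close>.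
\<close>

lemma inverts_quotient:
  assumes ab: "a \<in> {1..n}" "b \<in> {1..n}" and i: "i \<in> YH_I n q" and ne: "i a \<noteq> i b"
    and z: "X b * z = 1" "z * X b = 1"
  shows "inverts i (1 - X a * z) (- (X b * R a b))"
proof -
  have zb: "z \<in> bicommutant (X ` {1..n})"
    unfolding bicommutant_def
  proof (intro CollectI allI impI)
    fix y assume "\<forall>s\<in>X ` {1..n}. s * y = y * s"
    then have "X b * y = y * X b" using ab by auto
    then have "z * (X b * y) * z = z * (y * X b) * z" by simp
    then have "(z * X b) * (y * z) = (z * y) * (X b * z)" by (simp only: mult.assoc)
    then show "z * y = y * z" using z by simp
  qed
  have v: "1 - X a * z \<in> bicommutant (X ` {1..n})"
    by (intro bicommutant_diff bicommutant_mult bicommutant_one X_bicommutant ab zb)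
  have r: "- (X b * R a b) \<in> bicommutant (X ` {1..n})"
    by (intro bicommutant_minus bicommutant_mult R_bicommutant X_bicommutant ab)
  have "- (X b * R a b) * ((1 - X a * z) * u) = u" if u: "xspec.joint_eigen i u" for u
  proof -
    have "X b * R a b = R a b * X b" using R_X[OF ab ab(2)] by simp
    then have "- (X b * R a b) * ((1 - X a * z) * u) = R a b * (X b * X a * z * u - X b * u)"
      by (simp add: algebra_simps)
    also have "X b * X a * z = X a * (X b * z)" using X_commute[OF ab] by (simp add: mult.assoc[symmetric])
    also have "R a b * (X a * (X b * z) * u - X b * u) = R a b * ((X a - X b) * u)"
      using z by (simp add: left_diff_distrib)
    finally show ?thesis using R_eigen_inverse(2)[OF ab u i ne] by simp
  qed
  then show ?thesis using v r by (simp add: inverts_def)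
qed

end

text \<open>
  All labels \<open>j\<close> in \<open>S\<close> have the same pattern of equalities, and the relations on weight vectors
  depend on \<open>j\<close> through this pattern only; hence they hold on the sum of the \<open>e(j)\<close>.
\<close>

locale intertwiner_block = yokonuma_hecke +
  fixes i :: "nat \<Rightarrow> int" and a :: nat and S :: "(nat \<Rightarrow> nat) set" and same :: "nat \<Rightarrow> nat \<Rightarrow> bool"
  assumes i: "i \<in> YH_I n q" and a: "1 \<le> a" "a < n" and S: "S \<subseteq> YH_J d n"
    and same: "j \<in> S \<Longrightarrow> b \<in> {1..n} \<Longrightarrow> c \<in> {1..n} \<Longrightarrow> j b = j c \<longleftrightarrow> same b c"
begin

abbreviation E where "E \<equiv> eI i * sum eJ S"

lemma a_mem: "a \<in> {1..n}" "a + 1 \<in> {1..n}" and a1_le: "a + 1 \<le> n"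
  using a by auto

lemma same_next: "j \<in> S \<Longrightarrow> j a = j (a + 1) \<longleftrightarrow> same a (a + 1)"
  using same a_mem by blast

lemma \<Phi>_X_E:
  "\<Phi> a * X (a + 1) * E = (if i a = i (a + 1) \<and> same a (a + 1)
     then X a * \<Phi> a + \<kappa> q * X (a + 1) - X a else X a * \<Phi> a) * E"
proof (rule eq_on_idempotent[OF i S])
  fix j v assume j: "j \<in> S" and v: "weight i j v"
  show "\<Phi> a * X (a + 1) * v = (if i a = i (a + 1) \<and> same a (a + 1)
     then X a * \<Phi> a + \<kappa> q * X (a + 1) - X a else X a * \<Phi> a) * v"
    using X_\<Phi>_lower[OF a(1) refl a1_le v] same_next[OF j]
    by (simp add: distrib_right left_diff_distrib mult.assoc)
qed

lemma X_\<Phi>_E: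
  "X (a + 1) * \<Phi> a * E = (if i a = i (a + 1) \<and> same a (a + 1)
     then \<Phi> a * X a + \<kappa> q * X (a + 1) - X a else \<Phi> a * X a) * E"
proof (rule eq_on_idempotent[OF i S])
  fix j v assume j: "j \<in> S" and v: "weight i j v"
  show "X (a + 1) * \<Phi> a * v = (if i a = i (a + 1) \<and> same a (a + 1)
     then \<Phi> a * X a + \<kappa> q * X (a + 1) - X a else \<Phi> a * X a) * v"
    using X_\<Phi>_upper[OF a(1) refl a1_le v] same_next[OF j]
    by (simp add: distrib_right left_diff_distrib mult.assoc)
qed

lemma \<Phi>_square_E:
  "\<Phi> a ^ 2 * E =
    (if i a \<noteq> i (a + 1) \<and> same a (a + 1)
     then (\<kappa> q * X a - X (a + 1)) * (X a - \<kappa> q * X (a + 1)) * (R a (a + 1) * R a (a + 1) * E)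
     else if i a = i (a + 1) \<and> same a (a + 1) then \<kappa> (q + 1) * \<Phi> a * E else \<kappa> q * E)"
proof -
  let ?x = "if i a \<noteq> i (a + 1) \<and> same a (a + 1)
     then (\<kappa> q * X a - X (a + 1)) * (X a - \<kappa> q * X (a + 1)) * (R a (a + 1) * R a (a + 1))
     else if i a = i (a + 1) \<and> same a (a + 1) then \<kappa> (q + 1) * \<Phi> a else \<kappa> q"
  have "\<Phi> a ^ 2 * E = ?x * E"
  proof (rule eq_on_idempotent[OF i S])
    fix j v assume j: "j \<in> S" and v: "weight i j v"
    let ?w = "R a (a + 1) * (R a (a + 1) * v)"
    have "\<kappa> q * v + coef a (a + 1) * (coef (a + 1) a * v)
      = (\<kappa> q * X a - X (a + 1)) * ((X a - \<kappa> q * X (a + 1)) * ?w)" if "i a \<noteq> i (a + 1)"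
      by (rule square_correction[OF a_mem weight_R[OF a_mem weight_R[OF a_mem v]] that])
        (simp add: R_inverse(1)[OF a_mem v that] R_inverse(1)[OF a_mem weight_R[OF a_mem v] that])
    then show "\<Phi> a ^ 2 * v = ?x * v"
      using \<Phi>_square[OF a(1) refl a1_le v] same_next[OF j] by (simp add: power2_eq_square mult.assoc)
  qed
  then show ?thesis by (simp add: mult.assoc)
qed

lemma braid_E:
  assumes a2: "a + 2 \<le> n"
  shows "\<Phi> a * \<Phi> (a + 1) * \<Phi> a * E =
    (if i a = i (a + 1) \<and> i (a + 1) = i (a + 2) \<and> same a (a + 1) \<and> same (a + 1) (a + 2)
     then (\<Phi> (a + 1) * \<Phi> a * \<Phi> (a + 1) + \<kappa> q * \<Phi> a - \<kappa> q * \<Phi> (a + 1)) * E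
     else if i a = i (a + 2) \<and> i (a + 2) \<noteq> i (a + 1) \<and> same a (a + 1) \<and> same (a + 1) (a + 2)
     then \<Phi> (a + 1) * \<Phi> a * \<Phi> (a + 1) * E +
       \<kappa> ((1 - q) ^ 2) * (X a * X (a + 2) - X (a + 1) ^ 2) * (X a * X (a + 1) - \<kappa> q * X (a + 1) * X (a + 2))
        * (R a (a + 1) * R a (a + 1) * (R (a + 1) (a + 2) * R (a + 1) (a + 2)) * E)
     else \<Phi> (a + 1) * \<Phi> a * \<Phi> (a + 1) * E)"
proof -
  define b c where "b = a + 1" and "c = b + 1"
  have bc: "a + 1 = b" "a + 2 = c" by (simp_all add: b_def c_def)
  have cn: "c \<le> n" using a2 bc by simp
  note abc = a(1) b_def c_def cn
  note mem = abc_mem[OF abc]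
  let ?R = "R a b * R a b * (R b c * R b c)"
  let ?Z = "\<kappa> ((1 - q) ^ 2) * (X a * X c - X b ^ 2) * (X a * X b - \<kappa> q * X b * X c) * ?R"
  let ?x = "if i a = i b \<and> i b = i c \<and> same a b \<and> same b c
     then \<Phi> b * \<Phi> a * \<Phi> b + \<kappa> q * \<Phi> a - \<kappa> q * \<Phi> b
     else if i a = i c \<and> i c \<noteq> i b \<and> same a b \<and> same b c
     then \<Phi> b * \<Phi> a * \<Phi> b + ?Z else \<Phi> b * \<Phi> a * \<Phi> b"
  have "\<Phi> a * \<Phi> b * \<Phi> a * E = ?x * E"
  proof (rule eq_on_idempotent[OF i S])
    fix j v assume j: "j \<in> S" and v: "weight i j v"
    have sm: "same a b \<longleftrightarrow> j a = j b" "same b c \<longleftrightarrow> j b = j c"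
      using same[OF j mem(1,2)] same[OF j mem(2,3)] by simp_all
    note wab = weight_R[OF mem(1,2)] and wbc = weight_R[OF mem(2,3)]
    consider (eq) "i a = i b" "i b = i c" "j a = j b" "j b = j c"
      | (outer) "i a = i c" "i a \<noteq> i b" "j a = j b" "j b = j c"
      | (gen) "\<not> (i a = i c \<and> j a = j b \<and> j b = j c)" by metis
    then show "\<Phi> a * \<Phi> b * \<Phi> a * v = ?x * v"
    proof cases
      case eq
      then show ?thesis using braid_all_equal[OF abc v] sm by (simp add: algebra_simps)
    next
      case outer
      have ne: "i b \<noteq> i c" using outer by simp
      let ?w = "R a b * (R a b * (R b c * (R b c * v)))"
      have w: "weight i j ?w" by (intro wab wbc v)
      have v_eq: "v = (X a - X b) * ((X a - X b) * ((X b - X c) * ((X b - X c) * ?w)))"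
      proof -
        let ?D = "X a - X b" and ?F = "X b - X c"
        have RF: "?F * (R a b * u) = R a b * (?F * u)" for u
        proof -
          have "?F * R a b = R a b * ?F" using R_X mem by (simp add: algebra_simps)
          then show ?thesis by (simp add: mult.assoc[symmetric])
        qed
        have "?D * (?D * (?F * (?F * ?w))) = ?D * (?D * (R a b * (R a b * v)))"
          by (simp only: RF R_inverse(1)[OF mem(2,3) v ne] R_inverse(1)[OF mem(2,3) wbc[OF v] ne])
        also have "\<dots> = v" by (simp only: R_inverse(1)[OF mem(1,2) v outer(2)] R_inverse(1)[OF mem(1,2) wab[OF v] outer(2)])
        finally show ?thesis by simp
      qed
      have "\<Phi> a * (\<Phi> b * (\<Phi> a * v)) = \<Phi> b * (\<Phi> a * (\<Phi> b * v))
         + \<kappa> ((1 - q) ^ 2) * ((X a * X c - X b ^ 2) * ((X a * X b - \<kappa> q * X b * X c) * ?w))"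
        using braid_outer_equal[OF abc v outer(3,4,1,2)] braid_correction[OF abc w outer(2) ne v_eq] by simp
      then show ?thesis using outer ne sm by (simp add: mult.assoc distrib_right)
    next
      case gen
      then show ?thesis using braid_generic[OF abc v gen] sm by (auto simp: mult.assoc)
    qed
  qed
  then show ?thesis unfolding bc by (simp add: mult.assoc distrib_right)
qed

end

section \<open>The Yokonuma--Hecke algebra as a quotient of the free algebra\<close>

lemma free_algebra_simps:
  "p \<in> carrier (free_algebra S) \<longleftrightarrow> (\<forall>w\<in>Poly_Mapping.keys p. set w \<subseteq> S)"
  "\<one>\<^bsub>free_algebra S\<^esub> = 1" "\<zero>\<^bsub>free_algebra S\<^esub> = 0"
  "p \<otimes>\<^bsub>free_algebra S\<^esub> r = p * r" "p \<oplus>\<^bsub>free_algebra S\<^esub> r = p + r"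
  by (simp_all add: free_algebra_def)

context
  fixes S :: "'g set"
begin

abbreviation F where "F \<equiv> carrier (free_algebra S :: ('g list \<Rightarrow>\<^sub>0 'k::field) ring)"

lemma free_algebra_zero: "0 \<in> F"
  and free_algebra_const: "const c \<in> F"
  and free_algebra_var: "x \<in> S \<Longrightarrow> var x \<in> F"
  and free_algebra_uminus: "p \<in> F \<Longrightarrow> - p \<in> F"
  by (auto simp: free_algebra_simps const_def var_def)

lemma free_algebra_add: "p \<in> F \<Longrightarrow> r \<in> F \<Longrightarrow> p + r \<in> F"
  using keys_add[of p r] by (auto simp: free_algebra_simps)

lemma free_algebra_diff: "p \<in> F \<Longrightarrow> r \<in> F \<Longrightarrow> p - r \<in> F"
  using free_algebra_add[of p "- r"] free_algebra_uminus[of r] by simp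

lemma free_algebra_one: "1 \<in> F"
  by (auto simp: free_algebra_simps zero_list_def)

lemma free_algebra_mult:
  assumes "p \<in> F" "r \<in> F"
  shows "p * r \<in> F"
  unfolding free_algebra_simps
proof
  fix w assume "w \<in> Poly_Mapping.keys (p * r)"
  then obtain u v where "w = u @ v" "u \<in> Poly_Mapping.keys p" "v \<in> Poly_Mapping.keys r"
    using keys_mult[of p r] by (auto simp: plus_list_def)
  then show "set w \<subseteq> S" using assms by (auto simp: free_algebra_simps)
qed

lemma free_algebra_power: "p \<in> F \<Longrightarrow> p ^ m \<in> F"
  by (induction m) (auto intro: free_algebra_one free_algebra_mult)

lemma free_algebra_sum: "(\<And>t. t \<in> T \<Longrightarrow> f t \<in> F) \<Longrightarrow> sum f T \<in> F"
  by (induction T rule: infinite_finite_induct) (auto intro: free_algebra_zero free_algebra_add)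

lemma ring_free_algebra: "ring (free_algebra S :: ('g list \<Rightarrow>\<^sub>0 'k::field) ring)"
proof (intro ringI abelian_groupI monoidI)
  show "\<exists>y\<in>F. y \<oplus>\<^bsub>free_algebra S\<^esub> x = \<zero>\<^bsub>free_algebra S\<^esub>" if "x \<in> F" for x :: "'g list \<Rightarrow>\<^sub>0 'k"
    using that free_algebra_uminus by (intro bexI[of _ "- x"]) (auto simp: free_algebra_simps(2-))
qed (auto simp: free_algebra_simps(2-) algebra_simps
    intro: free_algebra_zero free_algebra_one free_algebra_add free_algebra_mult)

lemma minus_free_algebra:
  assumes "p \<in> F" "r \<in> F"
  shows "p \<ominus>\<^bsub>free_algebra S\<^esub> r = p - r"
proof -
  interpret ring "free_algebra S :: ('g list \<Rightarrow>\<^sub>0 'k::field) ring" by (rule ring_free_algebra)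
  have "\<ominus>\<^bsub>free_algebra S\<^esub> r = - r"
    by (rule minus_equality) (use assms free_algebra_uminus in \<open>auto simp: free_algebra_simps(2-)\<close>)
  then show ?thesis by (simp add: a_minus_def free_algebra_simps(2-))
qed

end

lemma sum_of_singles: "p = (\<Sum>w\<in>Poly_Mapping.keys p. Poly_Mapping.single w (Poly_Mapping.lookup p w))"
proof (rule poly_mapping_eqI)
  fix k
  show "Poly_Mapping.lookup p k = Poly_Mapping.lookup (\<Sum>w\<in>Poly_Mapping.keys p. Poly_Mapping.single w (Poly_Mapping.lookup p w)) k"
    by (simp add: lookup_sum lookup_single when_def in_keys_iff)
qed

lemma const_central:
  fixes p :: "'g list \<Rightarrow>\<^sub>0 'k::field"
  shows "const c * p = p * const c"
proof -
  have "const c * Poly_Mapping.single w a = Poly_Mapping.single w a * const c" for w :: "'g list" and a :: 'k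
    by (simp add: const_def mult_single plus_list_def mult.commute)
  then show ?thesis
    by (subst (1 2) sum_of_singles[of p]) (simp add: sum_distrib_left sum_distrib_right)
qed

lemma YH_relators_subset: "YH_relators d n q \<subseteq> carrier (free_algebra (YH_gens n) :: (gen list \<Rightarrow>\<^sub>0 'k::field) ring)"
proof -
  let ?F = "carrier (free_algebra (YH_gens n) :: (gen list \<Rightarrow>\<^sub>0 'k::field) ring)"
  have t: "var (GenT a) \<in> ?F" if "a \<in> {1..n}" for a
    using that by (intro free_algebra_var) (simp add: YH_gens_def)
  have g: "var (GenG a) \<in> ?F" if "a \<in> {1..<n}" for a
    using that by (intro free_algebra_var) (simp add: YH_gens_def)
  have ts: "var (GenT (Transposition.transpose b (b + 1) a)) \<in> ?F" if "a \<in> {1..n}" "b \<in> {1..<n}" for a b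
    using that by (intro t) (auto simp: Transposition.transpose_def)
  show ?thesis
    unfolding YH_relators_def Let_def
    by (intro Un_least subsetI; elim CollectE exE conjE; hypsubst;
        intro free_algebra_diff free_algebra_add free_algebra_mult free_algebra_power free_algebra_sum
          free_algebra_const free_algebra_one ts t g) auto
qed

lemma ideal_YH_ideal: "ideal (YH_ideal d n q) (free_algebra (YH_gens n))"
  unfolding YH_ideal_def by (rule ring.genideal_ideal[OF ring_free_algebra YH_relators_subset])

lemma ring_YH: "ring (YH d n q)"
  unfolding YH_def by (rule ideal.quotient_is_ring[OF ideal_YH_ideal])

lemma YH_class_hom: "YH_class d n q \<in> ring_hom (free_algebra (YH_gens n)) (YH d n q)"
  unfolding YH_def YH_class_def by (rule ideal.rcos_ring_hom[OF ideal_YH_ideal])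

lemma carrier_YH: "carrier (YH d n q) = YH_class d n q ` carrier (free_algebra (YH_gens n))"
  by (auto simp: YH_def FactRing_def A_RCOSETS_defs YH_class_def a_r_coset_def)

lemma YH_class_eqI:
  assumes p: "p \<in> carrier (free_algebra (YH_gens n))" and r: "r \<in> carrier (free_algebra (YH_gens n))"
    and rel: "p - r \<in> YH_relators d n q"
  shows "YH_class d n q p = YH_class d n q r"
proof -
  have "p - r \<in> YH_ideal d n q"
    unfolding YH_ideal_def using ring.genideal_self[OF ring_free_algebra YH_relators_subset] rel by blast
  then show ?thesis
    using ring.quotient_eq_iff_same_a_r_cos[OF ring_free_algebra ideal_YH_ideal p r]
    by (simp add: YH_class_def minus_free_algebra[OF p r])
qed

section \<open>Representing a ring by a type\<close>

text \<open>
  Statements about the carrier of a ring \<open>Y\<close> become statements about all elements of a type that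
  \<open>rep\<close> maps bijectively onto it.
\<close>

locale ring_representation = ring Y for Y :: "'b ring" (structure) +
  fixes rep :: "'a::{ring,monoid_mult} \<Rightarrow> 'b"
  assumes inj_rep: "inj rep" and range_rep: "range rep = carrier Y"
    and rep_add: "rep (x + y) = rep x \<oplus> rep y"
    and rep_mult: "rep (x * y) = rep x \<otimes> rep y"
    and rep_one: "rep 1 = \<one>"
begin

lemma rep_carrier [simp]: "rep x \<in> carrier Y"
  using range_rep by auto

lemma rep_eq_iff: "rep x = rep y \<longleftrightarrow> x = y"
  using inj_rep by (auto dest: injD)

lemma rep_zero: "rep 0 = \<zero>"
proof -
  have "rep 0 \<oplus> rep 0 = rep 0" using rep_add[of 0 0] by simp
  then show ?thesis using add.r_cancel_one rep_carrier by blast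
qed

lemma rep_eq_zero_iff: "rep x = \<zero> \<longleftrightarrow> x = 0"
  using rep_eq_iff[of x 0] by (simp add: rep_zero)

lemma rep_diff: "rep (x - y) = rep x \<ominus> rep y"
proof -
  have "rep (- y) = \<ominus> rep y"
    by (rule minus_equality[symmetric]) (simp_all add: rep_add[symmetric] rep_zero)
  then show ?thesis using rep_add[of x "- y"] by (simp add: a_minus_def)
qed

lemma rep_power: "rep (x ^ m) = rep x [^] m"
  by (induction m) (simp_all add: rep_one rep_mult power_Suc2 del: power_Suc)

lemma rep_sum: "finite S \<Longrightarrow> rep (sum f S) = finsum Y (\<lambda>s. rep (f s)) S"
  by (induction S rule: finite_induct) (simp_all add: rep_zero rep_add)

lemma finsum_rep:
  assumes "finite S" and "\<And>s. s \<in> S \<Longrightarrow> f s = rep (h s)"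
  shows "finsum Y f S = rep (sum h S)"
  unfolding rep_sum[OF assms(1)] by (rule finsum_cong') (use assms(2) in auto)

lemma gfinsum_rep:
  assumes "\<And>s. s \<in> S \<Longrightarrow> f s = rep (h s)"
  shows "gfinsum Y f S = rep (sum h {s \<in> S. h s \<noteq> 0})"
proof -
  have "{s \<in> S. f s \<noteq> \<zero>} = {s \<in> S. h s \<noteq> 0}" using assms by (auto simp: rep_eq_zero_iff)
  then show ?thesis
    using finsum_rep[of "{s \<in> S. h s \<noteq> 0}" f h] assms
    by (auto simp: gfinsum_def gfinprod_def finsum_def rep_zero)
qed

definition unrep :: "'b \<Rightarrow> 'a" where
  "unrep = inv_into UNIV rep"

lemma rep_unrep: "x \<in> carrier Y \<Longrightarrow> rep (unrep x) = x"
  using range_rep by (simp add: unrep_def f_inv_into_f)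

lemma unrep_rep: "unrep (rep x) = x"
  using inj_rep by (simp add: unrep_def)

lemma principal_right_ideal: "rep f <# carrier Y = rep ` range ((*) f)"
  by (auto simp: l_coset_def range_rep[symmetric] rep_mult image_iff)

lemma principal_right_ideal_eq:
  assumes "f * f = f" and "\<And>v. f * v = v \<longleftrightarrow> P (rep v)"
  shows "rep f <# carrier Y = {x \<in> carrier Y. P x}"
proof -
  have "v \<in> range ((*) f) \<longleftrightarrow> f * v = v" for v
    using assms(1) by (auto simp: mult.assoc[symmetric]) (metis rangeI)
  then have "rep f <# carrier Y = rep ` {v. P (rep v)}"
    unfolding principal_right_ideal using assms(2) by auto
  then show ?thesis using range_rep by auto
qed

text \<open>
  If \<open>r\<close> is a two-sided inverse of \<open>v\<close> on the right ideal of \<open>f\<close>, then the inverse function of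
  multiplication by \<open>v\<close> is multiplication by \<open>r\<close>.
\<close>

lemma rep_inv_on:
  assumes left: "\<And>z. r * (v * (f * z)) = f * z" and y: "f * (r * y) = r * y" "v * (r * y) = y"
  shows "inv_on Y (rep f) (rep v) (rep y) = rep (r * y)"
  unfolding inv_on_def
proof (rule the_inv_into_f_eq)
  show "inj_on (\<lambda>z. rep v \<otimes> z) (rep f <# carrier Y)"
  proof (rule inj_onI)
    fix x x' assume "x \<in> rep f <# carrier Y" "x' \<in> rep f <# carrier Y" and eq: "rep v \<otimes> x = rep v \<otimes> x'"
    then obtain z z' where z: "x = rep (f * z)" "x' = rep (f * z')" by (auto simp: principal_right_ideal)
    then have "v * (f * z) = v * (f * z')" using eq by (simp add: rep_mult[symmetric] rep_eq_iff)
    then show "x = x'" using left[of z] left[of z'] z by metis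
  qed
  show "rep v \<otimes> rep (r * y) = rep y" using y(2) by (simp add: rep_mult[symmetric])
  show "rep (r * y) \<in> rep f <# carrier Y" using y(1) unfolding principal_right_ideal by (metis rangeI imageI)
qed

lemma rep_inv: "x * z = 1 \<Longrightarrow> z * x = 1 \<Longrightarrow> inv rep x = rep z"
  by (rule inv_unique'[symmetric]) (simp_all add: rep_mult[symmetric] rep_one)

text \<open>
  A complete family of orthogonal idempotents is determined by the right ideals that it generates: if
  \<open>f\<close> is another such family, then \<open>f\<^sub>s e\<^sub>s = e\<^sub>s\<close> and \<open>f\<^sub>s e\<^sub>s\<^sub>' = f\<^sub>s f\<^sub>s\<^sub>' e\<^sub>s\<^sub>' = 0\<close> for \<open>s \<noteq> s'\<close>, whence
  \<open>f\<^sub>s = f\<^sub>s \<Sum> e\<^sub>s\<^sub>' = e\<^sub>s\<close>.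
\<close>

lemma the_idempotents:
  assumes e: "\<And>s. s \<in> S \<Longrightarrow> e s * e s = e s" "\<And>s s'. s \<in> S \<Longrightarrow> s' \<in> S \<Longrightarrow> s \<noteq> s' \<Longrightarrow> e s * e s' = 0"
    and fin: "finite {s \<in> S. e s \<noteq> 0}" and sum: "sum e {s \<in> S. e s \<noteq> 0} = 1"
    and V: "\<And>s. s \<in> S \<Longrightarrow> rep (e s) <# carrier Y = V s"
  shows "(THE h. h \<in> S \<rightarrow>\<^sub>E carrier Y \<and> complete_orthogonal_idempotents Y S h \<and>
      (\<forall>s\<in>S. h s <# carrier Y = V s)) = restrict (\<lambda>s. rep (e s)) S"
proof (rule the_equality)
  let ?h = "restrict (\<lambda>s. rep (e s)) S"
  have "gfinsum Y ?h S = \<one>" using gfinsum_rep[of S ?h e] sum by (simp add: rep_one)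
  moreover have "finite {s \<in> S. ?h s \<noteq> \<zero>}"
  proof -
    have "{s \<in> S. ?h s \<noteq> \<zero>} = {s \<in> S. e s \<noteq> 0}" by (auto simp: rep_eq_zero_iff)
    then show ?thesis using fin by simp
  qed
  ultimately show "?h \<in> S \<rightarrow>\<^sub>E carrier Y \<and> complete_orthogonal_idempotents Y S ?h \<and> (\<forall>s\<in>S. ?h s <# carrier Y = V s)"
    using e V by (auto simp: complete_orthogonal_idempotents_def rep_mult[symmetric] rep_zero)
next
  fix h assume h: "h \<in> S \<rightarrow>\<^sub>E carrier Y \<and> complete_orthogonal_idempotents Y S h \<and> (\<forall>s\<in>S. h s <# carrier Y = V s)"
  define f where "f s = unrep (h s)" for s
  have hf: "h s = rep (f s)" if "s \<in> S" for s
    unfolding f_def by (rule rep_unrep[symmetric]) (use h that in \<open>auto dest: PiE_mem\<close>)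
  have coi: "complete_orthogonal_idempotents Y S h" using h by simp
  have f_idem: "f s * f s = f s" and f_orth: "s' \<in> S \<Longrightarrow> s \<noteq> s' \<Longrightarrow> f s * f s' = 0" if "s \<in> S" for s s'
    using coi that hf by (auto simp: complete_orthogonal_idempotents_def rep_mult[symmetric] rep_eq_iff rep_eq_zero_iff)
  have V_f: "rep ` range ((*) (f s)) = rep ` range ((*) (e s))" if "s \<in> S" for s
  proof -
    have "rep (f s) <# carrier Y = rep (e s) <# carrier Y"
      using h V[OF that] hf[OF that] that by auto
    then show ?thesis by (simp only: principal_right_ideal)
  qed
  have range: "range ((*) (f s)) = range ((*) (e s))" if "s \<in> S" for s
    using V_f[OF that] by (simp only: inj_image_eq_iff[OF inj_rep])
  have fe: "f s * e s = e s" if s: "s \<in> S" for s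
  proof -
    have "e s \<in> range ((*) (f s))" using range[OF s] e(1)[OF s] by (metis rangeI)
    then obtain y where "e s = f s * y" by blast
    then show ?thesis using f_idem[OF s] by (metis mult.assoc)
  qed
  have f_e: "f s = e s" if s: "s \<in> S" for s
  proof -
    have "f s = f s * (\<Sum>s'\<in>{s \<in> S. e s \<noteq> 0}. e s')" using sum by simp
    also have "\<dots> = (\<Sum>s'\<in>{s \<in> S. e s \<noteq> 0}. if s' = s then e s else 0)"
      unfolding sum_distrib_left
    proof (rule sum.cong)
      fix s' assume s': "s' \<in> {s \<in> S. e s \<noteq> 0}"
      have "f s * e s' = f s * (f s' * e s')" using fe s' by simp
      then show "f s * e s' = (if s' = s then e s else 0)"
        using fe f_orth[OF s, of s'] s' by (auto simp: mult.assoc[symmetric])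
    qed simp
    also have "\<dots> = e s" using fin s by auto
    finally show ?thesis .
  qed
  show "h = restrict (\<lambda>s. rep (e s)) S"
    using h hf f_e by (intro ext) (auto simp: PiE_def extensional_def restrict_def)
qed

end

context
  fixes d n :: nat and q :: "'k::field"
begin

abbreviation gG :: "nat \<Rightarrow> gen list \<Rightarrow>\<^sub>0 'k" where "gG a \<equiv> var (GenG a)"
abbreviation gT :: "nat \<Rightarrow> gen list \<Rightarrow>\<^sub>0 'k" where "gT a \<equiv> var (GenT a)"

lemma YH_relators_intros:
  "a \<in> {1..n} \<Longrightarrow> gT a ^ d - 1 \<in> YH_relators d n q"
  "a \<in> {1..n} \<Longrightarrow> b \<in> {1..n} \<Longrightarrow> gT a * gT b - gT b * gT a \<in> YH_relators d n q"
  "a \<in> {1..n} \<Longrightarrow> b \<in> {1..<n} \<Longrightarrow>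
     gT a * gG b - gG b * gT (Transposition.transpose b (b + 1) a) \<in> YH_relators d n q"
  "a \<in> {1..<n} \<Longrightarrow>
     gG a ^ 2 - (const q + const (q - 1) * (const (inverse (of_nat d)) * (\<Sum>r<d. gT a ^ r * gT (a + 1) ^ (d - r))) * gG a)
       \<in> YH_relators d n q"
  "a \<in> {1..<n} \<Longrightarrow> b \<in> {1..<n} \<Longrightarrow> \<bar>int a - int b\<bar> = 1 \<Longrightarrow>
     gG a * gG b * gG a - gG b * gG a * gG b \<in> YH_relators d n q"
  "a \<in> {1..<n} \<Longrightarrow> b \<in> {1..<n} \<Longrightarrow> \<bar>int a - int b\<bar> > 1 \<Longrightarrow> gG a * gG b - gG b * gG a \<in> YH_relators d n q"
  unfolding YH_relators_def Let_def by blast+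

end

locale YH_model = ring_representation "YH d n q" rep
  for d n :: nat and q :: "'k::field" and rep :: "'a::{ring,monoid_mult} \<Rightarrow> (gen list \<Rightarrow>\<^sub>0 'k) set" +
  fixes \<xi> :: 'k
  assumes n_pos: "1 \<le> n" and d_pos: "1 \<le> d" and d_char: "CHAR('k) = 0 \<or> coprime d CHAR('k)"
    and \<xi>: "primitive_root_of_unity d \<xi>" and q: "q \<noteq> 0" "q \<noteq> 1"
begin

abbreviation Y where "Y \<equiv> YH d n q"
abbreviation F0 where "F0 \<equiv> carrier (free_algebra (YH_gens n) :: (gen list \<Rightarrow>\<^sub>0 'k) ring)"

definition cls :: "(gen list \<Rightarrow>\<^sub>0 'k) \<Rightarrow> 'a" where
  "cls p = unrep (YH_class d n q p)"

lemma rep_cls: "p \<in> F0 \<Longrightarrow> rep (cls p) = YH_class d n q p"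
  unfolding cls_def by (rule rep_unrep) (auto simp: carrier_YH)

lemma cls_surj: "\<exists>p\<in>F0. x = cls p"
  using rep_carrier[of x] unfolding carrier_YH by (auto simp: cls_def) (metis unrep_rep)

lemma cls_eqI: "p \<in> F0 \<Longrightarrow> r \<in> F0 \<Longrightarrow> p - r \<in> YH_relators d n q \<Longrightarrow> cls p = cls r"
  using YH_class_eqI[of p n r d q] by (simp add: cls_def)

lemma cls_add: "p \<in> F0 \<Longrightarrow> r \<in> F0 \<Longrightarrow> cls (p + r) = cls p + cls r"
  using ring_hom_add[OF YH_class_hom[of d n q]] rep_cls free_algebra_add[of p "YH_gens n" r]
  by (simp add: rep_eq_iff[symmetric] rep_add free_algebra_simps(2-))

lemma cls_mult: "p \<in> F0 \<Longrightarrow> r \<in> F0 \<Longrightarrow> cls (p * r) = cls p * cls r"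
  using ring_hom_mult[OF YH_class_hom[of d n q]] rep_cls free_algebra_mult[of p "YH_gens n" r]
  by (simp add: rep_eq_iff[symmetric] rep_mult free_algebra_simps(2-))

lemma cls_one: "cls 1 = 1"
  using ring_hom_one[OF YH_class_hom[of d n q]] rep_cls[OF free_algebra_one]
  by (simp add: rep_eq_iff[symmetric] rep_one free_algebra_simps(2-))

lemma cls_power: "p \<in> F0 \<Longrightarrow> cls (p ^ m) = cls p ^ m"
  by (induction m) (simp_all add: cls_one cls_mult free_algebra_power)

lemma cls_zero: "cls 0 = 0"
  using cls_add[OF free_algebra_zero free_algebra_zero] by simp

lemma cls_sum: "(\<And>t. t \<in> T \<Longrightarrow> f t \<in> F0) \<Longrightarrow> cls (sum f T) = (\<Sum>t\<in>T. cls (f t))"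
  by (induction T rule: infinite_finite_induct) (auto simp: cls_zero cls_add free_algebra_sum)

definition \<kappa> :: "'k \<Rightarrow> 'a" where "\<kappa> c = cls (const c)"
definition g :: "nat \<Rightarrow> 'a" where "g a = cls (var (GenG a))"
definition t :: "nat \<Rightarrow> 'a" where "t a = cls (var (GenT a))"
definition ee :: "nat \<Rightarrow> 'a" where
  "ee a = \<kappa> (inverse (of_nat d)) * (\<Sum>r<d. t a ^ r * t (a + 1) ^ (d - r))"
definition X :: "nat \<Rightarrow> 'a" where "X a = unrep (YH_X d n q a)"

lemma gen_F0: "a \<in> {1..<n} \<Longrightarrow> var (GenG a) \<in> F0" "a \<in> {1..n} \<Longrightarrow> var (GenT a) \<in> F0"
  by (auto intro!: free_algebra_var simp: YH_gens_def)

lemma rep_\<kappa>: "rep (\<kappa> c) = YH_scalar d n q c"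
  unfolding \<kappa>_def YH_scalar_def by (rule rep_cls[OF free_algebra_const])

lemma rep_g: "a \<in> {1..<n} \<Longrightarrow> rep (g a) = YH_g d n q a"
  unfolding g_def YH_g_def by (rule rep_cls[OF gen_F0(1)])

lemma rep_t: "a \<in> {1..n} \<Longrightarrow> rep (t a) = YH_t d n q a"
  unfolding t_def YH_t_def by (rule rep_cls[OF gen_F0(2)])

lemma YH_X_carrier: "a \<le> n \<Longrightarrow> YH_X d n q a \<in> carrier Y"
proof (induction a)
  case (Suc a)
  show ?case
  proof (cases a)
    case (Suc m)
    then have "a \<in> {1..<n}" using Suc.prems by auto
    then show ?thesis
      using Suc Suc.IH Suc.prems by (simp add: rep_\<kappa>[symmetric] rep_g[symmetric])
  qed simp
qed simp

lemma rep_X: "a \<le> n \<Longrightarrow> rep (X a) = YH_X d n q a"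
  unfolding X_def by (rule rep_unrep[OF YH_X_carrier])

lemma X_Suc_quotient:
  assumes a: "a \<in> {1..<n}"
  shows "X (a + 1) = \<kappa> (inverse q) * g a * X a * g a"
proof -
  obtain m where m: "a = Suc m" using a by (cases a) auto
  have a1: "a + 1 = Suc (Suc m)" and le: "Suc (Suc m) \<le> n" "Suc m \<le> n" using a m by auto
  have "rep (X (a + 1)) = YH_X d n q (Suc (Suc m))" unfolding a1 by (rule rep_X[OF le(1)])
  also have "\<dots> = rep (\<kappa> (inverse q) * g a * X a * g a)"
    using rep_X[OF le(2)] rep_g[OF a] m by (simp add: rep_mult rep_\<kappa>)
  finally show ?thesis by (simp only: rep_eq_iff)
qed

lemma \<kappa>_add: "\<kappa> (x + y) = \<kappa> x + \<kappa> y"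
  unfolding \<kappa>_def cls_add[OF free_algebra_const free_algebra_const, symmetric]
  by (simp add: const_def single_add)

lemma \<kappa>_mult: "\<kappa> (x * y) = \<kappa> x * \<kappa> y"
  unfolding \<kappa>_def cls_mult[OF free_algebra_const free_algebra_const, symmetric]
  by (simp add: const_def mult_single plus_list_def)

lemma \<kappa>_one: "\<kappa> 1 = 1"
  unfolding \<kappa>_def cls_one[symmetric] by (simp add: const_def zero_list_def[symmetric])

lemma d_unit: "of_nat d \<noteq> (0 :: 'k)"
proof
  assume "of_nat d = (0 :: 'k)"
  then have dvd: "CHAR('k) dvd d" by (simp add: of_nat_eq_0_iff_char_dvd)
  then have "CHAR('k) \<noteq> 0" using d_pos by (metis dvd_0_left_iff not_one_le_zero)
  then have "coprime d CHAR('k)" using d_char by simp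
  then have "CHAR('k) = 1" using dvd by (metis coprime_common_divisor_nat dvd_refl nat_dvd_1_iff_1)
  then show False using of_nat_CHAR[where 'a = 'k] by simp
qed

sublocale yh: yokonuma_hecke \<kappa> d n q \<xi> g t ee X
proof
  have cl: "p - r \<in> YH_relators d n q \<Longrightarrow> p \<in> F0 \<Longrightarrow> r \<in> F0 \<Longrightarrow> cls p = cls r" for p r
    using cls_eqI by blast
  note closed = free_algebra_add free_algebra_mult free_algebra_power free_algebra_sum free_algebra_const
    free_algebra_one gen_F0
  show "\<kappa> (x + y) = \<kappa> x + \<kappa> y" for x y
    by (rule \<kappa>_add)
  show "\<kappa> (x * y) = \<kappa> x * \<kappa> y" for x y
    by (rule \<kappa>_mult)
  show "\<kappa> 1 = 1" by (rule \<kappa>_one)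
  show "\<kappa> x * z = z * \<kappa> x" for x z
  proof -
    obtain p where "p \<in> F0" "z = cls p" using cls_surj by blast
    then show ?thesis
      unfolding \<kappa>_def using cls_mult[OF free_algebra_const] cls_mult[OF _ free_algebra_const] const_central by metis
  qed
  show "1 \<le> n" "1 \<le> d" "of_nat d \<noteq> (0 :: 'k)" "primitive_root_of_unity d \<xi>" "q \<noteq> 0" "q \<noteq> 1"
    by (fact n_pos d_pos d_unit \<xi> q)+
  show "t a ^ d = 1" if a: "a \<in> {1..n}" for a
  proof -
    have "cls (var (GenT a) ^ d) = cls 1"
      by (rule cl[OF YH_relators_intros(1)[OF a]]) (intro closed a)+
    then show ?thesis using a by (simp add: t_def cls_power gen_F0 cls_one)
  qed
  show "t a * t b = t b * t a" if ab: "a \<in> {1..n}" "b \<in> {1..n}" for a b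
  proof -
    have "cls (var (GenT a) * var (GenT b)) = cls (var (GenT b) * var (GenT a))"
      by (rule cl[OF YH_relators_intros(2)[OF ab]]) (intro closed ab)+
    then show ?thesis using ab by (simp add: t_def cls_mult gen_F0)
  qed
  show "t a * g b = g b * t (Transposition.transpose b (b + 1) a)" if ab: "a \<in> {1..n}" "b \<in> {1..<n}" for a b
  proof -
    let ?c = "Transposition.transpose b (b + 1) a"
    have c: "?c \<in> {1..n}" using ab by (auto simp: Transposition.transpose_def)
    have "cls (var (GenT a) * var (GenG b)) = cls (var (GenG b) * var (GenT ?c))"
      by (rule cl[OF YH_relators_intros(3)[OF ab]]) (intro closed ab c)+
    then show ?thesis using ab c by (simp add: t_def g_def cls_mult gen_F0)
  qed
  show "ee a = \<kappa> (inverse (of_nat d)) * (\<Sum>r<d. t a ^ r * t (a + 1) ^ (d - r))" for a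
    by (rule ee_def)
  show "g a * g a = \<kappa> q + \<kappa> (q - 1) * ee a * g a" if a: "a \<in> {1..<n}" for a
  proof -
    let ?e = "const (inverse (of_nat d)) * (\<Sum>r<d. var (GenT a) ^ r * var (GenT (a + 1)) ^ (d - r)) :: gen list \<Rightarrow>\<^sub>0 'k"
    have m: "a \<in> {1..n}" "a + 1 \<in> {1..n}" using a by auto
    have T: "var (GenT a) ^ r * var (GenT (a + 1)) ^ (d - r) \<in> F0" for r
      by (intro closed m)
    have e: "?e \<in> F0" by (intro closed m)
    have "cls (var (GenG a) ^ 2) = cls (const q + const (q - 1) * ?e * var (GenG a))"
      by (rule cl[OF YH_relators_intros(4)[OF a]]) (intro closed a e)+
    moreover have "cls ?e = ee a"
      unfolding ee_def \<kappa>_def t_def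
      by (simp add: cls_mult[OF free_algebra_const free_algebra_sum[OF T]] cls_sum[OF T] cls_mult
          cls_power free_algebra_power gen_F0(2)[OF m(1)] gen_F0(2)[OF m(2)])
    ultimately show ?thesis
      using a e by (simp add: cls_power cls_add cls_mult closed power2_eq_square \<kappa>_def g_def)
  qed
  show "g a * g (a + 1) * g a = g (a + 1) * g a * g (a + 1)" if a: "1 \<le> a" "a + 1 < n" for a
  proof -
    have "cls (var (GenG a) * var (GenG (a + 1)) * var (GenG a))
      = cls (var (GenG (a + 1)) * var (GenG a) * var (GenG (a + 1)))"
      by (rule cl[OF YH_relators_intros(5)]; (intro closed)?) (use a in auto)
    then show ?thesis using a by (simp add: g_def cls_mult closed)
  qed
  show "g a * g b = g b * g a" if a: "1 \<le> a" "a + 1 < b" "b < n" for a b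
  proof -
    have "cls (var (GenG a) * var (GenG b)) = cls (var (GenG b) * var (GenG a))"
      by (rule cl[OF YH_relators_intros(6)]; (intro closed)?) (use a in auto)
    then show ?thesis using a by (simp add: g_def cls_mult closed)
  qed
  show "X 1 = 1"
    using rep_X[of 1] n_pos by (simp add: rep_eq_iff[symmetric] rep_one One_nat_def)
  show "\<kappa> q * X (a + 1) = g a * X a * g a" if a: "a \<in> {1..<n}" for a
  proof -
    have "\<kappa> q * \<kappa> (inverse q) = 1" using q(1) by (simp add: \<kappa>_mult[symmetric] \<kappa>_one)
    then show ?thesis unfolding X_Suc_quotient[OF a] by (simp add: mult.assoc[symmetric])
  qed
qed

end

text \<open>
  The relations of \<open>\<Phi>\<^sub>a\<close> on an idempotent \<open>E\<close> at the label \<open>i\<close>, where \<open>E'\<close> is the image of \<open>E\<close> under the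
  transposition \<open>\<sigma>\<^sub>a\<close> and \<open>same\<close> tells which indices share a block.  Set partitions and ordered set
  partitions are two instances.
\<close>

definition block_relations ::
    "nat \<Rightarrow> nat \<Rightarrow> 'k::field \<Rightarrow> 'k \<Rightarrow> (nat \<Rightarrow> int) \<Rightarrow> nat \<Rightarrow> (nat \<Rightarrow> nat \<Rightarrow> bool) \<Rightarrow>
     (gen list \<Rightarrow>\<^sub>0 'k) set \<Rightarrow> (gen list \<Rightarrow>\<^sub>0 'k) set \<Rightarrow> bool" where
  "block_relations d n q \<xi> i a same E E' \<longleftrightarrow>
    (let Y = YH d n q; \<kappa> = YH_scalar d n q; X = YH_X d n q; \<Phi> = YH_Phi d n q \<xi>; eI = YH_eI d n q in
      \<Phi> a \<otimes>\<^bsub>Y\<^esub> E = E' \<otimes>\<^bsub>Y\<^esub> \<Phi> a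
      \<and>
      ((i a \<noteq> i (a + 1) \<and> same a (a + 1)) \<or> \<not> same a (a + 1) \<longrightarrow>
         \<Phi> a \<otimes>\<^bsub>Y\<^esub> X (a + 1) \<otimes>\<^bsub>Y\<^esub> E = X a \<otimes>\<^bsub>Y\<^esub> \<Phi> a \<otimes>\<^bsub>Y\<^esub> E)
      \<and>
      (i a = i (a + 1) \<and> same a (a + 1) \<longrightarrow>
         \<Phi> a \<otimes>\<^bsub>Y\<^esub> X (a + 1) \<otimes>\<^bsub>Y\<^esub> E =
           (X a \<otimes>\<^bsub>Y\<^esub> \<Phi> a \<oplus>\<^bsub>Y\<^esub> \<kappa> q \<otimes>\<^bsub>Y\<^esub> X (a + 1) \<ominus>\<^bsub>Y\<^esub> X a) \<otimes>\<^bsub>Y\<^esub> E)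
      \<and>
      ((i a \<noteq> i (a + 1) \<and> same a (a + 1)) \<or> \<not> same a (a + 1) \<longrightarrow>
         X (a + 1) \<otimes>\<^bsub>Y\<^esub> \<Phi> a \<otimes>\<^bsub>Y\<^esub> E = \<Phi> a \<otimes>\<^bsub>Y\<^esub> X a \<otimes>\<^bsub>Y\<^esub> E)
      \<and>
      (i a = i (a + 1) \<and> same a (a + 1) \<longrightarrow>
         X (a + 1) \<otimes>\<^bsub>Y\<^esub> \<Phi> a \<otimes>\<^bsub>Y\<^esub> E =
           (\<Phi> a \<otimes>\<^bsub>Y\<^esub> X a \<oplus>\<^bsub>Y\<^esub> \<kappa> q \<otimes>\<^bsub>Y\<^esub> X (a + 1) \<ominus>\<^bsub>Y\<^esub> X a) \<otimes>\<^bsub>Y\<^esub> E)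
      \<and>
      \<Phi> a [^]\<^bsub>Y\<^esub> (2::nat) \<otimes>\<^bsub>Y\<^esub> E =
        (if i a \<noteq> i (a + 1) \<and> same a (a + 1) then
           (\<kappa> q \<otimes>\<^bsub>Y\<^esub> X a \<ominus>\<^bsub>Y\<^esub> X (a + 1)) \<otimes>\<^bsub>Y\<^esub> (X a \<ominus>\<^bsub>Y\<^esub> \<kappa> q \<otimes>\<^bsub>Y\<^esub> X (a + 1)) \<otimes>\<^bsub>Y\<^esub>
             inv_on Y (eI i) ((X a \<ominus>\<^bsub>Y\<^esub> X (a + 1)) [^]\<^bsub>Y\<^esub> (2::nat)) E
         else if i a = i (a + 1) \<and> same a (a + 1) then
           \<kappa> (q + 1) \<otimes>\<^bsub>Y\<^esub> \<Phi> a \<otimes>\<^bsub>Y\<^esub> E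
         else \<kappa> q \<otimes>\<^bsub>Y\<^esub> E)
      \<and>
      (a + 2 \<le> n \<longrightarrow>
         \<Phi> a \<otimes>\<^bsub>Y\<^esub> \<Phi> (a + 1) \<otimes>\<^bsub>Y\<^esub> \<Phi> a \<otimes>\<^bsub>Y\<^esub> E =
           (if i a = i (a + 1) \<and> i (a + 1) = i (a + 2) \<and> same a (a + 1) \<and> same (a + 1) (a + 2) then
              (\<Phi> (a + 1) \<otimes>\<^bsub>Y\<^esub> \<Phi> a \<otimes>\<^bsub>Y\<^esub> \<Phi> (a + 1) \<oplus>\<^bsub>Y\<^esub> \<kappa> q \<otimes>\<^bsub>Y\<^esub> \<Phi> a
                 \<ominus>\<^bsub>Y\<^esub> \<kappa> q \<otimes>\<^bsub>Y\<^esub> \<Phi> (a + 1)) \<otimes>\<^bsub>Y\<^esub> E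
            else if i a = i (a + 2) \<and> i (a + 2) \<noteq> i (a + 1) \<and> same a (a + 1) \<and> same (a + 1) (a + 2) then
              \<Phi> (a + 1) \<otimes>\<^bsub>Y\<^esub> \<Phi> a \<otimes>\<^bsub>Y\<^esub> \<Phi> (a + 1) \<otimes>\<^bsub>Y\<^esub> E \<oplus>\<^bsub>Y\<^esub>
              \<kappa> ((1 - q)\<^sup>2) \<otimes>\<^bsub>Y\<^esub>
                (X a \<otimes>\<^bsub>Y\<^esub> X (a + 2) \<ominus>\<^bsub>Y\<^esub> X (a + 1) [^]\<^bsub>Y\<^esub> (2::nat)) \<otimes>\<^bsub>Y\<^esub>
                (X a \<otimes>\<^bsub>Y\<^esub> X (a + 1) \<ominus>\<^bsub>Y\<^esub> \<kappa> q \<otimes>\<^bsub>Y\<^esub> X (a + 1) \<otimes>\<^bsub>Y\<^esub> X (a + 2)) \<otimes>\<^bsub>Y\<^esub>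
                inv_on Y (eI i)
                  ((X a \<ominus>\<^bsub>Y\<^esub> X (a + 1)) [^]\<^bsub>Y\<^esub> (2::nat) \<otimes>\<^bsub>Y\<^esub>
                   (X (a + 1) \<ominus>\<^bsub>Y\<^esub> X (a + 2)) [^]\<^bsub>Y\<^esub> (2::nat)) E
            else \<Phi> (a + 1) \<otimes>\<^bsub>Y\<^esub> \<Phi> a \<otimes>\<^bsub>Y\<^esub> \<Phi> (a + 1) \<otimes>\<^bsub>Y\<^esub> E)))"

lemma same_block_image:
  assumes "bij s"
  shows "same_block ((`) s ` A) (s a) (s b) \<longleftrightarrow> same_block A a b"
  using assms by (auto simp: same_block_def inj_image_mem_iff bij_is_inj)

context YH_model
begin

lemma rep_eI: "YH_eI d n q = restrict (\<lambda>i. rep (yh.eI i)) (YH_I n q)"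
  unfolding YH_eI_def
proof (rule the_idempotents)
  show "yh.eI i * yh.eI i = yh.eI i" if "i \<in> YH_I n q" for i
    using yh.xspec.eigenidempotent_mult that by (simp add: yh.YH_I_eq)
  show "yh.eI i * yh.eI i' = 0" if "i \<in> YH_I n q" "i' \<in> YH_I n q" "i \<noteq> i'" for i i'
    using yh.xspec.eigenidempotent_mult that by (simp add: yh.YH_I_eq)
  show "finite {i \<in> YH_I n q. yh.eI i \<noteq> 0}" "sum yh.eI {i \<in> YH_I n q. yh.eI i \<noteq> 0} = 1"
    using yh.xspec.finite_spectrum yh.xspec.sum_eigenidempotent
    by (simp_all add: yh.xspec.spectrum_def yh.YH_I_eq)
  fix i assume i: "i \<in> YH_I n q"
  then have i': "i \<in> {1..n} \<rightarrow>\<^sub>E I_labels q" by (simp add: yh.YH_I_eq)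
  have nil: "(\<exists>N\<^sub>0::nat. \<forall>N\<ge>N\<^sub>0. (YH_X d n q a \<ominus>\<^bsub>Y\<^esub> YH_scalar d n q (q powi i a)) [^]\<^bsub>Y\<^esub> N \<otimes>\<^bsub>Y\<^esub> rep v = \<zero>\<^bsub>Y\<^esub>)
    \<longleftrightarrow> yh.X_eigen a (i a) v" if a: "a \<in> {1..n}" for a v
  proof -
    let ?x = "X a - \<kappa> (q powi i a)"
    have "YH_X d n q a \<ominus>\<^bsub>Y\<^esub> YH_scalar d n q (q powi i a) = rep ?x"
      using a by (simp add: rep_diff rep_X rep_\<kappa>)
    moreover have "rep ?x [^]\<^bsub>Y\<^esub> N \<otimes>\<^bsub>Y\<^esub> rep v = \<zero>\<^bsub>Y\<^esub> \<longleftrightarrow> ?x ^ N * v = 0" for N :: nat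
      by (simp add: rep_power[symmetric] rep_mult[symmetric] rep_eq_zero_iff)
    ultimately have "(\<exists>N\<^sub>0::nat. \<forall>N\<ge>N\<^sub>0. (YH_X d n q a \<ominus>\<^bsub>Y\<^esub> YH_scalar d n q (q powi i a)) [^]\<^bsub>Y\<^esub> N \<otimes>\<^bsub>Y\<^esub> rep v
         = \<zero>\<^bsub>Y\<^esub>) \<longleftrightarrow> (\<exists>N\<^sub>0::nat. \<forall>N\<ge>N\<^sub>0. ?x ^ N * v = 0)" by (simp only:)
    moreover have "?x ^ N * v = 0" if "?x ^ N\<^sub>0 * v = 0" "N\<^sub>0 \<le> N" for N\<^sub>0 N
    proof -
      have "?x ^ N * v = ?x ^ (N - N\<^sub>0) * (?x ^ N\<^sub>0 * v)"
        using that(2) by (simp add: mult.assoc[symmetric] power_add[symmetric])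
      then show ?thesis using that(1) by simp
    qed
    ultimately show ?thesis unfolding yh.X_eigen_def by blast
  qed
  show "rep (yh.eI i) <#\<^bsub>Y\<^esub> carrier Y = {x \<in> carrier Y. \<forall>a\<in>{1..n}. \<exists>N\<^sub>0::nat. \<forall>N\<ge>N\<^sub>0.
       (YH_X d n q a \<ominus>\<^bsub>Y\<^esub> YH_scalar d n q (q powi i a)) [^]\<^bsub>Y\<^esub> N \<otimes>\<^bsub>Y\<^esub> x = \<zero>\<^bsub>Y\<^esub>}"
  proof (rule principal_right_ideal_eq)
    show "yh.eI i * yh.eI i = yh.eI i" using yh.xspec.eigenidempotent_mult[OF i' i'] by simp
    show "yh.eI i * v = v \<longleftrightarrow> (\<forall>a\<in>{1..n}. \<exists>N\<^sub>0::nat. \<forall>N\<ge>N\<^sub>0.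
       (YH_X d n q a \<ominus>\<^bsub>Y\<^esub> YH_scalar d n q (q powi i a)) [^]\<^bsub>Y\<^esub> N \<otimes>\<^bsub>Y\<^esub> rep v = \<zero>\<^bsub>Y\<^esub>)" for v
      using yh.xspec.joint_eigen_iff[OF i', of v] nil by (simp add: yh.xspec.joint_eigen_def)
  qed
qed

lemma rep_eJ: "YH_eJ d n q \<xi> = restrict (\<lambda>j. rep (yh.eJ j)) (YH_J d n)"
  unfolding YH_eJ_def
proof (rule the_idempotents)
  show "yh.eJ j * yh.eJ j = yh.eJ j" if "j \<in> YH_J d n" for j
    using yh.tspec.eigenidempotent_mult that by (simp add: yh.YH_J_eq)
  show "yh.eJ j * yh.eJ j' = 0" if "j \<in> YH_J d n" "j' \<in> YH_J d n" "j \<noteq> j'" for j j'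
    using yh.tspec.eigenidempotent_mult that by (simp add: yh.YH_J_eq)
  show "finite {j \<in> YH_J d n. yh.eJ j \<noteq> 0}" "sum yh.eJ {j \<in> YH_J d n. yh.eJ j \<noteq> 0} = 1"
    using yh.tspec.finite_spectrum yh.tspec.sum_eigenidempotent
    by (simp_all add: yh.tspec.spectrum_def yh.YH_J_eq)
  fix j assume j: "j \<in> YH_J d n"
  then have j': "j \<in> {1..n} \<rightarrow>\<^sub>E {1..d}" by (simp add: yh.YH_J_eq)
  have eig: "YH_t d n q a \<otimes>\<^bsub>Y\<^esub> rep v = YH_scalar d n q (\<xi> ^ j a) \<otimes>\<^bsub>Y\<^esub> rep v \<longleftrightarrow> yh.t_eigen a (j a) v"
    if a: "a \<in> {1..n}" for a v
    unfolding rep_t[OF a, symmetric] rep_\<kappa>[symmetric] rep_mult[symmetric] rep_eq_iff by (simp add: yh.t_eigen_def)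
  show "rep (yh.eJ j) <#\<^bsub>Y\<^esub> carrier Y = {x \<in> carrier Y. \<forall>a\<in>{1..n}.
       YH_t d n q a \<otimes>\<^bsub>Y\<^esub> x = YH_scalar d n q (\<xi> ^ j a) \<otimes>\<^bsub>Y\<^esub> x}"
  proof (rule principal_right_ideal_eq)
    show "yh.eJ j * yh.eJ j = yh.eJ j" using yh.tspec.eigenidempotent_mult[OF j' j'] by simp
    show "yh.eJ j * v = v \<longleftrightarrow> (\<forall>a\<in>{1..n}. YH_t d n q a \<otimes>\<^bsub>Y\<^esub> rep v = YH_scalar d n q (\<xi> ^ j a) \<otimes>\<^bsub>Y\<^esub> rep v)" for v
      using yh.tspec.joint_eigen_iff[OF j', of v] eig by (simp add: yh.tspec.joint_eigen_def)
  qed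
qed

lemma rep_sum_eJ: "S \<subseteq> YH_J d n \<Longrightarrow> finsum Y (YH_eJ d n q \<xi>) S = rep (sum yh.eJ S)"
  by (rule finsum_rep) (auto simp: rep_eJ intro: finite_subset[OF _ yh.finite_YH_J])

lemma rep_ePar: "YH_ePar d n q \<xi> A = rep (yh.ePar A)"
  unfolding YH_ePar_def yh.ePar_def by (rule rep_sum_eJ) auto

lemma rep_inv_on_eigen:
  assumes i: "i \<in> YH_I n q" and v: "yh.inverts i v r" and y: "yh.xspec.joint_eigen i y"
  shows "inv_on Y (YH_eI d n q i) (rep v) (rep y) = rep (r * y)"
proof -
  have i': "i \<in> {1..n} \<rightarrow>\<^sub>E I_labels q" using i by (simp add: yh.YH_I_eq)
  have r: "r \<in> bicommutant (X ` {1..n})" using v by (simp add: yh.inverts_def)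
  have "inv_on Y (rep (yh.eI i)) (rep v) (rep y) = rep (r * y)"
  proof (rule rep_inv_on)
    show "r * (v * (yh.eI i * z)) = yh.eI i * z" for z
      using v yh.eigen_idempotent[OF i] by (simp add: yh.inverts_def)
    show "yh.eI i * (r * y) = r * y"
      using yh.xspec.eigenidempotent_fixes[OF i' yh.xspec.joint_eigen_left[OF y r]] .
    show "v * (r * y) = y" by (rule yh.inverts_right[OF v y])
  qed
  then show ?thesis using i by (simp add: rep_eI)
qed

lemma rep_eIPar: "i \<in> YH_I n q \<Longrightarrow> YH_eIPar d n q \<xi> i A = rep (yh.eI i * yh.ePar A)"
  by (simp add: YH_eIPar_def rep_eI rep_ePar rep_mult)

lemma rep_\<Phi>:
  assumes a: "1 \<le> a" "a < n"
  shows "YH_Phi d n q \<xi> a = rep (yh.\<Phi> a)"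
proof -
  have mem: "a \<in> {1..<n}" "a \<in> {1..n}" "a + 1 \<in> {1..n}" using a by auto
  let ?T1 = "{(i, A). i \<in> YH_I n q \<and> A \<in> SetPar n \<and> i a \<noteq> i (a + 1) \<and> same_block A a (a + 1)}"
  let ?T2 = "{(i, A). i \<in> YH_I n q \<and> A \<in> SetPar n \<and> i a = i (a + 1) \<and> same_block A a (a + 1)}"
  obtain z where z: "X (a + 1) * z = 1" "z * X (a + 1) = 1" using yh.X_invertible[OF mem(3)] by blast
  have v: "\<one>\<^bsub>Y\<^esub> \<ominus>\<^bsub>Y\<^esub> YH_X d n q a \<otimes>\<^bsub>Y\<^esub> inv\<^bsub>Y\<^esub> YH_X d n q (a + 1) = rep (1 - X a * z)"
    using rep_X[of a] rep_X[of "a + 1"] rep_inv[OF z] a by (simp add: rep_diff rep_mult rep_one)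
  have "gfinsum Y (\<lambda>(i, A). inv_on Y (YH_eI d n q i) (\<one>\<^bsub>Y\<^esub> \<ominus>\<^bsub>Y\<^esub> YH_X d n q a \<otimes>\<^bsub>Y\<^esub> inv\<^bsub>Y\<^esub> YH_X d n q (a + 1))
      (YH_eIPar d n q \<xi> i A)) ?T1
    = rep (yh.support_sum (\<lambda>(i, A). - (X (a + 1) * yh.R a (a + 1)) * (yh.eI i * yh.ePar A)) ?T1)"
    unfolding yh.support_sum_def
  proof (rule gfinsum_rep)
    fix s assume s: "s \<in> ?T1"
    obtain i A where iA: "s = (i, A)" by force
    have i: "i \<in> YH_I n q" "i a \<noteq> i (a + 1)" using s iA by auto
    show "(case s of (i, A) \<Rightarrow> inv_on Y (YH_eI d n q i) (\<one>\<^bsub>Y\<^esub> \<ominus>\<^bsub>Y\<^esub> YH_X d n q a \<otimes>\<^bsub>Y\<^esub> inv\<^bsub>Y\<^esub> YH_X d n q (a + 1))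
        (YH_eIPar d n q \<xi> i A)) = rep (case s of (i, A) \<Rightarrow> - (X (a + 1) * yh.R a (a + 1)) * (yh.eI i * yh.ePar A))"
      unfolding iA prod.case v rep_eIPar[OF i(1)]
      by (rule rep_inv_on_eigen[OF i(1) yh.inverts_quotient[OF mem(2,3) i z] yh.eigen_idempotent[OF i(1)]])
  qed
  moreover have "gfinsum Y (\<lambda>(i, A). YH_eIPar d n q \<xi> i A) ?T2
    = rep (yh.support_sum (\<lambda>(i, A). yh.eI i * yh.ePar A) ?T2)"
    unfolding yh.support_sum_def by (rule gfinsum_rep) (auto simp: rep_eIPar)
  ultimately show ?thesis
    unfolding YH_Phi_def yh.\<Phi>_def by (simp only: rep_add rep_mult rep_\<kappa> rep_g[OF mem(1)])
qed

text \<open>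
  Both kinds of idempotents are sums of \<open>e(j)\<close> over labels \<open>j\<close> with a prescribed pattern of equalities,
  and only this pattern enters the relations.
\<close>

lemma block_relations_sum:
  assumes i: "i \<in> YH_I n q" and a: "1 \<le> a" "a < n" and S: "S \<subseteq> YH_J d n"
    and same: "\<And>j b c. j \<in> S \<Longrightarrow> b \<in> {1..n} \<Longrightarrow> c \<in> {1..n} \<Longrightarrow> j b = j c \<longleftrightarrow> same b c"
  shows "block_relations d n q \<xi> i a same (rep (yh.eI i * sum yh.eJ S))
    (rep (yh.eI (i \<circ> yh.\<sigma> a) * sum yh.eJ ((\<lambda>j. j \<circ> yh.\<sigma> a) ` S)))"
proof -
  interpret b: intertwiner_block \<kappa> d n q \<xi> g t ee X i a S same
    by unfold_locales (use assms in auto)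
  note mem = b.a_mem
  have le: "a \<le> n" "a + 1 \<le> n" using a by auto
  note XX = rep_X[OF le(1), symmetric] rep_X[OF le(2), symmetric]
  note conv = rep_mult[symmetric] rep_add[symmetric] rep_diff[symmetric] rep_power[symmetric] rep_\<kappa>[symmetric]
    rep_eq_iff
  have E: "yh.xspec.joint_eigen i (yh.eI i * sum yh.eJ S)" by (rule yh.eigen_idempotent[OF i])
  have sq: "yh.inverts i ((X a - X (a + 1)) ^ 2) (yh.R a (a + 1) * yh.R a (a + 1))" if "i a \<noteq> i (a + 1)"
    unfolding power2_eq_square by (intro yh.inverts_mult yh.inverts_difference mem i that)
  have Z: "YH_X d n q (a + 2) = rep (X (a + 2))"
    "i (a + 2) \<noteq> i (a + 1) \<Longrightarrow> i a = i (a + 2) \<Longrightarrow>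
      yh.inverts i ((X a - X (a + 1)) ^ 2 * (X (a + 1) - X (a + 2)) ^ 2)
        (yh.R a (a + 1) * yh.R a (a + 1) * (yh.R (a + 1) (a + 2) * yh.R (a + 1) (a + 2)))"
    "YH_Phi d n q \<xi> (a + 1) = rep (yh.\<Phi> (a + 1))"
    if "a + 2 \<le> n"
  proof -
    have m: "a + 2 \<in> {1..n}" using that by simp
    show "YH_X d n q (a + 2) = rep (X (a + 2))" using rep_X[OF that] by simp
    show "yh.inverts i ((X a - X (a + 1)) ^ 2 * (X (a + 1) - X (a + 2)) ^ 2)
        (yh.R a (a + 1) * yh.R a (a + 1) * (yh.R (a + 1) (a + 2) * yh.R (a + 1) (a + 2)))"
      if "i (a + 2) \<noteq> i (a + 1)" "i a = i (a + 2)"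
      unfolding power2_eq_square
      by (intro yh.inverts_mult yh.inverts_difference mem m i) (use that in auto)
    show "YH_Phi d n q \<xi> (a + 1) = rep (yh.\<Phi> (a + 1))" using that by (intro rep_\<Phi>) auto
  qed
  have "YH_Phi d n q \<xi> a \<otimes>\<^bsub>Y\<^esub> rep b.E
      = rep (yh.eI (i \<circ> yh.\<sigma> a) * sum yh.eJ ((\<lambda>j. j \<circ> yh.\<sigma> a) ` S)) \<otimes>\<^bsub>Y\<^esub> YH_Phi d n q \<xi> a"
    unfolding rep_\<Phi>[OF a] conv by (rule yh.\<Phi>_permutes_idempotents[OF a i S])
  moreover have "YH_Phi d n q \<xi> a [^]\<^bsub>Y\<^esub> (2::nat) \<otimes>\<^bsub>Y\<^esub> rep b.E =
        (if i a \<noteq> i (a + 1) \<and> same a (a + 1) then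
           (YH_scalar d n q q \<otimes>\<^bsub>Y\<^esub> YH_X d n q a \<ominus>\<^bsub>Y\<^esub> YH_X d n q (a + 1)) \<otimes>\<^bsub>Y\<^esub>
           (YH_X d n q a \<ominus>\<^bsub>Y\<^esub> YH_scalar d n q q \<otimes>\<^bsub>Y\<^esub> YH_X d n q (a + 1)) \<otimes>\<^bsub>Y\<^esub>
             inv_on Y (YH_eI d n q i) ((YH_X d n q a \<ominus>\<^bsub>Y\<^esub> YH_X d n q (a + 1)) [^]\<^bsub>Y\<^esub> (2::nat)) (rep b.E)
         else if i a = i (a + 1) \<and> same a (a + 1) then
           YH_scalar d n q (q + 1) \<otimes>\<^bsub>Y\<^esub> YH_Phi d n q \<xi> a \<otimes>\<^bsub>Y\<^esub> rep b.E
         else YH_scalar d n q q \<otimes>\<^bsub>Y\<^esub> rep b.E)"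
    using b.\<Phi>_square_E unfolding rep_\<Phi>[OF a] XX conv
    by (simp add: rep_inv_on_eigen[OF i sq E] conv)
  moreover have "YH_Phi d n q \<xi> a \<otimes>\<^bsub>Y\<^esub> YH_Phi d n q \<xi> (a + 1) \<otimes>\<^bsub>Y\<^esub> YH_Phi d n q \<xi> a \<otimes>\<^bsub>Y\<^esub> rep b.E =
           (if i a = i (a + 1) \<and> i (a + 1) = i (a + 2) \<and> same a (a + 1) \<and> same (a + 1) (a + 2) then
              (YH_Phi d n q \<xi> (a + 1) \<otimes>\<^bsub>Y\<^esub> YH_Phi d n q \<xi> a \<otimes>\<^bsub>Y\<^esub> YH_Phi d n q \<xi> (a + 1)
                 \<oplus>\<^bsub>Y\<^esub> YH_scalar d n q q \<otimes>\<^bsub>Y\<^esub> YH_Phi d n q \<xi> a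
                 \<ominus>\<^bsub>Y\<^esub> YH_scalar d n q q \<otimes>\<^bsub>Y\<^esub> YH_Phi d n q \<xi> (a + 1)) \<otimes>\<^bsub>Y\<^esub> rep b.E
            else if i a = i (a + 2) \<and> i (a + 2) \<noteq> i (a + 1) \<and> same a (a + 1) \<and> same (a + 1) (a + 2) then
              YH_Phi d n q \<xi> (a + 1) \<otimes>\<^bsub>Y\<^esub> YH_Phi d n q \<xi> a \<otimes>\<^bsub>Y\<^esub> YH_Phi d n q \<xi> (a + 1) \<otimes>\<^bsub>Y\<^esub> rep b.E \<oplus>\<^bsub>Y\<^esub>
              YH_scalar d n q ((1 - q)\<^sup>2) \<otimes>\<^bsub>Y\<^esub>
                (YH_X d n q a \<otimes>\<^bsub>Y\<^esub> YH_X d n q (a + 2) \<ominus>\<^bsub>Y\<^esub> YH_X d n q (a + 1) [^]\<^bsub>Y\<^esub> (2::nat)) \<otimes>\<^bsub>Y\<^esub>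
                (YH_X d n q a \<otimes>\<^bsub>Y\<^esub> YH_X d n q (a + 1)
                   \<ominus>\<^bsub>Y\<^esub> YH_scalar d n q q \<otimes>\<^bsub>Y\<^esub> YH_X d n q (a + 1) \<otimes>\<^bsub>Y\<^esub> YH_X d n q (a + 2)) \<otimes>\<^bsub>Y\<^esub>
                inv_on Y (YH_eI d n q i)
                  ((YH_X d n q a \<ominus>\<^bsub>Y\<^esub> YH_X d n q (a + 1)) [^]\<^bsub>Y\<^esub> (2::nat) \<otimes>\<^bsub>Y\<^esub>
                   (YH_X d n q (a + 1) \<ominus>\<^bsub>Y\<^esub> YH_X d n q (a + 2)) [^]\<^bsub>Y\<^esub> (2::nat)) (rep b.E)
            else YH_Phi d n q \<xi> (a + 1) \<otimes>\<^bsub>Y\<^esub> YH_Phi d n q \<xi> a \<otimes>\<^bsub>Y\<^esub> YH_Phi d n q \<xi> (a + 1) \<otimes>\<^bsub>Y\<^esub> rep b.E)"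
    if a2: "a + 2 \<le> n"
  proof -
    note inv = rep_inv_on_eigen[OF i Z(2)[OF a2] E]
    show ?thesis
      using b.braid_E[OF a2] unfolding rep_\<Phi>[OF a] Z(3)[OF a2] XX Z(1)[OF a2] conv
      by (simp add: inv conv del: add_2_eq_Suc')
  qed
  moreover have "YH_Phi d n q \<xi> a \<otimes>\<^bsub>Y\<^esub> YH_X d n q (a + 1) \<otimes>\<^bsub>Y\<^esub> rep b.E =
      (if i a = i (a + 1) \<and> same a (a + 1)
       then (YH_X d n q a \<otimes>\<^bsub>Y\<^esub> YH_Phi d n q \<xi> a \<oplus>\<^bsub>Y\<^esub> YH_scalar d n q q \<otimes>\<^bsub>Y\<^esub> YH_X d n q (a + 1)
          \<ominus>\<^bsub>Y\<^esub> YH_X d n q a) \<otimes>\<^bsub>Y\<^esub> rep b.E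
       else YH_X d n q a \<otimes>\<^bsub>Y\<^esub> YH_Phi d n q \<xi> a \<otimes>\<^bsub>Y\<^esub> rep b.E)"
    using b.\<Phi>_X_E unfolding rep_\<Phi>[OF a] XX conv by (simp add: conv)
  moreover have "YH_X d n q (a + 1) \<otimes>\<^bsub>Y\<^esub> YH_Phi d n q \<xi> a \<otimes>\<^bsub>Y\<^esub> rep b.E =
      (if i a = i (a + 1) \<and> same a (a + 1)
       then (YH_Phi d n q \<xi> a \<otimes>\<^bsub>Y\<^esub> YH_X d n q a \<oplus>\<^bsub>Y\<^esub> YH_scalar d n q q \<otimes>\<^bsub>Y\<^esub> YH_X d n q (a + 1)
          \<ominus>\<^bsub>Y\<^esub> YH_X d n q a) \<otimes>\<^bsub>Y\<^esub> rep b.E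
       else YH_Phi d n q \<xi> a \<otimes>\<^bsub>Y\<^esub> YH_X d n q a \<otimes>\<^bsub>Y\<^esub> rep b.E)"
    using b.X_\<Phi>_E unfolding rep_\<Phi>[OF a] XX conv by (simp add: conv)
  ultimately show ?thesis
    unfolding block_relations_def Let_def by presburger
qed

lemma image_comp_transpose:
  assumes a: "1 \<le> a" "a < n" and P: "\<And>j. j \<in> YH_J d n \<Longrightarrow> P' (j \<circ> yh.\<sigma> a) \<longleftrightarrow> P j"
  shows "(\<lambda>j. j \<circ> yh.\<sigma> a) ` {j \<in> YH_J d n. P j} = {j \<in> YH_J d n. P' j}"
proof -
  have J: "j \<circ> yh.\<sigma> a \<in> YH_J d n" if "j \<in> YH_J d n" for j
    using yh.\<sigma>_YH_J[of a j] that a by simp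
  have "j \<in> (\<lambda>j. j \<circ> yh.\<sigma> a) ` {j \<in> YH_J d n. P j}" if "j \<in> YH_J d n" "P' j" for j
  proof (rule image_eqI)
    show "j = (j \<circ> yh.\<sigma> a) \<circ> yh.\<sigma> a" by (simp only: yh.\<sigma>_\<sigma>)
    show "j \<circ> yh.\<sigma> a \<in> {j \<in> YH_J d n. P j}" using that J P[OF J[OF that(1)]] by (simp add: yh.\<sigma>_\<sigma>)
  qed
  then show ?thesis using J P by auto
qed

lemma block_relations_Par:
  assumes i: "i \<in> YH_I n q" and a: "1 \<le> a" "a < n"
  shows "block_relations d n q \<xi> i a (same_block A) (YH_eIPar d n q \<xi> i A)
    (YH_eIPar d n q \<xi> (i \<circ> yh.\<sigma> a) ((`) (yh.\<sigma> a) ` A))"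
proof -
  let ?P = "\<lambda>A j. \<forall>x\<in>{1..n}. \<forall>y\<in>{1..n}. j x = j y \<longleftrightarrow> same_block A x y"
  have s: "yh.\<sigma> a x \<in> {1..n} \<longleftrightarrow> x \<in> {1..n}" for x
    using a by (auto simp: Transposition.transpose_def)
  have "?P ((`) (yh.\<sigma> a) ` A) (j \<circ> yh.\<sigma> a) \<longleftrightarrow> ?P A j" for j
  proof -
    have blk: "same_block ((`) (yh.\<sigma> a) ` A) x y \<longleftrightarrow> same_block A (yh.\<sigma> a x) (yh.\<sigma> a y)" for x y
      using same_block_image[OF bij_transpose, of a "a + 1" A "yh.\<sigma> a x" "yh.\<sigma> a y"] by simp
    show ?thesis unfolding blk comp_apply by (metis s transpose_involutory)
  qed
  then have img: "(\<lambda>j. j \<circ> yh.\<sigma> a) ` {j \<in> YH_J d n. ?P A j} = {j \<in> YH_J d n. ?P ((`) (yh.\<sigma> a) ` A) j}"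
    by (intro image_comp_transpose[OF a])
  have i': "i \<circ> yh.\<sigma> a \<in> YH_I n q" using yh.\<sigma>_YH_I[of a i] i a by simp
  show ?thesis
    unfolding rep_eIPar[OF i] rep_eIPar[OF i'] yh.ePar_def img[symmetric]
    by (rule block_relations_sum[OF i a]) auto
qed

abbreviation colour_classes :: "(nat \<Rightarrow> nat) \<Rightarrow> nat set list" where
  "colour_classes j \<equiv> filter (\<lambda>B. B \<noteq> {}) (map (\<lambda>c. {a\<in>{1..n}. j a = c}) [1..<d + 1])"

lemma block_relations_Ord:
  assumes i: "i \<in> YH_I n q" and a: "1 \<le> a" "a < n"
  shows "block_relations d n q \<xi> i a (same_block (set As)) (YH_eIOrd d n q \<xi> i As)
    (YH_eIOrd d n q \<xi> (i \<circ> yh.\<sigma> a) (map ((`) (yh.\<sigma> a)) As))"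
proof -
  have inj: "inj (yh.\<sigma> a)" by (rule inj_transpose)
  have s: "yh.\<sigma> a x \<in> {1..n} \<longleftrightarrow> x \<in> {1..n}" for x
    using a by (auto simp: Transposition.transpose_def)
  have cls: "colour_classes (j \<circ> yh.\<sigma> a) = map ((`) (yh.\<sigma> a)) (colour_classes j)" for j
  proof -
    have "{x \<in> {1..n}. (j \<circ> yh.\<sigma> a) x = c} = yh.\<sigma> a ` {x \<in> {1..n}. j x = c}" for c
    proof (rule Set.set_eqI)
      fix x
      have "x \<in> yh.\<sigma> a ` {x \<in> {1..n}. j x = c} \<longleftrightarrow> yh.\<sigma> a x \<in> {x \<in> {1..n}. j x = c}"
        by (metis (no_types, lifting) image_iff transpose_involutory)
      then show "x \<in> {x \<in> {1..n}. (j \<circ> yh.\<sigma> a) x = c} \<longleftrightarrow> x \<in> yh.\<sigma> a ` {x \<in> {1..n}. j x = c}"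
        by (simp only: mem_Collect_eq comp_apply s)
    qed
    then show ?thesis by (simp add: filter_map comp_def)
  qed
  have "colour_classes (j \<circ> yh.\<sigma> a) = map ((`) (yh.\<sigma> a)) As \<longleftrightarrow> colour_classes j = As" for j
    unfolding cls using inj by (intro inj_map_eq_map) (auto intro!: injI simp: inj_image_eq_iff)
  then have img: "(\<lambda>j. j \<circ> yh.\<sigma> a) ` {j \<in> YH_J d n. colour_classes j = As}
      = {j \<in> YH_J d n. colour_classes j = map ((`) (yh.\<sigma> a)) As}"
    by (intro image_comp_transpose[OF a])
  have Ord: "YH_eIOrd d n q \<xi> i' Bs = rep (yh.eI i' * sum yh.eJ {j \<in> YH_J d n. colour_classes j = Bs})"
    if "i' \<in> YH_I n q" for i' Bs
  proof -
    have "YH_eOrd d n q \<xi> Bs = rep (sum yh.eJ {j \<in> YH_J d n. colour_classes j = Bs})"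
      unfolding YH_eOrd_def by (rule rep_sum_eJ) auto
    then show ?thesis using that by (simp add: YH_eIOrd_def rep_eI rep_mult)
  qed
  have i': "i \<circ> yh.\<sigma> a \<in> YH_I n q" using yh.\<sigma>_YH_I[of a i] i a by simp
  show ?thesis
    unfolding Ord[OF i] Ord[OF i'] img[symmetric]
  proof (rule block_relations_sum[OF i a])
    fix j b c assume j: "j \<in> {j \<in> YH_J d n. colour_classes j = As}" and bc: "b \<in> {1..n}" "c \<in> {1..n}"
    have set_As: "set As = {B. B \<noteq> {} \<and> (\<exists>k\<in>{1..d}. B = {x \<in> {1..n}. j x = k})}"
    proof -
      have As: "As = colour_classes j" and up: "set [1..<d + 1] = {1..d}" using j by auto
      show ?thesis unfolding As set_filter set_map up by blast
    qed
    have jb: "j b \<in> {1..d}" using j bc by (auto simp: YH_J_def PiE_def Pi_def)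
    show "j b = j c \<longleftrightarrow> same_block (set As) b c"
    proof
      assume eq: "j b = j c"
      let ?B = "{x \<in> {1..n}. j x = j b}"
      have mem: "b \<in> ?B" "c \<in> ?B" using bc eq by simp_all
      then have "?B \<noteq> {}" by blast
      then have "?B \<in> set As" unfolding set_As using jb by (intro CollectI conjI bexI[of _ "j b"] refl)
      then show "same_block (set As) b c"
        unfolding same_block_def by (intro bexI[of _ ?B] conjI mem)
    next
      assume "same_block (set As) b c"
      then obtain k where "b \<in> {x \<in> {1..n}. j x = k}" "c \<in> {x \<in> {1..n}. j x = k}"
        unfolding same_block_def set_As by blast
      then show "j b = j c" by simp
    qed
  qed auto
qed

lemma Phi_X_commute:
  assumes a: "1 \<le> a" "a < n" and b: "1 \<le> b" "b \<le> n" "b \<noteq> a" "b \<noteq> a + 1"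
  shows "YH_Phi d n q \<xi> a \<otimes>\<^bsub>Y\<^esub> YH_X d n q b = YH_X d n q b \<otimes>\<^bsub>Y\<^esub> YH_Phi d n q \<xi> a"
  unfolding rep_\<Phi>[OF a] rep_X[OF b(2), symmetric] rep_mult[symmetric] rep_eq_iff
  by (rule yh.\<Phi>_X_commute) (use a b in auto)

lemma Phi_commute:
  assumes a: "1 \<le> a" "a < n" and b: "1 \<le> b" "b < n" "\<bar>int a - int b\<bar> > 1"
  shows "YH_Phi d n q \<xi> a \<otimes>\<^bsub>Y\<^esub> YH_Phi d n q \<xi> b = YH_Phi d n q \<xi> b \<otimes>\<^bsub>Y\<^esub> YH_Phi d n q \<xi> a"
  unfolding rep_\<Phi>[OF a] rep_\<Phi>[OF b(1,2)] rep_mult[symmetric] rep_eq_iff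
  by (rule yh.\<Phi>_commute[OF a b])

end

section \<open>A type for the Yokonuma--Hecke algebra\<close>

definition relations_hold :: "nat \<Rightarrow> nat \<Rightarrow> 'k::field \<Rightarrow> bool" where
  "relations_hold d n q \<longleftrightarrow> (\<forall>\<xi> i a.
     1 \<le> n \<and> 1 \<le> d \<and> (CHAR('k) = 0 \<or> coprime d CHAR('k)) \<and> primitive_root_of_unity d \<xi> \<and> q \<noteq> 0 \<and> q \<noteq> 1 \<and>
     i \<in> YH_I n q \<and> 1 \<le> a \<and> a < n \<longrightarrow>
     (\<forall>b. 1 \<le> b \<and> b \<le> n \<and> b \<noteq> a \<and> b \<noteq> a + 1 \<longrightarrow>
        YH_Phi d n q \<xi> a \<otimes>\<^bsub>YH d n q\<^esub> YH_X d n q b = YH_X d n q b \<otimes>\<^bsub>YH d n q\<^esub> YH_Phi d n q \<xi> a) \<and>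
     (\<forall>b. 1 \<le> b \<and> b < n \<and> \<bar>int a - int b\<bar> > 1 \<longrightarrow>
        YH_Phi d n q \<xi> a \<otimes>\<^bsub>YH d n q\<^esub> YH_Phi d n q \<xi> b = YH_Phi d n q \<xi> b \<otimes>\<^bsub>YH d n q\<^esub> YH_Phi d n q \<xi> a) \<and>
     (\<forall>A\<in>SetPar n. block_relations d n q \<xi> i a (same_block A) (YH_eIPar d n q \<xi> i A)
        (YH_eIPar d n q \<xi> (i \<circ> Transposition.transpose a (a + 1)) ((`) (Transposition.transpose a (a + 1)) ` A))) \<and>
     (\<forall>As\<in>OrdSetPar n. block_relations d n q \<xi> i a (same_block (set As)) (YH_eIOrd d n q \<xi> i As)
        (YH_eIOrd d n q \<xi> (i \<circ> Transposition.transpose a (a + 1)) (map ((`) (Transposition.transpose a (a + 1))) As))))"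

lemma relations_hold_if_model:
  fixes rep :: "'a::{ring,monoid_mult} \<Rightarrow> (gen list \<Rightarrow>\<^sub>0 'k::field) set"
  assumes "ring_representation (YH d n q) rep"
  shows "relations_hold d n q"
  unfolding relations_hold_def
  by (intro allI impI conjI ballI YH_model.Phi_X_commute[of d n q rep] YH_model.Phi_commute[of d n q rep]
      YH_model.block_relations_Par[of d n q rep] YH_model.block_relations_Ord[of d n q rep]
      YH_model.intro YH_model_axioms.intro assms; elim conjE; assumption)

text \<open>
  Parameters violating the relations if there are any: the relations then hold for all parameters as
  soon as they hold for these.
\<close>

definition critical_parameters :: "nat \<times> nat \<times> 'k::field" where
  "critical_parameters = (SOME p. \<not> relations_hold (fst p) (fst (snd p)) (snd (snd p)))"

abbreviation critical_YH :: "(gen list \<Rightarrow>\<^sub>0 'k::field) set ring" where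
  "critical_YH \<equiv> YH (fst (critical_parameters :: nat \<times> nat \<times> 'k)) (fst (snd (critical_parameters :: nat \<times> nat \<times> 'k)))
     (snd (snd critical_parameters))"

lemma relations_hold_if_critical:
  assumes "relations_hold (fst (critical_parameters :: nat \<times> nat \<times> 'k)) (fst (snd (critical_parameters :: nat \<times> nat \<times> 'k)))
     (snd (snd critical_parameters) :: 'k::field)"
  shows "relations_hold d n (q :: 'k)"
proof (rule ccontr)
  let ?bad = "\<lambda>p :: nat \<times> nat \<times> 'k. \<not> relations_hold (fst p) (fst (snd p)) (snd (snd p))"
  assume "\<not> relations_hold d n q"
  then have "?bad (d, n, q)" by simp
  then have "?bad critical_parameters" unfolding critical_parameters_def by (rule someI[of ?bad])
  then show False using assms by blast
qed

lemma ring_critical_YH: "ring critical_YH"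
  by (rule ring_YH)

text \<open>
  The algebra at the critical parameters depends on the field only, and can thus be made a type.
\<close>

typedef (overloaded) ('k::field) yh_element = "carrier (critical_YH :: (gen list \<Rightarrow>\<^sub>0 'k) set ring)"
proof
  show "\<zero>\<^bsub>critical_YH\<^esub> \<in> carrier critical_YH" using ring.ring_simprules(2)[OF ring_critical_YH] .
qed

instantiation yh_element :: (field) ring
begin

definition "0 = Abs_yh_element \<zero>\<^bsub>critical_YH\<^esub>"
definition "x + y = Abs_yh_element (Rep_yh_element x \<oplus>\<^bsub>critical_YH\<^esub> Rep_yh_element y)"
definition "- x = Abs_yh_element (\<ominus>\<^bsub>critical_YH\<^esub> Rep_yh_element x)"
definition "x - y = Abs_yh_element (Rep_yh_element x \<ominus>\<^bsub>critical_YH\<^esub> Rep_yh_element y)"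
definition "x * y = Abs_yh_element (Rep_yh_element x \<otimes>\<^bsub>critical_YH\<^esub> Rep_yh_element y)"

instance
proof -
  interpret R: ring "critical_YH :: (gen list \<Rightarrow>\<^sub>0 'a) set ring" by (rule ring_critical_YH)
  note defs = zero_yh_element_def plus_yh_element_def uminus_yh_element_def minus_yh_element_def
    times_yh_element_def
  have c: "Rep_yh_element x \<in> carrier critical_YH" for x :: "'a yh_element" by (rule Rep_yh_element)
  show "OFCLASS('a yh_element, ring_class)"
    by standard
      (simp_all add: defs c Abs_yh_element_inverse Abs_yh_element_inject Rep_yh_element_inverse R.a_assoc R.a_comm
        R.a_lcomm R.m_assoc R.l_distr R.r_distr R.l_neg R.r_neg a_minus_def)
qed

end

instantiation yh_element :: (field) monoid_mult
begin

definition "1 = Abs_yh_element \<one>\<^bsub>critical_YH\<^esub>"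

instance
proof -
  interpret R: ring "critical_YH :: (gen list \<Rightarrow>\<^sub>0 'a) set ring" by (rule ring_critical_YH)
  have c: "Rep_yh_element x \<in> carrier critical_YH" for x :: "'a yh_element" by (rule Rep_yh_element)
  show "OFCLASS('a yh_element, monoid_mult_class)"
    by standard (simp_all add: one_yh_element_def times_yh_element_def c Abs_yh_element_inverse
        Rep_yh_element_inverse)
qed

end

lemma Rep_yh_element_representation:
  "ring_representation critical_YH (Rep_yh_element :: 'k::field yh_element \<Rightarrow> _)"
proof -
  interpret R: ring "critical_YH :: (gen list \<Rightarrow>\<^sub>0 'k) set ring" by (rule ring_critical_YH)
  have c: "Rep_yh_element x \<in> carrier critical_YH" for x :: "'k yh_element" by (rule Rep_yh_element)
  have range: "range (Rep_yh_element :: 'k yh_element \<Rightarrow> _) = carrier critical_YH"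
    by (rule type_definition.Rep_range[OF type_definition_yh_element])
  show ?thesis
    by unfold_locales (simp_all add: range inj_def Rep_yh_element_inject plus_yh_element_def times_yh_element_def
        one_yh_element_def Abs_yh_element_inverse c)
qed

lemma relations_hold_all: "relations_hold d n (q :: 'k::field)"
  by (rule relations_hold_if_critical[OF relations_hold_if_model[OF Rep_yh_element_representation]])

theorem theorem24:
  fixes n d :: nat and q \<xi> :: "'k::field"
    and i :: "nat \<Rightarrow> int" and a :: nat
    and Y (structure)
  assumes "1 \<le> n" and "1 \<le> d"
    and "CHAR('k) = 0 \<or> coprime d CHAR('k)"
    and "primitive_root_of_unity d \<xi>"
    and "q \<noteq> 0" and "q \<noteq> 1"
    and "i \<in> YH_I n q" and "1 \<le> a" and "a < n"
  defines "Y \<equiv> YH d n q"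
    and "\<kappa> \<equiv> YH_scalar d n q"
    and "X \<equiv> YH_X d n q"
    and "\<Phi> \<equiv> YH_Phi d n q \<xi>"
    and "eI \<equiv> YH_eI d n q"
    and "E \<equiv> YH_eIPar d n q \<xi>"
    and "E\<^sub>o \<equiv> YH_eIOrd d n q \<xi>"
    and "\<sigma> \<equiv> Transposition.transpose a (a + 1)"
  shows
   "(\<forall>b. 1 \<le> b \<and> b \<le> n \<and> b \<noteq> a \<and> b \<noteq> a + 1 \<longrightarrow> \<Phi> a \<otimes> X b = X b \<otimes> \<Phi> a)
    \<and>
    (\<forall>b. 1 \<le> b \<and> b < n \<and> \<bar>int a - int b\<bar> > 1 \<longrightarrow> \<Phi> a \<otimes> \<Phi> b = \<Phi> b \<otimes> \<Phi> a)
    \<and>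
    (\<forall>A \<in> SetPar n.
      \<Phi> a \<otimes> E i A = E (i \<circ> \<sigma>) ((`) \<sigma> ` A) \<otimes> \<Phi> a
      \<and>
      ((i a \<noteq> i (a + 1) \<and> same_block A a (a + 1)) \<or> \<not> same_block A a (a + 1) \<longrightarrow>
         \<Phi> a \<otimes> X (a + 1) \<otimes> E i A = X a \<otimes> \<Phi> a \<otimes> E i A)
      \<and>
      (i a = i (a + 1) \<and> same_block A a (a + 1) \<longrightarrow>
         \<Phi> a \<otimes> X (a + 1) \<otimes> E i A =
           (X a \<otimes> \<Phi> a \<oplus> \<kappa> q \<otimes> X (a + 1) \<ominus> X a) \<otimes> E i A)
      \<and>
      ((i a \<noteq> i (a + 1) \<and> same_block A a (a + 1)) \<or> \<not> same_block A a (a + 1) \<longrightarrow>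
         X (a + 1) \<otimes> \<Phi> a \<otimes> E i A = \<Phi> a \<otimes> X a \<otimes> E i A)
      \<and>
      (i a = i (a + 1) \<and> same_block A a (a + 1) \<longrightarrow>
         X (a + 1) \<otimes> \<Phi> a \<otimes> E i A =
           (\<Phi> a \<otimes> X a \<oplus> \<kappa> q \<otimes> X (a + 1) \<ominus> X a) \<otimes> E i A)
      \<and>
      \<Phi> a [^] (2::nat) \<otimes> E i A =
        (if i a \<noteq> i (a + 1) \<and> same_block A a (a + 1) then
           (\<kappa> q \<otimes> X a \<ominus> X (a + 1)) \<otimes> (X a \<ominus> \<kappa> q \<otimes> X (a + 1)) \<otimes>
             inv_on Y (eI i) ((X a \<ominus> X (a + 1)) [^] (2::nat)) (E i A)
         else if i a = i (a + 1) \<and> same_block A a (a + 1) then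
           \<kappa> (q + 1) \<otimes> \<Phi> a \<otimes> E i A
         else \<kappa> q \<otimes> E i A)
      \<and>
      (a + 2 \<le> n \<longrightarrow>
         \<Phi> a \<otimes> \<Phi> (a + 1) \<otimes> \<Phi> a \<otimes> E i A =
           (if i a = i (a + 1) \<and> i (a + 1) = i (a + 2) \<and>
               same_block A a (a + 1) \<and> same_block A (a + 1) (a + 2) then
              (\<Phi> (a + 1) \<otimes> \<Phi> a \<otimes> \<Phi> (a + 1) \<oplus> \<kappa> q \<otimes> \<Phi> a \<ominus> \<kappa> q \<otimes> \<Phi> (a + 1)) \<otimes> E i A
            else if i a = i (a + 2) \<and> i (a + 2) \<noteq> i (a + 1) \<and>
               same_block A a (a + 1) \<and> same_block A (a + 1) (a + 2) then
              \<Phi> (a + 1) \<otimes> \<Phi> a \<otimes> \<Phi> (a + 1) \<otimes> E i A \<oplus>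
              \<kappa> ((1 - q)\<^sup>2) \<otimes>
                (X a \<otimes> X (a + 2) \<ominus> X (a + 1) [^] (2::nat)) \<otimes>
                (X a \<otimes> X (a + 1) \<ominus> \<kappa> q \<otimes> X (a + 1) \<otimes> X (a + 2)) \<otimes>
                inv_on Y (eI i)
                  ((X a \<ominus> X (a + 1)) [^] (2::nat) \<otimes> (X (a + 1) \<ominus> X (a + 2)) [^] (2::nat)) (E i A)
            else \<Phi> (a + 1) \<otimes> \<Phi> a \<otimes> \<Phi> (a + 1) \<otimes> E i A)))
    \<and>
    (\<forall>As \<in> OrdSetPar n.
      \<Phi> a \<otimes> E\<^sub>o i As = E\<^sub>o (i \<circ> \<sigma>) (map ((`) \<sigma>) As) \<otimes> \<Phi> a
      \<and>
      ((i a \<noteq> i (a + 1) \<and> same_block (set As) a (a + 1)) \<or> \<not> same_block (set As) a (a + 1) \<longrightarrow>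
         \<Phi> a \<otimes> X (a + 1) \<otimes> E\<^sub>o i As = X a \<otimes> \<Phi> a \<otimes> E\<^sub>o i As)
      \<and>
      (i a = i (a + 1) \<and> same_block (set As) a (a + 1) \<longrightarrow>
         \<Phi> a \<otimes> X (a + 1) \<otimes> E\<^sub>o i As =
           (X a \<otimes> \<Phi> a \<oplus> \<kappa> q \<otimes> X (a + 1) \<ominus> X a) \<otimes> E\<^sub>o i As)
      \<and>
      ((i a \<noteq> i (a + 1) \<and> same_block (set As) a (a + 1)) \<or> \<not> same_block (set As) a (a + 1) \<longrightarrow>
         X (a + 1) \<otimes> \<Phi> a \<otimes> E\<^sub>o i As = \<Phi> a \<otimes> X a \<otimes> E\<^sub>o i As)
      \<and>
      (i a = i (a + 1) \<and> same_block (set As) a (a + 1) \<longrightarrow>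
         X (a + 1) \<otimes> \<Phi> a \<otimes> E\<^sub>o i As =
           (\<Phi> a \<otimes> X a \<oplus> \<kappa> q \<otimes> X (a + 1) \<ominus> X a) \<otimes> E\<^sub>o i As)
      \<and>
      \<Phi> a [^] (2::nat) \<otimes> E\<^sub>o i As =
        (if i a \<noteq> i (a + 1) \<and> same_block (set As) a (a + 1) then
           (\<kappa> q \<otimes> X a \<ominus> X (a + 1)) \<otimes> (X a \<ominus> \<kappa> q \<otimes> X (a + 1)) \<otimes>
             inv_on Y (eI i) ((X a \<ominus> X (a + 1)) [^] (2::nat)) (E\<^sub>o i As)
         else if i a = i (a + 1) \<and> same_block (set As) a (a + 1) then
           \<kappa> (q + 1) \<otimes> \<Phi> a \<otimes> E\<^sub>o i As
         else \<kappa> q \<otimes> E\<^sub>o i As)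
      \<and>
      (a + 2 \<le> n \<longrightarrow>
         \<Phi> a \<otimes> \<Phi> (a + 1) \<otimes> \<Phi> a \<otimes> E\<^sub>o i As =
           (if i a = i (a + 1) \<and> i (a + 1) = i (a + 2) \<and>
               same_block (set As) a (a + 1) \<and> same_block (set As) (a + 1) (a + 2) then
              (\<Phi> (a + 1) \<otimes> \<Phi> a \<otimes> \<Phi> (a + 1) \<oplus> \<kappa> q \<otimes> \<Phi> a \<ominus> \<kappa> q \<otimes> \<Phi> (a + 1)) \<otimes> E\<^sub>o i As
            else if i a = i (a + 2) \<and> i (a + 2) \<noteq> i (a + 1) \<and>
               same_block (set As) a (a + 1) \<and> same_block (set As) (a + 1) (a + 2) then
              \<Phi> (a + 1) \<otimes> \<Phi> a \<otimes> \<Phi> (a + 1) \<otimes> E\<^sub>o i As \<oplus>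
              \<kappa> ((1 - q)\<^sup>2) \<otimes>
                (X a \<otimes> X (a + 2) \<ominus> X (a + 1) [^] (2::nat)) \<otimes>
                (X a \<otimes> X (a + 1) \<ominus> \<kappa> q \<otimes> X (a + 1) \<otimes> X (a + 2)) \<otimes>
                inv_on Y (eI i)
                  ((X a \<ominus> X (a + 1)) [^] (2::nat) \<otimes> (X (a + 1) \<ominus> X (a + 2)) [^] (2::nat)) (E\<^sub>o i As)
            else \<Phi> (a + 1) \<otimes> \<Phi> a \<otimes> \<Phi> (a + 1) \<otimes> E\<^sub>o i As)))"
proof -
  have hyps: "1 \<le> n \<and> 1 \<le> d \<and> (CHAR('k) = 0 \<or> coprime d CHAR('k)) \<and> primitive_root_of_unity d \<xi> \<and>
      q \<noteq> 0 \<and> q \<noteq> 1 \<and> i \<in> YH_I n q \<and> 1 \<le> a \<and> a < n"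
    using assms(1-9) by blast
  note rel = relations_hold_all[of d n q, unfolded relations_hold_def, THEN spec[where x = \<xi>],
      THEN spec[where x = i], THEN spec[where x = a], THEN mp, OF hyps]
  show ?thesis
    unfolding Y_def \<kappa>_def X_def \<Phi>_def eI_def E_def E\<^sub>o_def \<sigma>_def
    using rel[unfolded block_relations_def Let_def] .
qed

end
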